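(* Let $G/P_{\mathtt i}$ be an irreducible compact Hermitian symmetric space. Given $w\in W^{\mathfrak p}$ whose Schubert variety $X_w$ is proper, let $\mathfrak g=\bigoplus\mathfrak g_{j,k}$ be the $(Z_{\mathtt i},Z_w)$-bigraded decomposition of $\mathfrak g$. Then $$\mathfrak n_w=\mathfrak g_{-1,0}\oplus\mathfrak g_{-1,-1}\oplus\cdots\oplus\mathfrak g_{-1,-\mathsf a(w)}.$$
   Context: Setting. $\mathfrak g$ is a complex simple Lie algebra with Cartan subalgebra $\mathfrak h$, roots $\Delta$, positive/negative roots $\Delta^\pm$, simple roots $\alpha_1,\dots,\alpha_n$, root spaces $\mathfrak g_\beta$, and Weyl group $W$; $Z_1,\dots,Z_n$ is the basis of $\mathfrak h$ dual to the simple roots. Fix an index $\mathtt i$ such that every root takes values in $\{-1,0,1\}$ on $Z_{\mathtt i}$, so $\mathfrak g=\mathfrak g_{-1}\oplus\mathfrak g_0\oplus\mathfrak g_1$ where $\mathfrak g_j$ is the $j$-eigenspace of $\mathrm{ad}(Z_{\mathtt i})$; $\mathfrak p=\mathfrak g_0\oplus\mathfrak g_1$, and $G/P_{\mathtt i}$ is the corresponding irreducible compact Hermitian symmetric space. For $w\in W$ put $\Delta(w)=w\Delta^-\cap\Delta^+$ and $W^{\mathfrak p}=\{w\in W: \mathfrak g_\alpha\subset\mathfrak g_1\ \forall\alpha\in\Delta(w)\}$. For $w\in W^{\mathfrak p}$ put $\mathfrak n_w=\bigoplus_{\alpha\in\Delta(w)}\mathfrak g_{-\alpha}\subset\mathfrak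 g_{-1}$. $X_w$ is the closure of $Bw^{-1}\cdot o$ (where $B$ is the Borel subgroup of the positive roots and $o=P_{\mathtt i}$); it is proper if it is neither a point nor $G/P_{\mathtt i}$, equivalently $\{0\}\ne\mathfrak n_w\neq\mathfrak g_{-1}$. Let $I_{\mathfrak p}=\{1,\dots,n\}\setminus\{\mathtt i\}$, $\mathtt J(w)=\{\mathtt j\in I_{\mathfrak p}:[\mathfrak g_{-\alpha_{\mathtt j}},\mathfrak n_w]\not\subset\mathfrak n_w\}$, $Z_w=\sum_{\mathtt j\in\mathtt J(w)}Z_{\mathtt j}$, $\mathsf a(w)=\max\{\alpha(Z_w):\alpha\in\Delta(w)\}\in\mathbb Z_{\ge0}$, and $\mathfrak g_{j,k}=\{u\in\mathfrak g:[Z_{\mathtt i},u]=j\,u,\ [Z_w,u]=k\,u\}$. *)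

theory Defs
  imports "HOL-Analysis.Analysis"
begin

text \<open>The sum of the subspaces \<open>V k\<close>, \<open>k \<in> K\<close> (with \<open>K\<close> finite), is direct and equal to \<open>A\<close>.\<close>

definition internal_direct_sum :: "'k set \<Rightarrow> ('k \<Rightarrow> 'g set) \<Rightarrow> 'g::comm_monoid_add set \<Rightarrow> bool"
  where "internal_direct_sum K V A \<longleftrightarrow>
    A = {(\<Sum>k\<in>K. v k) |v. \<forall>k\<in>K. v k \<in> V k} \<and>
    (\<forall>v. (\<forall>k\<in>K. v k \<in> V k) \<and> (\<Sum>k\<in>K. v k) = 0 \<longrightarrow> (\<forall>k\<in>K. v k = 0))"


section \<open>Finite-dimensional complex Lie algebras\<close>

locale complex_lie_algebra = vector_space scale
  for scale :: "complex \<Rightarrow> 'g::ab_group_add \<Rightarrow> 'g" (infixr \<open>*\<^sub>C\<close> 75) +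
  fixes bracket :: "'g \<Rightarrow> 'g \<Rightarrow> 'g"
  assumes finite_dim: "\<exists>F. finite F \<and> span F = UNIV"
    and bracket_add_left: "bracket (x + y) z = bracket x z + bracket y z"
    and bracket_add_right: "bracket x (y + z) = bracket x y + bracket x z"
    and bracket_scale_left: "bracket (c *\<^sub>C x) y = c *\<^sub>C bracket x y"
    and bracket_scale_right: "bracket x (c *\<^sub>C y) = c *\<^sub>C bracket x y"
    and bracket_self: "bracket x x = 0"
    and jacobi: "bracket x (bracket y z) + bracket y (bracket z x) + bracket z (bracket x y) = 0"
begin

definition bracket_space :: "'g set \<Rightarrow> 'g set \<Rightarrow> 'g set"
  where "bracket_space A B = span {bracket x y |x y. x \<in> A \<and> y \<in> B}"

definition lie_ideal :: "'g set \<Rightarrow> bool"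
  where "lie_ideal I \<longleftrightarrow> subspace I \<and> (\<forall>x. \<forall>y\<in>I. bracket x y \<in> I)"

definition simple :: bool
  where "simple \<longleftrightarrow> (\<exists>x y. bracket x y \<noteq> 0) \<and> (\<forall>I. lie_ideal I \<longrightarrow> I = {0} \<or> I = UNIV)"

definition abelian_subalgebra :: "'g set \<Rightarrow> bool"
  where "abelian_subalgebra K \<longleftrightarrow> subspace K \<and> (\<forall>x\<in>K. \<forall>y\<in>K. bracket x y = 0)"

text \<open>Over the complex numbers, \<open>ad h\<close> is semisimple iff its eigenvectors span.\<close>

definition ad_semisimple :: "'g \<Rightarrow> bool"
  where "ad_semisimple h \<longleftrightarrow> span {x. \<exists>c. bracket h x = c *\<^sub>C x} = UNIV"

text \<open>Cartan subalgebras of a complex semisimple Lie algebra: maximal abelian subalgebras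
  all of whose elements are ad-semisimple.\<close>

definition cartan_subalgebra :: "'g set \<Rightarrow> bool"
  where "cartan_subalgebra H \<longleftrightarrow>
    abelian_subalgebra H \<and> (\<forall>K. abelian_subalgebra K \<and> H \<subseteq> K \<longrightarrow> K = H) \<and>
    (\<forall>h\<in>H. ad_semisimple h)"


subsection \<open>Roots and the Weyl group\<close>

text \<open>The dual space of a subspace \<open>H\<close>. A functional on \<open>H\<close> is encoded as a function on the whole
  algebra that vanishes outside \<open>H\<close>, so that equality of functionals is equality of functions.\<close>

definition dual_space :: "'g set \<Rightarrow> ('g \<Rightarrow> complex) set"
  where "dual_space H = {\<phi>. (\<forall>x\<in>H. \<forall>y\<in>H. \<phi> (x + y) = \<phi> x + \<phi> y) \<and>
    (\<forall>c. \<forall>x\<in>H. \<phi> (c *\<^sub>C x) = c * \<phi> x) \<and> (\<forall>x. x \<notin> H \<longrightarrow> \<phi> x = 0)}"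

definition root_space :: "'g set \<Rightarrow> ('g \<Rightarrow> complex) \<Rightarrow> 'g set"
  where "root_space H \<beta> = {x. \<forall>h\<in>H. bracket h x = \<beta> h *\<^sub>C x}"

definition roots :: "'g set \<Rightarrow> ('g \<Rightarrow> complex) set"
  where "roots H = {\<beta> \<in> dual_space H. \<beta> \<noteq> (\<lambda>_. 0) \<and> root_space H \<beta> \<noteq> {0}}"

text \<open>The coroot is the element \<open>t\<close> of the line \<open>[\<gg>\<^sub>\<beta>, \<gg>\<^sub>-\<^sub>\<beta>]\<close> with \<open>\<beta>(t) = 2\<close>.\<close>

definition coroot :: "'g set \<Rightarrow> ('g \<Rightarrow> complex) \<Rightarrow> 'g"
  where "coroot H \<beta> =
    (THE t. t \<in> bracket_space (root_space H \<beta>) (root_space H (\<lambda>h. - \<beta> h)) \<and> \<beta> t = 2)"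

text \<open>Reflections are extended by the identity outside the dual space, so that composition and
  \<open>inv\<close> on the function type restrict to the Weyl group of \<open>H\<close>.\<close>

definition reflection :: "'g set \<Rightarrow> ('g \<Rightarrow> complex) \<Rightarrow> ('g \<Rightarrow> complex) \<Rightarrow> ('g \<Rightarrow> complex)"
  where "reflection H \<beta> \<phi> =
    (if \<phi> \<in> dual_space H then (\<lambda>h. \<phi> h - \<phi> (coroot H \<beta>) * \<beta> h) else \<phi>)"

inductive_set weyl_group :: "'g set \<Rightarrow> (('g \<Rightarrow> complex) \<Rightarrow> ('g \<Rightarrow> complex)) set" for H
  where
    weyl_id: "id \<in> weyl_group H"
  | weyl_reflection: "\<beta> \<in> roots H \<Longrightarrow> w \<in> weyl_group H \<Longrightarrow> reflection H \<beta> \<circ> w \<in> weyl_group H"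

text \<open>\<open>\<alpha> 1, \<dots>, \<alpha> n\<close> is a base of the root system.\<close>

definition simple_system :: "'g set \<Rightarrow> nat \<Rightarrow> (nat \<Rightarrow> 'g \<Rightarrow> complex) \<Rightarrow> bool"
  where "simple_system H n \<alpha> \<longleftrightarrow>
    (\<forall>j\<in>{1..n}. \<alpha> j \<in> roots H) \<and>
    (\<forall>c::nat \<Rightarrow> complex. (\<lambda>h. \<Sum>j\<in>{1..n}. c j * \<alpha> j h) = (\<lambda>_. 0) \<longrightarrow> (\<forall>j\<in>{1..n}. c j = 0)) \<and>
    (\<forall>\<beta>\<in>roots H. \<exists>c::nat \<Rightarrow> int.
       ((\<forall>j\<in>{1..n}. c j \<ge> 0) \<or> (\<forall>j\<in>{1..n}. c j \<le> 0)) \<and>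
       \<beta> = (\<lambda>h. \<Sum>j\<in>{1..n}. of_int (c j) * \<alpha> j h))"

definition pos_roots :: "'g set \<Rightarrow> nat \<Rightarrow> (nat \<Rightarrow> 'g \<Rightarrow> complex) \<Rightarrow> ('g \<Rightarrow> complex) set"
  where "pos_roots H n \<alpha> =
    {\<beta> \<in> roots H. \<exists>c::nat \<Rightarrow> nat. \<beta> = (\<lambda>h. \<Sum>j\<in>{1..n}. of_nat (c j) * \<alpha> j h)}"

definition neg_roots :: "'g set \<Rightarrow> nat \<Rightarrow> (nat \<Rightarrow> 'g \<Rightarrow> complex) \<Rightarrow> ('g \<Rightarrow> complex) set"
  where "neg_roots H n \<alpha> =
    {\<beta> \<in> roots H. \<exists>c::nat \<Rightarrow> nat. \<beta> = (\<lambda>h. - (\<Sum>j\<in>{1..n}. of_nat (c j) * \<alpha> j h))}"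


subsection \<open>The adjoint group\<close>

text \<open>\<open>exp (ad x)\<close>, as the sum of the exponential series in the finite-dimensional space of
  endomorphisms: convergence is tested on all linear functionals.\<close>

definition exp_ad :: "'g \<Rightarrow> 'g \<Rightarrow> 'g"
  where "exp_ad x y = (THE z. \<forall>\<phi>. Vector_Spaces.linear scale (*) \<phi> \<longrightarrow>
    (\<lambda>k. \<phi> ((bracket x ^^ k) y) / fact k) sums \<phi> z)"

text \<open>For a subalgebra \<open>K\<close>, the connected subgroup of the adjoint group with Lie algebra \<open>K\<close>,
  that is, the group generated by the \<open>exp (ad x)\<close> with \<open>x \<in> K\<close>. Closure under inverses is
  automatic, since the inverse of \<open>exp (ad x)\<close> is \<open>exp (ad (- x))\<close>.\<close>

inductive_set connected_subgroup :: "'g set \<Rightarrow> ('g \<Rightarrow> 'g) set" for K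
  where
    id: "id \<in> connected_subgroup K"
  | exp: "x \<in> K \<Longrightarrow> g \<in> connected_subgroup K \<Longrightarrow> exp_ad x \<circ> g \<in> connected_subgroup K"

definition adjoint_group :: "('g \<Rightarrow> 'g) set"
  where "adjoint_group = connected_subgroup UNIV"

text \<open>The usual (analytic) topology of the adjoint group as a group of endomorphisms; it is the
  initial topology of the matrix coefficients \<open>g \<mapsto> \<phi> (g x)\<close>.\<close>

definition adjoint_topology :: "('g \<Rightarrow> 'g) topology"
  where "adjoint_topology = subtopology
    (topology_generated_by
      {{g. \<phi> (g x) \<in> U} |\<phi> x U. Vector_Spaces.linear scale (*) \<phi> \<and> open U})
    adjoint_group"

text \<open>The elements of \<open>N\<^sub>G(H)\<close> that induce the Weyl group element \<open>v\<close> on the dual of \<open>H\<close>;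
  \<open>g\<close> acts on functionals by \<open>\<phi> \<mapsto> \<phi> \<circ> g\<inverse>\<close>.\<close>

definition weyl_lifts :: "'g set \<Rightarrow> (('g \<Rightarrow> complex) \<Rightarrow> ('g \<Rightarrow> complex)) \<Rightarrow> ('g \<Rightarrow> 'g) set"
  where "weyl_lifts H v = {g \<in> adjoint_group. g ` H = H \<and>
    (\<forall>\<phi>\<in>dual_space H. \<forall>h\<in>H. v \<phi> (g h) = \<phi> h)}"

end


section \<open>Irreducible compact Hermitian symmetric spaces\<close>

text \<open>A complex simple Lie algebra with Cartan subalgebra \<open>H\<close>, simple roots \<open>\<alpha> 1, \<dots>, \<alpha> n\<close>, dual
  basis \<open>Z 1, \<dots>, Z n\<close> of \<open>H\<close>, and a node \<open>i\<close> with \<open>Z i\<close> grading the algebra in degrees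
  \<open>-1, 0, 1\<close>.\<close>

locale hermitian_symmetric = complex_lie_algebra scale bracket
  for scale :: "complex \<Rightarrow> 'g::ab_group_add \<Rightarrow> 'g" (infixr \<open>*\<^sub>C\<close> 75)
    and bracket :: "'g \<Rightarrow> 'g \<Rightarrow> 'g" +
  fixes H :: "'g set" and n :: nat and \<alpha> :: "nat \<Rightarrow> 'g \<Rightarrow> complex"
    and Z :: "nat \<Rightarrow> 'g" and i :: nat
  assumes simple: "simple"
    and cartan: "cartan_subalgebra H"
    and simple_system: "simple_system H n \<alpha>"
    and Z_span: "span (Z ` {1..n}) = H"
    and Z_dual: "\<And>j k. j \<in> {1..n} \<Longrightarrow> k \<in> {1..n} \<Longrightarrow> \<alpha> j (Z k) = (if j = k then 1 else 0)"
    and node: "i \<in> {1..n}"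
    and cominuscule: "\<And>\<beta>. \<beta> \<in> roots H \<Longrightarrow> \<beta> (Z i) \<in> {-1, 0, 1}"
begin

definition grade :: "int \<Rightarrow> 'g set"
  where "grade j = {u. bracket (Z i) u = of_int j *\<^sub>C u}"

definition parabolic :: "'g set"
  where "parabolic = span (grade 0 \<union> grade 1)"

definition borel :: "'g set"
  where "borel = span (H \<union> (\<Union>\<beta>\<in>pos_roots H n \<alpha>. root_space H \<beta>))"


subsection \<open>The homogeneous space \<open>G/P\<close>\<close>

definition P_group :: "('g \<Rightarrow> 'g) set"
  where "P_group = {g \<in> adjoint_group. g ` parabolic = parabolic}"

definition coset :: "('g \<Rightarrow> 'g) \<Rightarrow> ('g \<Rightarrow> 'g) set"
  where "coset g = {g \<circ> q |q. q \<in> P_group}"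

definition G_mod_P :: "('g \<Rightarrow> 'g) set set"
  where "G_mod_P = coset ` adjoint_group"

definition G_mod_P_topology :: "('g \<Rightarrow> 'g) set topology"
  where "G_mod_P_topology =
    topology (\<lambda>U. U \<subseteq> G_mod_P \<and> openin adjoint_topology {g \<in> adjoint_group. coset g \<in> U})"

lemma openin_G_mod_P_topology:
  "openin G_mod_P_topology U \<longleftrightarrow>
    U \<subseteq> G_mod_P \<and> openin adjoint_topology {g \<in> adjoint_group. coset g \<in> U}"
proof -
  have int: "{g \<in> adjoint_group. coset g \<in> S \<inter> T} =
      {g \<in> adjoint_group. coset g \<in> S} \<inter> {g \<in> adjoint_group. coset g \<in> T}" for S T
    by blast
  have un: "{g \<in> adjoint_group. coset g \<in> \<Union>K} =
      (\<Union>S\<in>K. {g \<in> adjoint_group. coset g \<in> S})" for K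
    by blast
  have "istopology (\<lambda>U. U \<subseteq> G_mod_P \<and>
      openin adjoint_topology {g \<in> adjoint_group. coset g \<in> U})"
    unfolding istopology_def int un by blast
  then show ?thesis
    by (simp add: G_mod_P_topology_def topology_inverse')
qed


subsection \<open>Schubert varieties\<close>

definition inversions :: "(('g \<Rightarrow> complex) \<Rightarrow> ('g \<Rightarrow> complex)) \<Rightarrow> ('g \<Rightarrow> complex) set"
  where "inversions w = w ` neg_roots H n \<alpha> \<inter> pos_roots H n \<alpha>"

definition W_p :: "(('g \<Rightarrow> complex) \<Rightarrow> ('g \<Rightarrow> complex)) set"
  where "W_p = {w \<in> weyl_group H. \<forall>\<beta>\<in>inversions w. root_space H \<beta> \<subseteq> grade 1}"

text \<open>The closure of \<open>B w\<inverse> \<cdot> o\<close>. For these constructible sets the analytic and the Zariski closure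
  agree.\<close>

definition schubert_variety ::
    "(('g \<Rightarrow> complex) \<Rightarrow> ('g \<Rightarrow> complex)) \<Rightarrow> ('g \<Rightarrow> 'g) set set"
  where "schubert_variety w = G_mod_P_topology closure_of
    {coset (b \<circ> g) |b g. b \<in> connected_subgroup borel \<and> g \<in> weyl_lifts H (inv w)}"

definition schubert_proper :: "(('g \<Rightarrow> complex) \<Rightarrow> ('g \<Rightarrow> complex)) \<Rightarrow> bool"
  where "schubert_proper w \<longleftrightarrow>
    \<not> (\<exists>p. schubert_variety w = {p}) \<and> schubert_variety w \<noteq> G_mod_P"

definition n_w :: "(('g \<Rightarrow> complex) \<Rightarrow> ('g \<Rightarrow> complex)) \<Rightarrow> 'g set"
  where "n_w w = span (\<Union>\<beta>\<in>inversions w. root_space H (\<lambda>h. - \<beta> h))"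

definition J_w :: "(('g \<Rightarrow> complex) \<Rightarrow> ('g \<Rightarrow> complex)) \<Rightarrow> nat set"
  where "J_w w = {j \<in> {1..n} - {i}.
    \<not> bracket_space (root_space H (\<lambda>h. - \<alpha> j h)) (n_w w) \<subseteq> n_w w}"

definition Z_w :: "(('g \<Rightarrow> complex) \<Rightarrow> ('g \<Rightarrow> complex)) \<Rightarrow> 'g"
  where "Z_w w = (\<Sum>j\<in>J_w w. Z j)"

definition a_w :: "(('g \<Rightarrow> complex) \<Rightarrow> ('g \<Rightarrow> complex)) \<Rightarrow> int"
  where "a_w w = Max {k. \<exists>\<beta>\<in>inversions w. \<beta> (Z_w w) = of_int k}"

definition bigrade :: "(('g \<Rightarrow> complex) \<Rightarrow> ('g \<Rightarrow> complex)) \<Rightarrow> int \<Rightarrow> int \<Rightarrow> 'g set"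
  where "bigrade w j k =
    {u. bracket (Z i) u = of_int j *\<^sub>C u \<and> bracket (Z_w w) u = of_int k *\<^sub>C u}"

end

end

theory Submission
  imports Defs "HOL-Library.Function_Algebras"
begin

text \<open>Write \<open>\<Delta>\<^sub>1\<close> for the roots \<open>\<beta>\<close> with \<open>\<beta> (Z i) = 1\<close>. Everything reduces to the claim that \<open>\<Delta>(w)\<close>
  consists of the \<open>\<beta> \<in> \<Delta>\<^sub>1\<close> with \<open>\<beta> (Z_w) \<le> a(w)\<close>. Grade the roots \<open>\<gamma>\<close> by the integer \<open>(w \<gamma>) (Z i)\<close>, which
  is \<open>-1\<close>, \<open>0\<close> or \<open>1\<close>, and let \<open>E \<gamma>\<close> be the sum of the coefficients of \<open>\<gamma>\<close> at the simple roots of degree \<open>1\<close>.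
  A root \<open>\<beta> \<in> \<Delta>\<^sub>1\<close> belongs to \<open>\<Delta>(w)\<close> if and only if \<open>E (w\<inverse> \<beta>) \<le> 0\<close>, and the value \<open>0\<close> is attained on
  \<open>\<Delta>(w)\<close>. It remains to see that for \<open>j \<noteq> i\<close> the number \<open>E (w\<inverse> \<alpha> j)\<close> is \<open>1\<close> for \<open>j \<in> J(w)\<close> and \<open>0\<close> otherwise.

  For \<open>j \<noteq> i\<close> the root \<open>\<theta> = w\<inverse> \<alpha> j\<close> is positive of degree \<open>0\<close> and not a sum of two such roots. If
  \<open>j \<in> J(w)\<close>, then \<open>\<theta> = x + y\<close> with positive roots \<open>x\<close> and \<open>y\<close> of degrees \<open>1\<close> and \<open>-1\<close>. By the Jacobi identity one can
  move simple roots of degree \<open>0\<close> from \<open>y\<close> to \<open>x\<close> until \<open>y\<close> is simple, so \<open>E y = 0\<close>; symmetrically \<open>E x = 1\<close>.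
  If \<open>j \<notin> J(w)\<close>, then \<open>\<theta>\<close> is a simple root of degree \<open>0\<close>.

  Properness excludes \<open>\<Delta>(w) = \<emptyset>\<close>: otherwise \<open>w\<close> preserves the positive roots, so \<open>w = id\<close> by
  the exchange property, and \<open>X_w\<close> is the point \<open>P\<close>. The structure theory is elementary, since the Cartan subalgebra is
  given together with a base: the Killing form is nondegenerate on a simple algebra as soon as it is nonzero, and
  it is nonzero because the weights take integer values on the \<open>Z k\<close>.\<close>

text \<open>The link between \<open>E\<close> and \<open>Z_w w\<close> is additivity. For a root
  \<open>\<beta>\<close> with \<open>coef \<beta> i = 1\<close>, the number
  \<open>E (inv w \<beta>)\<close> is \<open>E (inv w (\<alpha> i))\<close> plus the other
  coefficients of \<open>\<beta>\<close>, weighted by \<open>E (inv w (\<alpha> j))\<close>. Once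
  these weights are known to be the indicator of \<open>J_w w\<close>, it is a constant plus
  \<open>\<beta> (Z_w w)\<close>, and the constant is \<open>- a_w w\<close> because the threshold 0
  is attained. The obstacle is the weight 1 for \<open>j \<in> J_w w\<close>. A positive root of
  degree 0 could contain many simple roots of degrees 1 and -1, and membership in
  \<open>J_w w\<close> yields a single decomposition into degrees 1 and -1, with no control over
  \<open>E\<close>. The only constraint is that \<open>inv w (\<alpha> j)\<close> is indecomposable
  in degree 0, a statement about pairs of roots. Hence a descent on pairs of roots instead of a
  computation with coefficients. The exponential series enters through properness: the Schubert
  variety is the closure of an orbit of a group generated by the maps \<open>exp_ad x\<close>, and
  identifying it for \<open>w = id\<close> requires that these maps are invertible
  automorphisms.\<close>

text \<open>If \<open>y = s + t\<close> with \<open>t\<close> of degree \<open>0\<close>, then \<open>x + s\<close> is not a root, since otherwise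
  \<open>\<theta> = (x + s) + t\<close>. Hence \<open>x + t\<close> is a root and \<open>(x + t, s)\<close> replaces \<open>(x, y)\<close>. A \<open>t\<close> of minimal
  height is simple, so that \<open>E t = 0\<close>.\<close>

lemma alternating_decomposition_vanishes:
  fixes R P S :: "'r::ab_group_add set" and ht :: "'r \<Rightarrow> nat" and g E :: "'r \<Rightarrow> int"
  assumes pos_sum: "\<And>x y. x \<in> P \<Longrightarrow> y \<in> P \<Longrightarrow> x + y \<in> R \<Longrightarrow> x + y \<in> P"
    and split: "\<And>x. x \<in> P \<Longrightarrow> x \<notin> S \<Longrightarrow> \<exists>s t. s \<in> P \<and> t \<in> P \<and> x = s + t"
    and jacobi: "\<And>x s t. x \<in> P \<Longrightarrow> s \<in> P \<Longrightarrow> t \<in> P \<Longrightarrow> s + t \<in> R \<Longrightarrow> x + (s + t) \<in> R \<Longrightarrow>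
      x + s \<in> R \<or> x + t \<in> R"
    and P_sub: "P \<subseteq> R"
    and ht_add: "\<And>x y. x \<in> P \<Longrightarrow> y \<in> P \<Longrightarrow> ht (x + y) = ht x + ht y"
    and ht_pos: "\<And>x. x \<in> P \<Longrightarrow> 0 < ht x"
    and g_add: "\<And>x y. x \<in> P \<Longrightarrow> y \<in> P \<Longrightarrow> g (x + y) = g x + g y"
    and g_range: "\<And>x. x \<in> P \<Longrightarrow> g x \<in> {-1, 0, 1}"
    and E_add: "\<And>x y. x \<in> P \<Longrightarrow> y \<in> P \<Longrightarrow> E (x + y) = E x + E y"
    and E_simple: "\<And>x. x \<in> P \<Longrightarrow> x \<in> S \<Longrightarrow> g x \<noteq> 1 \<Longrightarrow> E x = 0"
    and theta: "\<theta> \<in> P" "\<And>s t. s \<in> P \<Longrightarrow> t \<in> P \<Longrightarrow> g s = 0 \<Longrightarrow> g t = 0 \<Longrightarrow> s + t \<noteq> \<theta>"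
    and xy: "x \<in> P" "y \<in> P" "x + y = \<theta>" "g x = 1" "g y = -1"
  shows "E y = 0"
  using xy
proof (induction "ht y" arbitrary: x y rule: less_induct)
  case (less y x)
  note x = \<open>x \<in> P\<close> and y = \<open>y \<in> P\<close> and xy = \<open>x + y = \<theta>\<close> and gx = \<open>g x = 1\<close> and gy = \<open>g y = -1\<close>
  show ?case
  proof (cases "y \<in> S")
    case True
    then show ?thesis using E_simple y gy by simp
  next
    case False
    \<comment> \<open>Degrees 2 and -2 lie outside the range of \<open>g\<close>, and a sum that is
      a root would again belong to \<open>P\<close>.\<close>
    have no_sum: "a + b \<notin> R" if "a \<in> P" "b \<in> P" "\<bar>g a + g b\<bar> = 2" for a b
      using g_range[of "a + b"] g_add[of a b] pos_sum[of a b] that by auto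
    let ?D = "\<lambda>s t. s \<in> P \<and> t \<in> P \<and> g s = -1 \<and> g t = 0 \<and> y = s + t"
    obtain s0 t0 where st0: "s0 \<in> P" "t0 \<in> P" "y = s0 + t0"
      using split[OF y False] by blast
    then have "g s0 + g t0 = -1" using gy g_add by auto
    then have "?D s0 t0 \<or> ?D t0 s0"
      using g_range[of s0] g_range[of t0] st0 by (auto simp: add.commute)
    then obtain s1 t1 where "?D s1 t1" by blast
    \<comment> \<open>Minimality runs over all splittings of \<open>y\<close> into degrees -1 and 0,
      so a competitor may come with a different \<open>s\<close>.\<close>
    then obtain t where "\<exists>s. ?D s t" and t_min': "\<And>t'. \<exists>s. ?D s t' \<Longrightarrow> ht t \<le> ht t'"
      using ex_has_least_nat[of "\<lambda>t. \<exists>s. ?D s t" t1 ht] by blast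
    then obtain s where D: "s \<in> P" "t \<in> P" "g s = -1" "g t = 0" "y = s + t"
      by blast
    have t_min: "ht t \<le> ht t'" if "?D s' t'" for s' t'
      using t_min' that by blast
    have x_st: "x + (s + t) \<in> R" and st: "s + t \<in> R"
      using xy D theta(1) y P_sub by auto
    have "x + s \<notin> R"
    proof
      assume "x + s \<in> R"
      then have "x + s \<in> P" "g (x + s) = 0" using pos_sum g_add x D gx by auto
      moreover have "(x + s) + t = \<theta>" using xy D by (simp add: add.assoc)
      ultimately show False using theta(2) D by blast
    qed
    then have xt: "x + t \<in> R" using jacobi x_st st x D by blast
    have "t \<in> S"
    proof (rule ccontr)
      assume "t \<notin> S"
      then obtain t1 t2 where t12: "t1 \<in> P" "t2 \<in> P" "t = t1 + t2" using split D by blast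
      have t12R: "t1 + t2 \<in> R" using t12 D P_sub by auto
      have "g t1 + g t2 = 0" using D t12 g_add by auto
      then consider "g t1 = 0" "g t2 = 0" | "\<bar>g t1\<bar> = 1" "g t2 = - g t1"
        using g_range[of t1] g_range[of t2] t12 by auto
      then show False
      proof cases
        case 1
        \<comment> \<open>By the Jacobi identity one of the two summands of \<open>t\<close> can be
          absorbed into \<open>s\<close>, which leaves a summand of smaller height.\<close>
        have *: False if "a \<in> P" "b \<in> P" "t = a + b" "g a = 0" "g b = 0" "s + a \<in> R" for a b
        proof -
          have "s + a \<in> P" "g (s + a) = -1" using that D pos_sum g_add by auto
          then have "?D (s + a) b" using that D by (simp add: add.assoc)
          then have "ht t \<le> ht b" by (rule t_min)
          then show False using that ht_add ht_pos by fastforce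
        qed
        have "s + t1 \<in> R \<or> s + t2 \<in> R"
          using jacobi[of s t1 t2] D t12 t12R st by simp
        then show False using *[of t1 t2] *[of t2 t1] t12 1 by (auto simp: add.commute)
      next
        case 2
        \<comment> \<open>The sums \<open>x + a\<close> and \<open>s + b\<close> would have degrees
          2 and -2. The Jacobi identity therefore makes \<open>x + b\<close> and
          \<open>s + a\<close> roots; both have degree 0 and together they give
          \<open>\<theta>\<close>, against its indecomposability.\<close>
        have *: False if ab: "a \<in> P" "b \<in> P" "t = a + b" "g a = 1" "g b = -1" for a b
        proof -
          have abR: "a + b \<in> R" using ab D P_sub by auto
          have "x + a \<notin> R" "s + b \<notin> R" using no_sum ab x gx D by auto
          then have "x + b \<in> R" "s + a \<in> R"
            using jacobi[of x a b] jacobi[of s a b] ab D x abR xt st by auto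
          then have "x + b \<in> P" "s + a \<in> P" "g (x + b) = 0" "g (s + a) = 0"
            using pos_sum g_add x D ab gx by auto
          moreover have "(x + b) + (s + a) = \<theta>"
            using xy D ab by (metis add.assoc add.commute)
          ultimately show False using theta(2) by blast
        qed
        show False using 2 *[of t1 t2] *[of t2 t1] t12 g_range[of t1] by (auto simp: add.commute)
      qed
    qed
    then have Et: "E t = 0" using E_simple D by simp
    have "E s = 0"
    proof (rule less.hyps)
      show "ht s < ht y" using ht_add ht_pos D by simp
      show "x + t \<in> P" "g (x + t) = 1" using pos_sum g_add xt x D gx by auto
      show "(x + t) + s = \<theta>" using xy D by (metis add.assoc add.commute)
    qed (use D in auto)
    then show ?thesis using Et D E_add by simp
  qed
qed

section \<open>Elementary identities for the bracket\<close>

context complex_lie_algebra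
begin

lemma bracket_zero [simp]: "bracket 0 x = 0" "bracket x 0 = 0"
  using bracket_add_left[of 0 0 x] bracket_add_right[of x 0 0] by simp_all

lemma bracket_minus_left: "bracket (- x) y = - bracket x y"
  using bracket_add_left[of "- x" x y] by (simp add: eq_neg_iff_add_eq_0)

lemma bracket_minus_right: "bracket x (- y) = - bracket x y"
  using bracket_add_right[of x "- y" y] by (simp add: eq_neg_iff_add_eq_0)

lemma bracket_diff_right: "bracket x (y - z) = bracket x y - bracket x z"
  using bracket_add_right[of x y "- z"] bracket_minus_right by simp

lemma bracket_anticommute: "bracket x y = - bracket y x"
proof -
  have "bracket x y + bracket y x = bracket (x + y) (x + y)"
    unfolding bracket_add_left bracket_add_right by (simp add: bracket_self)
  then show ?thesis by (simp only: bracket_self eq_neg_iff_add_eq_0)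
qed

lemma bracket_sum_right: "bracket x (\<Sum>k\<in>A. f k) = (\<Sum>k\<in>A. bracket x (f k))"
  by (induction A rule: infinite_finite_induct) (simp_all add: bracket_add_right)

lemma bracket_sum_left: "bracket (\<Sum>k\<in>A. f k) x = (\<Sum>k\<in>A. bracket (f k) x)"
  by (induction A rule: infinite_finite_induct) (simp_all add: bracket_add_left)

lemma bracket_leibniz:
  "bracket x (bracket y z) = bracket (bracket x y) z + bracket y (bracket x z)"
proof -
  have "bracket z (bracket x y) = - bracket (bracket x y) z"
    "bracket y (bracket z x) = - bracket y (bracket x z)"
    using bracket_anticommute[of z] bracket_anticommute[of z x] by (simp_all add: bracket_minus_right)
  then show ?thesis using jacobi[of x y z] by (simp add: algebra_simps)
qed

lemma bracket_bracket_left: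
  "bracket (bracket x y) z = bracket x (bracket y z) - bracket y (bracket x z)"
  using bracket_leibniz[of x y z] by simp

lemma linear_bracket: "Vector_Spaces.linear scale scale (bracket x)"
  unfolding Vector_Spaces.linear_iff using bracket_add_right bracket_scale_right vector_space_axioms by auto

lemma bracket_span_right:
  assumes "y \<in> span S" "subspace V" "\<And>s. s \<in> S \<Longrightarrow> bracket x s \<in> V"
  shows "bracket x y \<in> V"
  using assms(1)
proof (induction rule: span_induct_alt)
  case base
  then show ?case using subspace_0[OF assms(2)] by simp
next
  case (step c s y)
  then show ?case
    using assms by (simp add: bracket_add_right bracket_scale_right subspace_add subspace_scale)
qed

lemma subspace_neg_iff: "subspace V \<Longrightarrow> - x \<in> V \<longleftrightarrow> x \<in> V"
  using subspace_neg[of V x] subspace_neg[of V "- x"] by auto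

lemma bracket_span_left:
  assumes "y \<in> span S" "subspace V" "\<And>s. s \<in> S \<Longrightarrow> bracket s x \<in> V"
  shows "bracket y x \<in> V"
  using bracket_span_right[OF assms(1,2), of x] assms(3)
  by (simp add: bracket_anticommute[of x] subspace_neg_iff[OF assms(2)])

subsection \<open>Weight spaces\<close>

lemma subspace_root_space: "subspace (root_space H \<mu>)"
  by (rule subspaceI)
    (simp_all add: root_space_def bracket_add_right bracket_scale_right scale_right_distrib mult.commute)

lemma root_spaceD: "x \<in> root_space H \<mu> \<Longrightarrow> h \<in> H \<Longrightarrow> bracket h x = \<mu> h *\<^sub>C x"
  by (simp add: root_space_def)

lemma bracket_root_space:
  assumes "x \<in> root_space H \<mu>" "y \<in> root_space H \<nu>"
  shows "bracket x y \<in> root_space H (\<mu> + \<nu>)"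
  using assms
  by (simp add: root_space_def bracket_leibniz[of _ x y] bracket_scale_left bracket_scale_right
      scale_left_distrib)

text \<open>Applying \<open>bracket h\<close> minus the scalar \<open>\<nu> h\<close> to the
  relation removes the component at \<open>\<nu>\<close> and multiplies the one at
  \<open>\<mu>\<close> by a nonzero number. The element \<open>h\<close> may depend on
  \<open>\<mu>\<close>, since the induction hypothesis is used for one \<open>\<mu>\<close> at a
  time.\<close>

lemma weight_vectors_independent:
  assumes "finite M" "\<And>\<mu> \<nu>. \<mu> \<in> M \<Longrightarrow> \<nu> \<in> M \<Longrightarrow> \<mu> \<noteq> \<nu> \<Longrightarrow> \<exists>h\<in>H. \<mu> h \<noteq> \<nu> h"
    and "\<And>\<mu>. \<mu> \<in> M \<Longrightarrow> v \<mu> \<in> root_space H \<mu>" "(\<Sum>\<mu>\<in>M. v \<mu>) = 0" "\<mu> \<in> M"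
  shows "v \<mu> = 0"
  using assms
proof (induction M arbitrary: v \<mu>)
  case (insert \<nu> M)
  have zero: "v \<mu> = 0" if mu: "\<mu> \<in> M" for \<mu>
  proof -
    obtain h where h: "h \<in> H" "\<mu> h \<noteq> \<nu> h" using insert.prems(1)[of \<mu> \<nu>] insert.hyps(2) mu by auto
    define u where "u \<mu> = (\<mu> h - \<nu> h) *\<^sub>C v \<mu>" for \<mu>
    have "0 = bracket h (\<Sum>\<mu>\<in>insert \<nu> M. v \<mu>) - \<nu> h *\<^sub>C (\<Sum>\<mu>\<in>insert \<nu> M. v \<mu>)"
      by (simp only: insert.prems(3) bracket_zero scale_zero_right diff_zero)
    also have "\<dots> = (\<Sum>\<mu>\<in>insert \<nu> M. bracket h (v \<mu>) - \<nu> h *\<^sub>C v \<mu>)"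
      by (simp add: bracket_sum_right scale_sum_right sum_subtractf del: sum.insert)
    also have "\<dots> = (\<Sum>\<mu>\<in>insert \<nu> M. u \<mu>)"
      using insert.prems(2) h by (intro sum.cong) (auto simp: u_def root_space_def scale_left_diff_distrib)
    also have "\<dots> = (\<Sum>\<mu>\<in>M. u \<mu>)" using insert.hyps by (simp add: u_def)
    finally have "(\<Sum>\<mu>\<in>M. u \<mu>) = 0" by simp
    moreover have "u \<mu> \<in> root_space H \<mu>" if "\<mu> \<in> M" for \<mu>
      unfolding u_def using insert.prems that subspace_scale[OF subspace_root_space] by auto
    ultimately have "u \<mu> = 0" using insert.IH[of u \<mu>] insert.prems mu by auto
    then show ?thesis using h by (simp add: u_def)
  qed
  then have "v \<nu> = 0" using insert by simp
  then show ?case using zero insert.prems by auto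
qed simp

lemma eigenvectors_independent:
  assumes "finite C" "\<And>c. c \<in> C \<Longrightarrow> bracket h (v c) = c *\<^sub>C v c" "(\<Sum>c\<in>C. v c) = 0" "c \<in> C"
  shows "v c = 0"
proof -
  let ?f = "\<lambda>c::complex. \<lambda>_::'g. c"
  have inj: "inj_on ?f C" by (auto simp: inj_on_def fun_eq_iff)
  \<comment> \<open>An eigenvalue is encoded as a constant weight on \<open>{h}\<close>;
    \<open>undefined\<close> is merely a point at which the constant is read back.\<close>
  have "v (?f c undefined) = 0"
  proof (rule weight_vectors_independent[where M = "?f ` C" and H = "{h}"
        and v = "\<lambda>\<mu>. v (\<mu> undefined)" and \<mu> = "?f c"])
    show "(\<Sum>\<mu>\<in>?f ` C. v (\<mu> undefined)) = 0" using assms inj by (simp add: sum.reindex)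
  qed (use assms in \<open>auto simp: root_space_def\<close>)
  then show ?thesis by simp
qed

subsection \<open>The Killing form\<close>

text \<open>The basis is an explicit argument so that it can later be taken to consist of weight
  vectors, in which the elements of the Cartan subalgebra act diagonally.\<close>

definition trace_on :: "'g set \<Rightarrow> ('g \<Rightarrow> 'g) \<Rightarrow> complex"
  where "trace_on B T = (\<Sum>b\<in>B. representation B (T b) b)"

definition killing :: "'g set \<Rightarrow> 'g \<Rightarrow> 'g \<Rightarrow> complex"
  where "killing B x y = trace_on B (\<lambda>z. bracket x (bracket y z))"

context
  fixes B
  assumes basis: "finite B" "independent B" "span B = UNIV"
begin

lemma sum_representation_basis: "(\<Sum>b\<in>B. representation B v b *\<^sub>C b) = v"
  using sum_representation_eq[of B v B] basis by auto

lemma representation_linear: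
  assumes "Vector_Spaces.linear scale scale S"
  shows "representation B (S v) a = (\<Sum>b\<in>B. representation B v b * representation B (S b) a)"
proof -
  interpret S: Vector_Spaces.linear scale scale S by fact
  have "representation B (S v) a = representation B (S (\<Sum>b\<in>B. representation B v b *\<^sub>C b)) a"
    by (simp add: sum_representation_basis)
  also have "\<dots> = representation B (\<Sum>b\<in>B. representation B v b *\<^sub>C S b) a"
    by (simp add: S.sum S.scale)
  also have "\<dots> = (\<Sum>b\<in>B. representation B v b * representation B (S b) a)"
    using basis by (simp add: representation_sum representation_scale)
  finally show ?thesis .
qed

lemma trace_on_commute:
  assumes S: "Vector_Spaces.linear scale scale S" and T: "Vector_Spaces.linear scale scale T"
  shows "trace_on B (\<lambda>z. S (T z)) = trace_on B (\<lambda>z. T (S z))"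
proof -
  have "trace_on B (\<lambda>z. S (T z)) =
      (\<Sum>a\<in>B. \<Sum>b\<in>B. representation B (T a) b * representation B (S b) a)"
    unfolding trace_on_def by (simp only: representation_linear[OF S, of "T _"])
  also have "\<dots> = (\<Sum>b\<in>B. \<Sum>a\<in>B. representation B (S b) a * representation B (T a) b)"
    by (subst sum.swap) (simp add: mult.commute)
  also have "\<dots> = trace_on B (\<lambda>z. T (S z))"
    unfolding trace_on_def by (simp only: representation_linear[OF T, of "S _"])
  finally show ?thesis .
qed

lemma trace_on_add: "trace_on B (\<lambda>z. S z + T z) = trace_on B S + trace_on B T"
  unfolding trace_on_def using basis by (simp add: representation_add sum.distrib)

lemma trace_on_diff: "trace_on B (\<lambda>z. S z - T z) = trace_on B S - trace_on B T"
  unfolding trace_on_def using basis by (simp add: representation_diff sum_subtractf)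

lemma trace_on_scale: "trace_on B (\<lambda>z. c *\<^sub>C S z) = c * trace_on B S"
  unfolding trace_on_def using basis by (simp add: representation_scale sum_distrib_left)

lemma killing_commute: "killing B x y = killing B y x"
  unfolding killing_def by (rule trace_on_commute; rule linear_bracket)

lemma killing_add_left: "killing B (x + y) z = killing B x z + killing B y z"
  unfolding killing_def by (simp add: bracket_add_left trace_on_add)

lemma killing_scale_left: "killing B (c *\<^sub>C x) y = c * killing B x y"
  unfolding killing_def by (simp add: bracket_scale_left trace_on_scale)

lemma killing_add_right: "killing B x (y + z) = killing B x y + killing B x z"
  by (simp add: killing_commute[of x] killing_add_left)

lemma killing_scale_right: "killing B x (c *\<^sub>C y) = c * killing B x y"
  by (simp add: killing_commute[of x] killing_scale_left)

lemma killing_zero: "killing B 0 x = 0" "killing B x 0 = 0"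
  using killing_scale_left[of 0 0 x] killing_scale_right[of x 0 0] by simp_all

lemma killing_diff_left: "killing B (x - y) z = killing B x z - killing B y z"
  using killing_add_left[of "x - y" y z] by simp

lemma killing_minus: "killing B (- x) y = - killing B x y" "killing B x (- y) = - killing B x y"
  using killing_add_left[of "- x" x y] killing_add_right[of x "- y" y]
  by (simp_all add: killing_zero eq_neg_iff_add_eq_0)

lemma killing_sum_right: "killing B x (\<Sum>k\<in>A. f k) = (\<Sum>k\<in>A. killing B x (f k))"
  by (induction A rule: infinite_finite_induct) (simp_all add: killing_zero killing_add_right)

lemma killing_sum_left: "killing B (\<Sum>k\<in>A. f k) x = (\<Sum>k\<in>A. killing B (f k) x)"
  by (induction A rule: infinite_finite_induct) (simp_all add: killing_zero killing_add_left)

text \<open>Expanding the inner brackets, the two sides are the traces of \<open>xyz - yxz\<close>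
  and of \<open>xyz - xzy\<close> in the adjoint representation; the last terms agree by cyclicity
  of the trace.\<close>

lemma killing_invariant: "killing B (bracket x y) z = killing B x (bracket y z)"
proof -
  have "Vector_Spaces.linear scale scale (bracket x \<circ> bracket z)"
    by (rule Vector_Spaces.linear_compose[OF linear_bracket linear_bracket])
  then have "trace_on B (\<lambda>v. bracket y (bracket x (bracket z v))) =
      trace_on B (\<lambda>v. bracket x (bracket z (bracket y v)))"
    using trace_on_commute[OF linear_bracket, of "bracket x \<circ> bracket z" y] by simp
  then show ?thesis
    unfolding killing_def
    by (simp add: bracket_bracket_left bracket_diff_right trace_on_diff)
qed

lemma killing_weight_orthogonal:
  assumes "x \<in> root_space H \<mu>" "y \<in> root_space H \<nu>" "h \<in> H" "\<mu> h + \<nu> h \<noteq> 0"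
  shows "killing B x y = 0"
proof -
  have "\<nu> h * killing B x y = killing B x (bracket h y)"
    using assms by (simp add: root_space_def killing_scale_right)
  also have "\<dots> = - killing B (bracket h x) y"
    by (simp add: killing_invariant[symmetric] bracket_anticommute[of x h] killing_minus)
  also have "\<dots> = - \<mu> h * killing B x y"
    using assms by (simp add: root_space_def killing_scale_left)
  finally have "(\<mu> h + \<nu> h) * killing B x y = 0" by (simp add: algebra_simps)
  then show ?thesis using assms by simp
qed

text \<open>Invariance moves a bracket from the first argument to the second. In a simple algebra
  this leaves only the alternatives of a zero or a nondegenerate form.\<close>

lemma lie_ideal_killing_radical: "lie_ideal {x. \<forall>y. killing B x y = 0}"
proof -
  have "killing B (bracket x y) z = 0" if "\<forall>z. killing B y z = 0" for x y z
    using that by (simp add: bracket_anticommute[of x y] killing_minus killing_invariant)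
  then show ?thesis
    unfolding lie_ideal_def subspace_def
    by (simp add: killing_zero killing_add_left killing_scale_left)
qed

end

section \<open>Sums of subspaces and common eigenvectors\<close>

lemma span_UN_subspaces:
  assumes "\<And>k. k \<in> K \<Longrightarrow> subspace (V k)" "x \<in> span (\<Union>k\<in>K. V k)"
  obtains M v where "finite M" "M \<subseteq> K" "\<And>k. k \<in> M \<Longrightarrow> v k \<in> V k" "x = (\<Sum>k\<in>M. v k)"
proof -
  have "\<exists>M v. finite M \<and> M \<subseteq> K \<and> (\<forall>k\<in>M. v k \<in> V k) \<and> x = (\<Sum>k\<in>M. v k)"
    using assms(2)
  proof (induction rule: span_induct_alt)
    case base
    show ?case by (intro exI[of _ "{}"]) simp
  next
    case (step c s y)
    then obtain M v where M: "finite M" "M \<subseteq> K" "\<forall>k\<in>M. v k \<in> V k" "y = (\<Sum>k\<in>M. v k)" by blast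
    obtain k where k: "k \<in> K" "s \<in> V k" using step by blast
    \<comment> \<open>The index \<open>k\<close> may already occur in \<open>M\<close>; extending
      the family by zero lets the new summand be added to the old one at \<open>k\<close>.\<close>
    define v' where "v' l = (if l \<in> M then v l else 0)" for l
    define u where "u l = (if l = k then c *\<^sub>C s else 0) + v' l" for l
    have v'V: "v' l \<in> V l" if "l \<in> insert k M" for l
      using that M(2,3) k(1) subspace_0[OF assms(1)] by (auto simp: v'_def)
    have "u l \<in> V l" if l: "l \<in> insert k M" for l
    proof -
      have "l \<in> K" using l M(2) k(1) by blast
      moreover have "(if l = k then c *\<^sub>C s else 0) \<in> V l"
        using k subspace_scale[OF assms(1)] subspace_0[OF assms(1)[OF \<open>l \<in> K\<close>]] by auto
      ultimately show ?thesis
        unfolding u_def using subspace_add[OF assms(1)] v'V[OF l] by blast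
    qed
    moreover have "c *\<^sub>C s + y = (\<Sum>l\<in>insert k M. u l)"
    proof -
      have "(\<Sum>l\<in>insert k M. v' l) = (\<Sum>l\<in>M. v l)"
        by (rule sum.mono_neutral_cong_right) (use M(1) in \<open>auto simp: v'_def\<close>)
      moreover have "(\<Sum>l\<in>insert k M. if l = k then c *\<^sub>C s else 0) = c *\<^sub>C s"
        using M(1) by (subst sum.delta) auto
      ultimately show ?thesis unfolding u_def sum.distrib M(4) by (simp only:)
    qed
    ultimately show ?case
      using M(1,2) k(1) by (intro exI[of _ "insert k M"] exI[of _ u]) blast
  qed
  then show ?thesis using that by blast
qed

lemma span_UN_root_spaces:
  assumes "x \<in> span (\<Union>\<mu>\<in>K. root_space H \<mu>)"
  shows "\<exists>M v. finite M \<and> M \<subseteq> K \<and> (\<forall>\<mu>\<in>M. v \<mu> \<in> root_space H \<mu>) \<and> x = (\<Sum>\<mu>\<in>M. v \<mu>)"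
proof -
  obtain M v where "finite M" "M \<subseteq> K" "\<forall>\<mu>\<in>M. v \<mu> \<in> root_space H \<mu>" "x = (\<Sum>\<mu>\<in>M. v \<mu>)"
    by (rule span_UN_subspaces[OF subspace_root_space assms]) blast
  then show ?thesis by blast
qed

lemma ad_semisimple_eigenvector_sum:
  assumes "ad_semisimple h"
  obtains C v where "finite C" "\<And>c. c \<in> C \<Longrightarrow> bracket h (v c) = c *\<^sub>C v c" "x = (\<Sum>c\<in>C. v c)"
proof -
  have "{x. \<exists>c. bracket h x = c *\<^sub>C x} = (\<Union>c. root_space {h} (\<lambda>_. c))"
    by (auto simp: root_space_def)
  then have "x \<in> span (\<Union>c\<in>UNIV. root_space {h} (\<lambda>_. c))" using assms by (simp add: ad_semisimple_def)
  then obtain C v where v: "finite C" "\<And>c. c \<in> C \<Longrightarrow> v c \<in> root_space {h} (\<lambda>_. c)"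
    "x = (\<Sum>c\<in>C. v c)"
    using span_UN_subspaces[of UNIV "\<lambda>c. root_space {h} (\<lambda>_. c)" x] subspace_root_space by metis
  show ?thesis by (rule that[OF v(1) _ v(3)]) (use v(2) in \<open>simp add: root_space_def\<close>)
qed

text \<open>Split a common eigenvector \<open>x\<close> of \<open>S\<close> into eigenvectors
  \<open>v c\<close> of the new element \<open>h\<close>. If
  \<open>bracket k x = d *\<^sub>C x\<close>, then the defects of the \<open>v c\<close> from being
  eigenvectors of \<open>k\<close> with eigenvalue \<open>d\<close> sum to zero. As \<open>h\<close>
  and \<open>k\<close> commute, these defects are again eigenvectors of \<open>h\<close> with
  distinct eigenvalues, so each of them vanishes.\<close>

lemma simultaneous_eigenvectors_span:
  assumes "finite S" "\<And>h. h \<in> S \<Longrightarrow> ad_semisimple h"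
    and "\<And>h k. h \<in> S \<Longrightarrow> k \<in> S \<Longrightarrow> bracket h k = 0"
  shows "span {x. \<forall>h\<in>S. \<exists>c. bracket h x = c *\<^sub>C x} = UNIV"
  using assms
proof (induction S)
  case (insert h S)
  let ?V = "{x. \<forall>k\<in>S. \<exists>c. bracket k x = c *\<^sub>C x}"
  let ?V' = "{x. \<forall>k\<in>insert h S. \<exists>c. bracket k x = c *\<^sub>C x}"
  have "?V \<subseteq> span ?V'"
  proof
    fix x assume x: "x \<in> ?V"
    obtain C v where v: "finite C" "\<And>c. c \<in> C \<Longrightarrow> bracket h (v c) = c *\<^sub>C v c" "x = (\<Sum>c\<in>C. v c)"
      using ad_semisimple_eigenvector_sum insert.prems by blast
    have "v c \<in> ?V'" if c: "c \<in> C" for c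
    proof -
      have "\<exists>d. bracket k (v c) = d *\<^sub>C v c" if k: "k \<in> S" for k
      proof -
        obtain d where d: "bracket k x = d *\<^sub>C x" using x k by auto
        let ?u = "\<lambda>c. bracket k (v c) - d *\<^sub>C v c"
        have "(\<Sum>c\<in>C. ?u c) = bracket k x - d *\<^sub>C x"
          by (simp add: v(3) sum_subtractf bracket_sum_right scale_sum_right)
        then have sum0: "(\<Sum>c\<in>C. ?u c) = 0" using d by simp
        have hk: "bracket h k = 0" using insert.prems k by simp
        have "bracket h (?u c) = c *\<^sub>C ?u c" if "c \<in> C" for c
        proof -
          have "bracket h (bracket k (v c)) = c *\<^sub>C bracket k (v c)"
            using bracket_leibniz[of h k "v c"] v(2)[OF that] hk by (simp add: bracket_scale_right)
          then show ?thesis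
            using v(2)[OF that]
            by (simp add: bracket_diff_right bracket_scale_right scale_right_diff_distrib mult.commute)
        qed
        then have "?u c = 0" using eigenvectors_independent[OF v(1) _ sum0 c] by blast
        then show ?thesis by (intro exI[of _ d]) simp
      qed
      then show ?thesis using v(2)[OF c] by auto
    qed
    then show "x \<in> span ?V'" unfolding v(3) by (intro span_sum span_base) auto
  qed
  then have "span ?V \<subseteq> span ?V'" by (rule span_minimal) (rule subspace_span)
  then show ?case using insert by auto
qed simp

section \<open>The dual space and the roots\<close>

lemma dual_space_zero: "0 \<in> dual_space H"
  and dual_space_add: "\<phi> \<in> dual_space H \<Longrightarrow> \<psi> \<in> dual_space H \<Longrightarrow> \<phi> + \<psi> \<in> dual_space H"
  and dual_space_uminus: "\<phi> \<in> dual_space H \<Longrightarrow> - \<phi> \<in> dual_space H"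
  and dual_space_diff: "\<phi> \<in> dual_space H \<Longrightarrow> \<psi> \<in> dual_space H \<Longrightarrow> \<phi> - \<psi> \<in> dual_space H"
  and dual_space_scale: "\<phi> \<in> dual_space H \<Longrightarrow> (\<lambda>h. c * \<phi> h) \<in> dual_space H"
  by (auto simp: dual_space_def algebra_simps)

lemma rootsD:
  assumes "\<beta> \<in> roots H"
  shows "\<beta> \<in> dual_space H" "\<beta> \<noteq> 0" "\<exists>x. x \<in> root_space H \<beta> \<and> x \<noteq> 0"
  using assms subspace_0[OF subspace_root_space, of H \<beta>] by (auto simp: roots_def func_zero)

lemma rootsI:
  assumes "\<beta> \<in> dual_space H" "\<beta> \<noteq> 0" "x \<in> root_space H \<beta>" "x \<noteq> 0"
  shows "\<beta> \<in> roots H"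
  using assms by (auto simp: roots_def func_zero)

subsection \<open>The exponential of the adjoint representation\<close>

abbreviation functional :: "('g \<Rightarrow> complex) \<Rightarrow> bool"
  where "functional \<phi> \<equiv> Vector_Spaces.linear scale (*) \<phi>"

abbreviation endomorphism :: "('g \<Rightarrow> 'g) \<Rightarrow> bool"
  where "endomorphism T \<equiv> Vector_Spaces.linear scale scale T"

lemma functional_iff:
  "functional \<phi> \<longleftrightarrow> (\<forall>x y. \<phi> (x + y) = \<phi> x + \<phi> y) \<and> (\<forall>c x. \<phi> (c *\<^sub>C x) = c * \<phi> x)"
proof -
  have "vector_space ((*) :: complex \<Rightarrow> complex \<Rightarrow> complex)"
    by unfold_locales (simp_all add: algebra_simps)
  then show ?thesis unfolding Vector_Spaces.linear_iff using vector_space_axioms by blast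
qed

lemma endomorphism_iff:
  "endomorphism T \<longleftrightarrow> (\<forall>x y. T (x + y) = T x + T y) \<and> (\<forall>c x. T (c *\<^sub>C x) = c *\<^sub>C T x)"
  unfolding Vector_Spaces.linear_iff using vector_space_axioms by blast

lemma functional_add: "functional \<phi> \<Longrightarrow> \<phi> (x + y) = \<phi> x + \<phi> y"
  and functional_scale: "functional \<phi> \<Longrightarrow> \<phi> (c *\<^sub>C x) = c * \<phi> x"
  by (simp_all add: functional_iff)

lemma functional_sum: "functional \<phi> \<Longrightarrow> \<phi> (\<Sum>k\<in>A. f k) = (\<Sum>k\<in>A. \<phi> (f k))"
proof (induction A rule: infinite_finite_induct)
  case (infinite A)
  then show ?case using functional_scale[of \<phi> 0 0] by simp
next
  case empty
  then show ?case using functional_scale[of \<phi> 0 0] by simp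
qed (simp add: functional_add)

lemma functional_comp: "functional \<phi> \<Longrightarrow> endomorphism T \<Longrightarrow> functional (\<lambda>x. \<phi> (T x))"
  by (simp add: functional_iff endomorphism_iff)

lemma endomorphism_bracket_power: "endomorphism (bracket x ^^ k)"
  by (induction k) (auto simp: endomorphism_iff bracket_add_right bracket_scale_right)

text \<open>Take the coordinate at \<open>z\<close> in a basis that extends \<open>z\<close>
  together with a basis of \<open>V\<close>. The algebra has no topology of its own, so limits and
  closed conditions below are tested on such functionals.\<close>

lemma functional_vanishing_on_subspace:
  assumes "subspace V" "z \<notin> V"
  obtains \<phi> where "functional \<phi>" "\<And>v. v \<in> V \<Longrightarrow> \<phi> v = 0" "\<phi> z = 1"
proof -
  obtain C where C: "C \<subseteq> V" "independent C" "V \<subseteq> span C"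
    using maximal_independent_subset by blast
  have "span C \<subseteq> V" using C(1) assms(1) by (rule span_minimal)
  then have ind: "independent (insert z C)" using independent_insertI[of z C] C assms by blast
  let ?B = "extend_basis (insert z C)"
  have B: "insert z C \<subseteq> ?B" "independent ?B" "span ?B = UNIV"
    using extend_basis_superset[OF ind] independent_extend_basis[OF ind] span_extend_basis[OF ind] by auto
  show ?thesis
  proof (rule that)
    show lin: "functional (\<lambda>v. representation ?B v z)" by (rule linear_representation[OF B(2,3)])
    show "representation ?B z z = 1" using representation_basis[OF B(2), of z] B(1) by simp
    show "representation ?B v z = 0" if "v \<in> V" for v
    proof -
      have "z \<notin> C" using C assms by blast
      have "v \<in> span C" using C that by blast
      then show ?thesis
      proof (induction rule: span_induct_alt)
        case base
        then show ?case by (simp add: representation_zero)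
      next
        case (step c x y)
        then have "representation ?B x z = 0"
          using representation_basis[OF B(2), of x] B(1) \<open>z \<notin> C\<close> by auto
        then show ?case using step lin by (simp add: functional_iff)
      qed
    qed
  qed
qed

lemma functional_eqI:
  assumes "\<And>\<phi>. functional \<phi> \<Longrightarrow> \<phi> x = \<phi> y"
  shows "x = y"
proof (rule ccontr)
  assume "x \<noteq> y"
  then have "x - y \<notin> {0}" by simp
  moreover have "subspace {0}" by simp
  ultimately obtain \<phi> where \<phi>: "functional \<phi>" "\<phi> (x - y) = 1"
    using functional_vanishing_on_subspace by metis
  have "\<phi> x = \<phi> (x - y) + \<phi> y" using functional_add[OF \<phi>(1), of "x - y" y] by simp
  then show False using assms[OF \<phi>(1)] \<phi>(2) by simp
qed

lemma functional_subspaceI: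
  assumes "subspace V" "\<And>\<phi>. functional \<phi> \<Longrightarrow> (\<And>v. v \<in> V \<Longrightarrow> \<phi> v = 0) \<Longrightarrow> \<phi> z = 0"
  shows "z \<in> V"
proof (rule ccontr)
  assume "z \<notin> V"
  then obtain \<phi> where "functional \<phi>" "\<And>v. v \<in> V \<Longrightarrow> \<phi> v = 0" "\<phi> z = 1"
    using functional_vanishing_on_subspace assms(1) by metis
  then show False using assms(2) by fastforce
qed

lemma finite_basis:
  obtains B where "finite B" "independent B" "span B = UNIV"
proof -
  obtain F where F: "finite F" "span F = UNIV" using finite_dim by blast
  obtain B where B: "B \<subseteq> UNIV" "independent B" "UNIV \<subseteq> span B"
    using maximal_independent_subset by blast
  have "finite B" using independent_span_bound[OF F(1) B(2)] F(2) by simp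
  then show ?thesis using that B by blast
qed

lemma functional_representation:
  assumes "finite B" "independent B" "span B = UNIV" "functional \<phi>"
  shows "\<phi> v = (\<Sum>b\<in>B. representation B v b * \<phi> b)"
proof -
  have "\<phi> v = \<phi> (\<Sum>b\<in>B. representation B v b *\<^sub>C b)" using sum_representation_basis[OF assms(1-3)] by simp
  then show ?thesis using assms(4) by (simp add: functional_sum functional_scale)
qed

text \<open>The sum \<open>N\<close> of the absolute values of the coordinates is a norm for which
  \<open>bracket x\<close> is bounded by \<open>K\<close>. The series is thus dominated by a
  multiple of the exponential series of \<open>K\<close>.\<close>

lemma exp_series_summable:
  assumes \<phi>: "functional \<phi>"
  shows "summable (\<lambda>k. norm (\<phi> ((bracket x ^^ k) y) / fact k))"
proof -
  obtain B where B: "finite B" "independent B" "span B = UNIV" using finite_basis .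
  define N where "N v = (\<Sum>b\<in>B. norm (representation B v b))" for v
  define K where "K = (\<Sum>b\<in>B. N (bracket x b))"
  define C where "C = (\<Sum>b\<in>B. norm (\<phi> b))"
  have N0: "0 \<le> N v" for v by (simp add: N_def sum_nonneg)
  have K0: "0 \<le> K" and C0: "0 \<le> C" by (simp_all add: K_def C_def N0 sum_nonneg)
  have \<phi>N: "norm (\<phi> v) \<le> C * N v" for v
  proof -
    have "norm (\<phi> v) \<le> (\<Sum>b\<in>B. norm (representation B v b) * norm (\<phi> b))"
      unfolding functional_representation[OF B \<phi>, of v] norm_mult[symmetric] by (rule norm_sum)
    also have "\<dots> \<le> (\<Sum>b\<in>B. norm (representation B v b) * C)"
      unfolding C_def using B(1) by (intro sum_mono mult_left_mono member_le_sum) auto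
    also have "\<dots> = C * N v" by (simp add: N_def sum_distrib_left mult.commute)
    finally show ?thesis .
  qed
  have step: "N (bracket x v) \<le> K * N v" for v
  proof -
    have "N (bracket x v) \<le> (\<Sum>a\<in>B. \<Sum>b\<in>B. norm (representation B v b) * norm (representation B (bracket x b) a))"
      unfolding N_def
    proof (rule sum_mono)
      fix a
      show "norm (representation B (bracket x v) a) \<le>
          (\<Sum>b\<in>B. norm (representation B v b) * norm (representation B (bracket x b) a))"
        unfolding representation_linear[OF B linear_bracket, of x v a] norm_mult[symmetric] by (rule norm_sum)
    qed
    also have "\<dots> = (\<Sum>b\<in>B. norm (representation B v b) * N (bracket x b))"
      unfolding N_def sum_distrib_left by (rule sum.swap)
    also have "\<dots> \<le> (\<Sum>b\<in>B. norm (representation B v b) * K)"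
      unfolding K_def using B(1) N0 by (intro sum_mono mult_left_mono member_le_sum) auto
    also have "\<dots> = K * N v" by (simp add: N_def sum_distrib_left mult.commute)
    finally show ?thesis .
  qed
  have pow: "N ((bracket x ^^ k) y) \<le> K ^ k * N y" for k
  proof (induction k)
    case (Suc k)
    have "N ((bracket x ^^ Suc k) y) \<le> K * N ((bracket x ^^ k) y)" using step by simp
    also have "\<dots> \<le> K * (K ^ k * N y)" using Suc K0 by (rule mult_left_mono)
    finally show ?case by (simp add: mult.assoc)
  qed simp
  have "norm (\<phi> ((bracket x ^^ k) y) / fact k) \<le> C * N y * (inverse (fact k) * K ^ k)" for k
  proof -
    have "norm (\<phi> ((bracket x ^^ k) y)) \<le> C * (K ^ k * N y)"
      using \<phi>N[of "(bracket x ^^ k) y"] mult_left_mono[OF pow C0, of k] by linarith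
    then have "norm (\<phi> ((bracket x ^^ k) y)) * inverse (fact k) \<le> C * (K ^ k * N y) * inverse (fact k)"
      by (rule mult_right_mono) simp
    also have "\<dots> = C * N y * (inverse (fact k) * K ^ k)" by (simp only: ac_simps)
    finally show ?thesis by (simp only: norm_divide norm_fact divide_inverse[of "norm _"])
  qed
  then show ?thesis
    by (intro summable_comparison_test'[OF summable_mult[OF summable_exp[of K]]]) simp
qed

text \<open>The definite description in \<open>exp_ad\<close> is met by the vector of coordinatewise
  limits; it is unique because functionals separate points.\<close>

lemma exp_ad_sums:
  assumes "functional \<phi>"
  shows "(\<lambda>k. \<phi> ((bracket x ^^ k) y) / fact k) sums \<phi> (exp_ad x y)"
proof -
  let ?P = "\<lambda>z. \<forall>\<phi>. functional \<phi> \<longrightarrow> (\<lambda>k. \<phi> ((bracket x ^^ k) y) / fact k) sums \<phi> z"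
  obtain B where B: "finite B" "independent B" "span B = UNIV" using finite_basis .
  let ?s = "\<lambda>b. \<Sum>k. representation B ((bracket x ^^ k) y) b / fact k"
  let ?z = "\<Sum>b\<in>B. ?s b *\<^sub>C b"
  have s: "(\<lambda>k. representation B ((bracket x ^^ k) y) b / fact k) sums ?s b" for b
    by (rule summable_sums[OF summable_norm_cancel[OF exp_series_summable]]) (rule linear_representation[OF B(2,3)])
  have "?P ?z"
  proof (intro allI impI)
    fix \<phi> assume \<phi>: "functional \<phi>"
    have "(\<lambda>k. \<Sum>b\<in>B. representation B ((bracket x ^^ k) y) b / fact k * \<phi> b) sums (\<Sum>b\<in>B. ?s b * \<phi> b)"
      by (intro sums_sum sums_mult2 s)
    moreover have "(\<Sum>b\<in>B. representation B v b / fact k * \<phi> b) = \<phi> v / fact k" for v and k :: nat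
      unfolding functional_representation[OF B \<phi>, of v] sum_divide_distrib by (intro sum.cong) auto
    ultimately show "(\<lambda>k. \<phi> ((bracket x ^^ k) y) / fact k) sums \<phi> ?z"
      using \<phi> by (simp add: functional_sum functional_scale)
  qed
  moreover have "z = ?z" if "?P z" for z
    by (rule functional_eqI) (use that \<open>?P ?z\<close> sums_unique2 in blast)
  ultimately have "?P (exp_ad x y)" unfolding exp_ad_def by (rule theI)
  then show ?thesis using assms by blast
qed

lemma exp_ad_unique:
  assumes "\<And>\<phi>. functional \<phi> \<Longrightarrow> (\<lambda>k. \<phi> ((bracket x ^^ k) y) / fact k) sums \<phi> z"
  shows "exp_ad x y = z"
  by (rule functional_eqI) (rule sums_unique2[OF exp_ad_sums assms])

lemma endomorphism_exp_ad: "endomorphism (exp_ad x)"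
  unfolding endomorphism_iff
proof (intro conjI allI)
  fix y z and c :: complex
  have lin: "(bracket x ^^ k) (y + z) = (bracket x ^^ k) y + (bracket x ^^ k) z"
    "(bracket x ^^ k) (c *\<^sub>C y) = c *\<^sub>C (bracket x ^^ k) y" for k
    using endomorphism_bracket_power[of k x] by (simp_all add: endomorphism_iff)
  show "exp_ad x (y + z) = exp_ad x y + exp_ad x z"
  proof (rule exp_ad_unique)
    fix \<phi> assume \<phi>: "functional \<phi>"
    show "(\<lambda>k. \<phi> ((bracket x ^^ k) (y + z)) / fact k) sums \<phi> (exp_ad x y + exp_ad x z)"
      using sums_add[OF exp_ad_sums[OF \<phi>] exp_ad_sums[OF \<phi>], of x y x z]
      by (simp add: lin functional_add[OF \<phi>] add_divide_distrib)
  qed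
  show "exp_ad x (c *\<^sub>C y) = c *\<^sub>C exp_ad x y"
  proof (rule exp_ad_unique)
    fix \<phi> assume \<phi>: "functional \<phi>"
    show "(\<lambda>k. \<phi> ((bracket x ^^ k) (c *\<^sub>C y)) / fact k) sums \<phi> (c *\<^sub>C exp_ad x y)"
      using sums_mult[OF exp_ad_sums[OF \<phi>], of c x y] by (simp add: lin functional_scale[OF \<phi>])
  qed
qed

text \<open>A subspace is the intersection of the kernels of the functionals vanishing on it, and
  such a functional annihilates every term of the series.\<close>

lemma exp_ad_invariant:
  assumes "subspace V" "\<And>v. v \<in> V \<Longrightarrow> bracket x v \<in> V" "y \<in> V"
  shows "exp_ad x y \<in> V"
proof (rule functional_subspaceI[OF assms(1)])
  fix \<phi> assume \<phi>: "functional \<phi>" "\<And>v. v \<in> V \<Longrightarrow> \<phi> v = 0"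
  have "(bracket x ^^ k) y \<in> V" for k by (induction k) (simp_all add: assms)
  then have "(\<lambda>k. \<phi> ((bracket x ^^ k) y) / fact k) = (\<lambda>_. 0)" using \<phi>(2) by simp
  then show "\<phi> (exp_ad x y) = 0" using exp_ad_sums[OF \<phi>(1), of x y] sums_unique2[OF sums_zero] by metis
qed

text \<open>In coordinates, a bilinear pairing or a composition of two exponentials is a finite sum
  of products of scalar series; this form serves both uses.\<close>

lemma Cauchy_product_sum_sums:
  fixes a b :: "'i \<Rightarrow> nat \<Rightarrow> complex"
  assumes "\<And>i. i \<in> I \<Longrightarrow> summable (\<lambda>k. norm (a i k))" "\<And>i. i \<in> I \<Longrightarrow> a i sums A i"
    and "\<And>i. i \<in> I \<Longrightarrow> summable (\<lambda>k. norm (b i k))" "\<And>i. i \<in> I \<Longrightarrow> b i sums C i"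
  shows "(\<lambda>m. \<Sum>k\<le>m. \<Sum>i\<in>I. a i k * b i (m - k)) sums (\<Sum>i\<in>I. A i * C i)"
proof -
  have "(\<lambda>m. \<Sum>i\<in>I. \<Sum>k\<le>m. a i k * b i (m - k)) sums (\<Sum>i\<in>I. A i * C i)"
    using Cauchy_product_sums[OF assms(1,3)] sums_unique[OF assms(2)] sums_unique[OF assms(4)]
    by (intro sums_sum) simp
  then show ?thesis by (subst sum.swap)
qed

text \<open>This is the Leibniz rule for iterated derivations, with each binomial coefficient
  written through factorials so that the terms match those of a Cauchy product of exponential
  series.\<close>

lemma ad_power_bracket:
  "(bracket x ^^ m) (bracket y z) = fact m *\<^sub>C
    (\<Sum>k\<le>m. (1 / (fact k * fact (m - k))) *\<^sub>C bracket ((bracket x ^^ k) y) ((bracket x ^^ (m - k)) z))"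
proof (induction m)
  case (Suc m)
  let ?T = "\<lambda>m k. (1 / (fact k * fact (m - k))) *\<^sub>C bracket ((bracket x ^^ k) y) ((bracket x ^^ (m - k)) z)"
  have fact_Suc': "(fact (Suc j) :: complex) = of_nat (Suc j) * fact j" for j by simp
  have step: "bracket x (?T m k) = of_nat (Suc k) *\<^sub>C ?T (Suc m) (Suc k) + of_nat (Suc m - k) *\<^sub>C ?T (Suc m) k"
    if "k \<le> m" for k
  proof -
    have sk: "Suc m - k = Suc (m - k)" using that by simp
    have nz: "complex_of_nat (Suc j) \<noteq> 0" for j by (rule of_nat_neq_0)
    have "of_nat (Suc k) * (1 / (fact (Suc k) * fact (m - k))) = 1 / (fact k * fact (m - k) :: complex)"
      "of_nat (Suc (m - k)) * (1 / (fact k * fact (Suc (m - k)))) = 1 / (fact k * fact (m - k) :: complex)"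
      unfolding fact_Suc' using nz by (simp_all add: field_simps del: of_nat_Suc)
    then show ?thesis
      unfolding sk by (simp add: bracket_scale_right bracket_leibniz[of x "(bracket x ^^ k) y"] scale_right_distrib
          del: fact_Suc of_nat_Suc)
  qed
  have "(\<Sum>k\<le>m. bracket x (?T m k)) =
      (\<Sum>k\<le>m. of_nat (Suc k) *\<^sub>C ?T (Suc m) (Suc k)) + (\<Sum>k\<le>m. of_nat (Suc m - k) *\<^sub>C ?T (Suc m) k)"
    unfolding sum.distrib[symmetric] by (intro sum.cong refl step) simp
  \<comment> \<open>Both sums are brought to the range up to \<open>Suc m\<close>; the terms added
    at \<open>k = 0\<close> here and at \<open>k = Suc m\<close> below have coefficient 0.\<close>
  also have "(\<Sum>k\<le>m. of_nat (Suc k) *\<^sub>C ?T (Suc m) (Suc k)) = (\<Sum>k\<le>Suc m. of_nat k *\<^sub>C ?T (Suc m) k)"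
    unfolding sum.atMost_Suc_shift[of "\<lambda>k. of_nat k *\<^sub>C ?T (Suc m) k" m] by simp
  also have "(\<Sum>k\<le>m. of_nat (Suc m - k) *\<^sub>C ?T (Suc m) k) = (\<Sum>k\<le>Suc m. of_nat (Suc m - k) *\<^sub>C ?T (Suc m) k)"
    by simp
  also have "(\<Sum>k\<le>Suc m. of_nat k *\<^sub>C ?T (Suc m) k) + (\<Sum>k\<le>Suc m. of_nat (Suc m - k) *\<^sub>C ?T (Suc m) k) =
      of_nat (Suc m) *\<^sub>C (\<Sum>k\<le>Suc m. ?T (Suc m) k)"
    unfolding sum.distrib[symmetric] scale_sum_right
  proof (intro sum.cong refl)
    fix k assume "k \<in> {..Suc m}"
    then have "of_nat k + of_nat (Suc m - k) = (of_nat (Suc m) :: complex)"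
      unfolding of_nat_add[symmetric] by simp
    then show "of_nat k *\<^sub>C ?T (Suc m) k + of_nat (Suc m - k) *\<^sub>C ?T (Suc m) k = of_nat (Suc m) *\<^sub>C ?T (Suc m) k"
      unfolding scale_left_distrib[symmetric] by simp
  qed
  finally have "(\<Sum>k\<le>m. bracket x (?T m k)) = of_nat (Suc m) *\<^sub>C (\<Sum>k\<le>Suc m. ?T (Suc m) k)" .
  moreover have "(bracket x ^^ Suc m) (bracket y z) = fact m *\<^sub>C (\<Sum>k\<le>m. bracket x (?T m k))"
    by (simp add: Suc bracket_scale_right bracket_sum_right)
  ultimately show ?case by (simp add: mult.commute del: sum.atMost_Suc of_nat_Suc)
qed simp

text \<open>The exponential of a derivation is an automorphism: divided by \<open>fact m\<close>,
  the Leibniz rule is the \<open>m\<close>-th coefficient of the Cauchy product of the two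
  series.\<close>

lemma exp_ad_bracket: "exp_ad x (bracket y z) = bracket (exp_ad x y) (exp_ad x z)"
proof (rule exp_ad_unique)
  fix \<phi> assume \<phi>: "functional \<phi>"
  obtain B where B: "finite B" "independent B" "span B = UNIV" using finite_basis .
  let ?r = "representation B"
  have expand: "\<phi> (bracket u v) = (\<Sum>(b, c)\<in>B \<times> B. ?r u b * (?r v c * \<phi> (bracket b c)))" for u v
  proof -
    have "bracket u v = bracket (\<Sum>b\<in>B. ?r u b *\<^sub>C b) (\<Sum>c\<in>B. ?r v c *\<^sub>C c)"
      using sum_representation_basis[OF B] by simp
    also have "\<phi> \<dots> = (\<Sum>b\<in>B. \<Sum>c\<in>B. ?r u b * (?r v c * \<phi> (bracket b c)))"
      by (simp add: bracket_sum_left bracket_sum_right bracket_scale_left bracket_scale_right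
          functional_sum[OF \<phi>] functional_scale[OF \<phi>] sum_distrib_left)
        (subst sum.swap, simp add: mult.left_commute)
    finally show ?thesis using B(1) by (simp add: sum.cartesian_product)
  qed
  have coord: "functional (\<lambda>v. ?r v b)" for b by (rule linear_representation[OF B(2,3)])
  \<comment> \<open>There is one product of series for each pair of basis vectors; the structure
    constant \<open>\<phi> (bracket b c)\<close> is attached to the second factor.\<close>
  let ?a = "\<lambda>(b, c) k. ?r ((bracket x ^^ k) y) b / fact k"
    and ?b = "\<lambda>(b, c) k. ?r ((bracket x ^^ k) z) c / fact k * \<phi> (bracket b c)"
  have "(\<lambda>m. \<Sum>k\<le>m. \<Sum>p\<in>B \<times> B. ?a p k * ?b p (m - k)) sums
      (\<Sum>p\<in>B \<times> B. (case p of (b, c) \<Rightarrow> ?r (exp_ad x y) b) * (case p of (b, c) \<Rightarrow> ?r (exp_ad x z) c * \<phi> (bracket b c)))"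
  proof (rule Cauchy_product_sum_sums)
    fix p assume "p \<in> B \<times> B"
    obtain b c where p: "p = (b, c)" by (cases p)
    show "summable (\<lambda>k. norm (?a p k))" "?a p sums (case p of (b, c) \<Rightarrow> ?r (exp_ad x y) b)"
      unfolding p using exp_series_summable[OF coord] exp_ad_sums[OF coord] by simp_all
    show "summable (\<lambda>k. norm (?b p k))"
      unfolding p prod.case norm_mult by (rule summable_mult2[OF exp_series_summable[OF coord]])
    show "?b p sums (case p of (b, c) \<Rightarrow> ?r (exp_ad x z) c * \<phi> (bracket b c))"
      unfolding p using sums_mult2[OF exp_ad_sums[OF coord]] by simp
  qed
  moreover have "(\<Sum>p\<in>B \<times> B. (case p of (b, c) \<Rightarrow> ?r (exp_ad x y) b) *
      (case p of (b, c) \<Rightarrow> ?r (exp_ad x z) c * \<phi> (bracket b c))) = \<phi> (bracket (exp_ad x y) (exp_ad x z))"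
    unfolding expand[of "exp_ad x y" "exp_ad x z"] by (intro sum.cong) auto
  moreover have "(\<Sum>k\<le>m. \<Sum>p\<in>B \<times> B. ?a p k * ?b p (m - k)) = \<phi> ((bracket x ^^ m) (bracket y z)) / fact m" for m
  proof -
    have "(\<Sum>p\<in>B \<times> B. ?a p k * ?b p (m - k)) =
        (1 / (fact k * fact (m - k))) * \<phi> (bracket ((bracket x ^^ k) y) ((bracket x ^^ (m - k)) z))" for k
      unfolding expand[of "(bracket x ^^ k) y" "(bracket x ^^ (m - k)) z"] sum_distrib_left
      by (intro sum.cong) auto
    then show ?thesis
      unfolding ad_power_bracket by (simp add: functional_sum[OF \<phi>] functional_scale[OF \<phi>])
  qed
  ultimately show "(\<lambda>m. \<phi> ((bracket x ^^ m) (bracket y z)) / fact m) sums \<phi> (bracket (exp_ad x y) (exp_ad x z))"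
    by simp
qed

lemma ad_uminus_power: "(bracket (- x) ^^ k) y = (- 1) ^ k *\<^sub>C (bracket x ^^ k) y"
  by (induction k) (simp_all add: bracket_minus_left bracket_scale_right)

text \<open>The coefficient of order \<open>m\<close> in the product is an alternating sum of
  binomial coefficients, which vanishes except for \<open>m = 0\<close>.\<close>

lemma exp_ad_uminus: "exp_ad (- x) (exp_ad x y) = y"
proof (rule functional_eqI)
  fix \<phi> assume \<phi>: "functional \<phi>"
  obtain B where B: "finite B" "independent B" "span B = UNIV" using finite_basis .
  let ?r = "representation B"
  have coord: "functional (\<lambda>v. ?r v b)" for b by (rule linear_representation[OF B(2,3)])
  have expE: "functional (\<lambda>v. \<phi> (exp_ad (- x) v))" by (rule functional_comp[OF \<phi> endomorphism_exp_ad])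
  let ?a = "\<lambda>b k. ?r ((bracket x ^^ k) y) b / fact k"
    and ?b = "\<lambda>b k. \<phi> ((bracket (- x) ^^ k) b) / fact k"
  have "(\<lambda>m. \<Sum>k\<le>m. \<Sum>b\<in>B. ?a b k * ?b b (m - k)) sums (\<Sum>b\<in>B. ?r (exp_ad x y) b * \<phi> (exp_ad (- x) b))"
    by (intro Cauchy_product_sum_sums exp_series_summable[OF coord] exp_series_summable[OF \<phi>]
        exp_ad_sums[OF coord] exp_ad_sums[OF \<phi>])
  moreover have "(\<Sum>b\<in>B. ?r (exp_ad x y) b * \<phi> (exp_ad (- x) b)) = \<phi> (exp_ad (- x) (exp_ad x y))"
    using functional_representation[OF B expE, of "exp_ad x y"] by simp
  moreover have "(\<Sum>k\<le>m. \<Sum>b\<in>B. ?a b k * ?b b (m - k)) = (if m = 0 then \<phi> y else 0)" for m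
  proof -
    have "(\<Sum>b\<in>B. ?a b k * ?b b (m - k)) =
        (- 1) ^ (m - k) * of_nat (m choose k) / fact m * \<phi> ((bracket x ^^ m) y)" if "k \<le> m" for k
    proof -
      have "functional (\<lambda>v. \<phi> ((bracket (- x) ^^ (m - k)) v))"
        by (rule functional_comp[OF \<phi> endomorphism_bracket_power])
      then have "(\<Sum>b\<in>B. ?a b k * ?b b (m - k)) =
          \<phi> ((bracket (- x) ^^ (m - k)) ((bracket x ^^ k) y)) / (fact k * fact (m - k))"
        by (subst functional_representation[OF B, of "\<lambda>v. \<phi> ((bracket (- x) ^^ (m - k)) v)"])
          (simp_all add: sum_divide_distrib)
      also have "(bracket (- x) ^^ (m - k)) ((bracket x ^^ k) y) = (- 1) ^ (m - k) *\<^sub>C (bracket x ^^ m) y"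
        using that funpow_add[of "m - k" k "bracket x"] by (simp add: ad_uminus_power)
      finally show ?thesis
        using that by (simp add: functional_scale[OF \<phi>] binomial_fact)
    qed
    then have "(\<Sum>k\<le>m. \<Sum>b\<in>B. ?a b k * ?b b (m - k)) =
        (\<Sum>k\<le>m. (- 1) ^ (m - k) * of_nat (m choose k)) / fact m * \<phi> ((bracket x ^^ m) y)"
      by (simp add: sum_distrib_right sum_divide_distrib)
    also have "(\<Sum>k\<le>m. (- 1) ^ (m - k) * of_nat (m choose k)) = (\<Sum>k\<le>m. (- 1) ^ k * complex_of_nat (m choose k))"
      by (rule sum.reindex_bij_witness[of _ "\<lambda>k. m - k" "\<lambda>k. m - k"]) (auto simp: binomial_symmetric[symmetric])
    finally show ?thesis using choose_alternating_sum[of m, where 'a = complex] by (cases "m = 0") auto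
  qed
  ultimately have "(\<lambda>m. if m = 0 then \<phi> y else 0) sums \<phi> (exp_ad (- x) (exp_ad x y))" by simp
  moreover have "(\<lambda>m::nat. if m = 0 then \<phi> y else 0) sums \<phi> y" by (rule sums_single)
  ultimately show "\<phi> (exp_ad (- x) (exp_ad x y)) = \<phi> y" by (rule sums_unique2)
qed

subsection \<open>The adjoint group\<close>

lemma connected_subgroup_endomorphism: "g \<in> connected_subgroup K \<Longrightarrow> endomorphism g"
proof (induction rule: connected_subgroup.induct)
  case id
  show ?case by (simp add: endomorphism_iff)
next
  case (exp x g)
  then show ?case using endomorphism_exp_ad[of x] by (simp add: endomorphism_iff)
qed

lemma connected_subgroup_bracket:
  "g \<in> connected_subgroup K \<Longrightarrow> g (bracket x y) = bracket (g x) (g y)"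
  by (induction rule: connected_subgroup.induct) (simp_all add: exp_ad_bracket)

lemma connected_subgroup_comp:
  "g \<in> connected_subgroup K \<Longrightarrow> g' \<in> connected_subgroup K \<Longrightarrow> g \<circ> g' \<in> connected_subgroup K"
  by (induction rule: connected_subgroup.induct) (auto simp: comp_assoc connected_subgroup.exp)

lemma connected_subgroup_mono: "g \<in> connected_subgroup K \<Longrightarrow> K \<subseteq> L \<Longrightarrow> g \<in> connected_subgroup L"
  by (induction rule: connected_subgroup.induct) (auto intro: connected_subgroup.intros)

lemma connected_subgroup_inverse:
  assumes "g \<in> connected_subgroup K" "\<And>x. x \<in> K \<Longrightarrow> - x \<in> K"
  shows "\<exists>g'\<in>connected_subgroup K. (\<forall>x. g' (g x) = x) \<and> (\<forall>x. g (g' x) = x)"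
  using assms(1)
proof (induction rule: connected_subgroup.induct)
  case id
  show ?case by (rule bexI[of _ id]) (simp_all add: connected_subgroup.id)
next
  case (exp x g)
  then obtain g' where g': "g' \<in> connected_subgroup K" "\<forall>x. g' (g x) = x" "\<forall>x. g (g' x) = x" by blast
  have e: "exp_ad (- x) \<in> connected_subgroup K"
    using connected_subgroup.exp[OF assms(2)[OF exp(1)] connected_subgroup.id] by simp
  have "exp_ad x (exp_ad (- x) y) = y" for y using exp_ad_uminus[of "- x" y] by simp
  then show ?case
    using g' exp_ad_uminus[of x] by (intro bexI[OF _ connected_subgroup_comp[OF g'(1) e]]) simp
qed

lemma connected_subgroup_invariant:
  assumes "g \<in> connected_subgroup K" "subspace V" "\<And>x v. x \<in> K \<Longrightarrow> v \<in> V \<Longrightarrow> bracket x v \<in> V" "v \<in> V"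
  shows "g v \<in> V"
  using assms(1) by (induction rule: connected_subgroup.induct) (simp_all add: exp_ad_invariant assms)

text \<open>An injective map sends a basis of \<open>V\<close> to an independent subset of
  \<open>V\<close> of the same size. This reduces stabilising the parabolic subalgebra to an
  inclusion.\<close>

lemma endomorphism_injective_subspace_image:
  assumes "endomorphism g" "inj g" "subspace V" "g ` V \<subseteq> V"
  shows "g ` V = V"
proof -
  interpret g: Vector_Spaces.linear scale scale g by fact
  obtain F where F: "finite F" "span F = UNIV" using finite_dim by blast
  obtain C where C: "C \<subseteq> V" "independent C" "V \<subseteq> span C" using maximal_independent_subset by blast
  have finC: "finite C" using independent_span_bound[OF F(1) C(2)] F(2) by simp
  have ind: "independent (g ` C)"
    using g.independent_injective_image[OF C(2)] assms(2) inj_on_subset by blast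
  have card: "card (g ` C) = card C" using assms(2) by (simp add: card_image inj_on_subset)
  have "V \<subseteq> span (g ` C)"
  proof
    fix v assume v: "v \<in> V"
    show "v \<in> span (g ` C)"
    proof (rule ccontr)
      assume nv: "v \<notin> span (g ` C)"
      then have "independent (insert v (g ` C))" using ind by (rule independent_insertI)
      moreover have "insert v (g ` C) \<subseteq> span C" using C assms(4) v by blast
      ultimately have "card (insert v (g ` C)) \<le> card C" using independent_span_bound[OF finC] by blast
      moreover have "v \<notin> g ` C" using nv span_base by blast
      ultimately show False using card finC by simp
    qed
  qed
  also have "span (g ` C) = g ` span C" by (rule g.span_image)
  also have "\<dots> \<subseteq> g ` V" using C(1) assms(3) by (intro image_mono span_minimal)
  finally show ?thesis using assms(4) by blast
qed

end

text \<open>The node \<open>i\<close> is left out because the structure theory up to the Weyl group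
  depends only on the base. The vectors \<open>Z k\<close> are coordinates that read off the
  coefficients of roots.\<close>

locale simple_lie_algebra_with_base = complex_lie_algebra scale bracket
  for scale :: "complex \<Rightarrow> 'g::ab_group_add \<Rightarrow> 'g" (infixr \<open>*\<^sub>C\<close> 75)
    and bracket :: "'g \<Rightarrow> 'g \<Rightarrow> 'g" +
  fixes H :: "'g set" and n :: nat and \<alpha> :: "nat \<Rightarrow> 'g \<Rightarrow> complex"
    and Z :: "nat \<Rightarrow> 'g"
  assumes simple_algebra: "simple"
    and cartan_H: "cartan_subalgebra H"
    and simple_system_\<alpha>: "simple_system H n \<alpha>"
    and span_Z: "span (Z ` {1..n}) = H"
    and \<alpha>_Z: "\<And>j k. j \<in> {1..n} \<Longrightarrow> k \<in> {1..n} \<Longrightarrow> \<alpha> j (Z k) = (if j = k then 1 else 0)"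
begin

abbreviation \<gg> :: "('g \<Rightarrow> complex) \<Rightarrow> 'g set"
  where "\<gg> \<equiv> root_space H"

abbreviation dual :: "('g \<Rightarrow> complex) set"
  where "dual \<equiv> dual_space H"

abbreviation W :: "(('g \<Rightarrow> complex) \<Rightarrow> 'g \<Rightarrow> complex) set"
  where "W \<equiv> weyl_group H"

section \<open>Coordinates on the Cartan subalgebra and on its dual\<close>

lemma subspace_H: "subspace H"
  unfolding span_Z[symmetric] by (rule subspace_span)

lemma bracket_H: "h \<in> H \<Longrightarrow> k \<in> H \<Longrightarrow> bracket h k = 0"
  using cartan_H unfolding cartan_subalgebra_def abelian_subalgebra_def by blast

lemma Z_in_H: "k \<in> {1..n} \<Longrightarrow> Z k \<in> H"
  using span_base[of "Z k" "Z ` {1..n}"] unfolding span_Z by blast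

lemma simple_root: "k \<in> {1..n} \<Longrightarrow> \<alpha> k \<in> roots H"
  using simple_system_\<alpha> unfolding simple_system_def by blast

lemma simple_root_dual: "k \<in> {1..n} \<Longrightarrow> \<alpha> k \<in> dual"
  using simple_root rootsD by blast

lemma dual_add: "\<phi> \<in> dual \<Longrightarrow> x \<in> H \<Longrightarrow> y \<in> H \<Longrightarrow> \<phi> (x + y) = \<phi> x + \<phi> y"
  and dual_scale: "\<phi> \<in> dual \<Longrightarrow> x \<in> H \<Longrightarrow> \<phi> (c *\<^sub>C x) = c * \<phi> x"
  and dual_outside: "\<phi> \<in> dual \<Longrightarrow> x \<notin> H \<Longrightarrow> \<phi> x = 0"
  by (auto simp: dual_space_def)

lemma dual_zero: "\<phi> \<in> dual \<Longrightarrow> \<phi> 0 = 0"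
  using dual_scale[of \<phi> 0 0] subspace_0[OF subspace_H] by simp

lemma dual_sum:
  assumes "\<phi> \<in> dual" "\<And>k. k \<in> A \<Longrightarrow> x k \<in> H"
  shows "\<phi> (\<Sum>k\<in>A. x k) = (\<Sum>k\<in>A. \<phi> (x k))"
  using assms(2)
proof (induction A rule: infinite_finite_induct)
  case (insert a A)
  then show ?case using dual_add[OF assms(1)] subspace_sum[OF subspace_H, of A x] by simp
qed (simp_all add: dual_zero assms)

lemma H_expand:
  assumes "h \<in> H"
  shows "h = (\<Sum>k=1..n. \<alpha> k h *\<^sub>C Z k)"
proof -
  have "h \<in> span (Z ` {1..n})" using assms span_Z by simp
  then have "h \<in> H \<and> h = (\<Sum>k=1..n. \<alpha> k h *\<^sub>C Z k)"
  proof (induction rule: span_induct_alt)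
    case base
    then show ?case using subspace_0[OF subspace_H] by (simp add: dual_zero simple_root_dual)
  next
    case (step c z y)
    then obtain j where j: "j \<in> {1..n}" "z = Z j" by blast
    have "(\<Sum>k=1..n. \<alpha> k (c *\<^sub>C z + y) *\<^sub>C Z k) =
        (\<Sum>k=1..n. (if k = j then c *\<^sub>C Z k else 0) + \<alpha> k y *\<^sub>C Z k)"
      using step j Z_in_H subspace_H
      by (intro sum.cong)
        (auto simp: dual_add dual_scale simple_root_dual subspace_scale \<alpha>_Z scale_left_distrib)
    also have "\<dots> = c *\<^sub>C Z j + y" using j step by (simp add: sum.distrib)
    finally show ?case
      using step j Z_in_H subspace_H by (simp add: subspace_add subspace_scale)
  qed
  then show ?thesis by simp
qed

lemma dual_expand:
  assumes "\<phi> \<in> dual" "h \<in> H"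
  shows "\<phi> h = (\<Sum>k=1..n. \<phi> (Z k) * \<alpha> k h)"
proof -
  have "\<phi> h = \<phi> (\<Sum>k=1..n. \<alpha> k h *\<^sub>C Z k)" using H_expand[OF assms(2)] by simp
  also have "\<dots> = (\<Sum>k=1..n. \<alpha> k h * \<phi> (Z k))"
    using assms(1) Z_in_H subspace_scale[OF subspace_H]
    by (subst dual_sum) (auto simp: dual_scale intro!: sum.cong)
  finally show ?thesis by (simp add: mult.commute)
qed

lemma dual_eqI:
  assumes "\<phi> \<in> dual" "\<psi> \<in> dual" "\<And>k. k \<in> {1..n} \<Longrightarrow> \<phi> (Z k) = \<psi> (Z k)"
  shows "\<phi> = \<psi>"
proof
  fix h show "\<phi> h = \<psi> h"
    using assms by (cases "h \<in> H") (simp_all add: dual_outside dual_expand)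
qed

lemma dual_eqI':
  assumes "\<phi> \<in> dual" "\<psi> \<in> dual" "\<And>h. h \<in> H \<Longrightarrow> \<phi> h = \<psi> h"
  shows "\<phi> = \<psi>"
  using dual_eqI assms Z_in_H by blast

subsection \<open>The root space decomposition\<close>

abbreviation weights :: "('g \<Rightarrow> complex) set"
  where "weights \<equiv> insert 0 (roots H)"

text \<open>An element that commutes with \<open>H\<close> spans an abelian subalgebra together with
  \<open>H\<close>, so maximality puts it into \<open>H\<close>.\<close>

lemma root_space_zero: "\<gg> 0 = H"
proof
  show "H \<subseteq> \<gg> 0" by (auto simp: root_space_def bracket_H)
next
  show "\<gg> 0 \<subseteq> H"
  proof
    fix x assume "x \<in> \<gg> 0"
    then have x: "bracket h x = 0" "bracket x h = 0" if "h \<in> H" for h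
      using that bracket_anticommute[of x h] by (auto simp: root_space_def)
    have sub0: "subspace {0}" by simp
    let ?K = "span (insert x H)"
    have "bracket y z = 0" if "y \<in> ?K" "z \<in> ?K" for y z
    proof -
      have "bracket y k \<in> {0}" if "k \<in> insert x H" for k
        by (rule bracket_span_left[OF \<open>y \<in> ?K\<close> sub0]) (use that x bracket_H bracket_self in auto)
      then show ?thesis using bracket_span_right[OF \<open>z \<in> ?K\<close> sub0] by blast
    qed
    then have "abelian_subalgebra ?K" by (simp add: abelian_subalgebra_def)
    moreover have "H \<subseteq> ?K" using span_superset by blast
    ultimately have "?K = H" using cartan_H unfolding cartan_subalgebra_def by blast
    then show "x \<in> H" using span_base[of x "insert x H"] by simp
  qed
qed

lemma simultaneous_eigenvector_weight:
  assumes "\<And>k. k \<in> {1..n} \<Longrightarrow> bracket (Z k) x = c k *\<^sub>C x"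
  obtains \<mu> where "\<mu> \<in> dual" "x \<in> \<gg> \<mu>"
proof
  let ?\<mu> = "\<lambda>h. \<Sum>k=1..n. c k * \<alpha> k h"
  show "?\<mu> \<in> dual"
    unfolding dual_space_def
    by (auto simp: dual_add dual_scale dual_outside simple_root_dual sum_distrib_left sum.distrib
        algebra_simps)
  show "x \<in> \<gg> ?\<mu>"
    unfolding root_space_def
  proof safe
    fix h assume "h \<in> H"
    then have "bracket h x = bracket (\<Sum>k=1..n. \<alpha> k h *\<^sub>C Z k) x" using H_expand by simp
    also have "\<dots> = (\<Sum>k=1..n. (c k * \<alpha> k h) *\<^sub>C x)"
      using assms by (simp add: bracket_sum_left bracket_scale_left mult.commute)
    finally show "bracket h x = ?\<mu> h *\<^sub>C x" by (simp add: scale_sum_left)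
  qed
qed

lemma span_weight_spaces: "span (\<Union>\<mu>\<in>weights. \<gg> \<mu>) = UNIV"
proof -
  have "{x. \<forall>h\<in>Z ` {1..n}. \<exists>c. bracket h x = c *\<^sub>C x} \<subseteq> (\<Union>\<mu>\<in>weights. \<gg> \<mu>)"
  proof
    fix x assume "x \<in> {x. \<forall>h\<in>Z ` {1..n}. \<exists>c. bracket h x = c *\<^sub>C x}"
    then have "\<forall>k\<in>{1..n}. \<exists>c. bracket (Z k) x = c *\<^sub>C x" by auto
    then obtain c where "\<And>k. k \<in> {1..n} \<Longrightarrow> bracket (Z k) x = c k *\<^sub>C x" by metis
    then obtain \<mu> where \<mu>: "\<mu> \<in> dual" "x \<in> \<gg> \<mu>"
      using simultaneous_eigenvector_weight by blast
    show "x \<in> (\<Union>\<mu>\<in>weights. \<gg> \<mu>)"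
    proof (cases "x = 0 \<or> \<mu> = 0")
      case True
      then have "x \<in> \<gg> 0" using \<mu> subspace_0[OF subspace_root_space] by auto
      then show ?thesis by blast
    next
      case False
      then show ?thesis using \<mu> rootsI by blast
    qed
  qed
  then have "span {x. \<forall>h\<in>Z ` {1..n}. \<exists>c. bracket h x = c *\<^sub>C x} \<subseteq>
      span (\<Union>\<mu>\<in>weights. \<gg> \<mu>)"
    by (rule span_mono)
  moreover have "span {x. \<forall>h\<in>Z ` {1..n}. \<exists>c. bracket h x = c *\<^sub>C x} = UNIV"
    by (rule simultaneous_eigenvectors_span)
      (use cartan_H Z_in_H bracket_H in \<open>auto simp: cartan_subalgebra_def\<close>)
  ultimately show ?thesis by auto
qed

lemma weight_dual: "\<mu> \<in> weights \<Longrightarrow> \<mu> \<in> dual"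
  using rootsD by (auto simp: dual_space_def)

lemma weights_separated:
  assumes "\<mu> \<in> dual" "\<nu> \<in> dual" "\<mu> \<noteq> \<nu>"
  shows "\<exists>h\<in>H. \<mu> h \<noteq> \<nu> h"
  using assms dual_eqI' by blast

lemma weight_sum_zero:
  assumes "finite M" "M \<subseteq> dual" "\<And>\<mu>. \<mu> \<in> M \<Longrightarrow> v \<mu> \<in> \<gg> \<mu>"
    "(\<Sum>\<mu>\<in>M. v \<mu>) = 0" "\<mu> \<in> M"
  shows "v \<mu> = 0"
  by (rule weight_vectors_independent[OF assms(1) _ assms(3-5)])
    (use assms(2) weights_separated in blast)

text \<open>A finite spanning set lies in the sum of finitely many weight spaces. A nonzero vector
  for any further root would violate the independence of weight vectors.\<close>

lemma finite_roots: "finite (roots H)"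
proof -
  obtain F where F: "finite F" "span F = UNIV" using finite_dim by blast
  have "\<exists>M. finite M \<and> M \<subseteq> weights \<and> f \<in> span (\<Union>\<mu>\<in>M. \<gg> \<mu>)" for f
  proof -
    have "f \<in> span (\<Union>\<mu>\<in>weights. \<gg> \<mu>)" unfolding span_weight_spaces by simp
    from span_UN_root_spaces[OF this] obtain M v where M: "finite M" "M \<subseteq> weights"
      "\<And>\<mu>. \<mu> \<in> M \<Longrightarrow> v \<mu> \<in> \<gg> \<mu>" "f = (\<Sum>\<mu>\<in>M. v \<mu>)"
      by blast
    then have "f \<in> span (\<Union>\<mu>\<in>M. \<gg> \<mu>)" by (auto intro!: span_sum intro: span_base)
    then show ?thesis using M by blast
  qed
  then have "\<forall>f. \<exists>M. finite M \<and> M \<subseteq> weights \<and> f \<in> span (\<Union>\<mu>\<in>M. \<gg> \<mu>)"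
    by blast
  from choice[OF this] obtain M where M: "\<And>f. finite (M f)" "\<And>f. M f \<subseteq> weights"
    "\<And>f. f \<in> span (\<Union>\<mu>\<in>M f. \<gg> \<mu>)"
    by blast
  define N where "N = (\<Union>f\<in>F. M f)"
  have finN: "finite N" using F M by (simp add: N_def)
  have "F \<subseteq> span (\<Union>\<mu>\<in>N. \<gg> \<mu>)"
  proof
    fix f assume "f \<in> F"
    then have "(\<Union>\<mu>\<in>M f. \<gg> \<mu>) \<subseteq> (\<Union>\<mu>\<in>N. \<gg> \<mu>)" by (auto simp: N_def)
    then show "f \<in> span (\<Union>\<mu>\<in>N. \<gg> \<mu>)" using M(3) span_mono by blast
  qed
  then have N_span: "span (\<Union>\<mu>\<in>N. \<gg> \<mu>) = UNIV"
    using F span_minimal[OF _ subspace_span] by blast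
  have "roots H \<subseteq> N"
  proof (rule ccontr)
    assume "\<not> roots H \<subseteq> N"
    then obtain \<beta> where \<beta>: "\<beta> \<in> roots H" "\<beta> \<notin> N" by blast
    then obtain x where x: "x \<in> \<gg> \<beta>" "x \<noteq> 0" using rootsD by blast
    have "x \<in> span (\<Union>\<mu>\<in>N. \<gg> \<mu>)" unfolding N_span by simp
    from span_UN_root_spaces[OF this] obtain L v where L: "finite L" "L \<subseteq> N" "\<And>\<mu>. \<mu> \<in> L \<Longrightarrow> v \<mu> \<in> \<gg> \<mu>"
      "x = (\<Sum>\<mu>\<in>L. v \<mu>)"
      by blast
    let ?v = "\<lambda>\<mu>. if \<mu> = \<beta> then - x else v \<mu>"
    have "\<beta> \<notin> L" using L \<beta> by auto
    then have "(\<Sum>\<mu>\<in>insert \<beta> L. ?v \<mu>) = - x + (\<Sum>\<mu>\<in>L. v \<mu>)"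
      using L(1) by (subst sum.insert) (auto intro!: sum.cong)
    then have sum0: "(\<Sum>\<mu>\<in>insert \<beta> L. ?v \<mu>) = 0" unfolding L(4)[symmetric] by simp
    have sub: "insert \<beta> L \<subseteq> dual"
    proof
      fix \<mu> assume "\<mu> \<in> insert \<beta> L"
      then have "\<mu> \<in> weights" using L(2) \<beta>(1) M(2) by (auto simp: N_def)
      then show "\<mu> \<in> dual" by (rule weight_dual)
    qed
    have mem: "?v \<mu> \<in> \<gg> \<mu>" if "\<mu> \<in> insert \<beta> L" for \<mu>
      using that L(3) subspace_neg[OF subspace_root_space x(1)] by auto
    have "?v \<beta> = 0"
      by (rule weight_sum_zero[of "insert \<beta> L" ?v, OF _ sub mem sum0]) (use L(1) in auto)
    then show False using x by simp
  qed
  then show ?thesis using finN by (rule finite_subset)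
qed

text \<open>Comparing the components of \<open>bracket h u\<close> and of the multiple of
  \<open>u\<close>, independence removes every component whose weight does not take the value
  \<open>c\<close> at \<open>h\<close>.\<close>

lemma eigenvector_decomposition:
  assumes "h \<in> H" "bracket h u = c *\<^sub>C u"
  obtains v where "\<And>\<mu>. \<mu> \<in> weights \<Longrightarrow> v \<mu> \<in> \<gg> \<mu>"
    "u = (\<Sum>\<mu>\<in>{\<mu> \<in> weights. \<mu> h = c}. v \<mu>)"
proof -
  let ?W = "weights"
  have "u \<in> span (\<Union>\<mu>\<in>?W. \<gg> \<mu>)" unfolding span_weight_spaces by simp
  from span_UN_root_spaces[OF this] obtain M v' where M: "finite M" "M \<subseteq> ?W"
    "\<And>\<mu>. \<mu> \<in> M \<Longrightarrow> v' \<mu> \<in> \<gg> \<mu>" "u = (\<Sum>\<mu>\<in>M. v' \<mu>)"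
    by blast
  define v where "v \<mu> = (if \<mu> \<in> M then v' \<mu> else 0)" for \<mu>
  have v: "v \<mu> \<in> \<gg> \<mu>" for \<mu>
    using M subspace_0[OF subspace_root_space] by (simp add: v_def)
  have fin: "finite ?W" using finite_roots by simp
  have u: "u = (\<Sum>\<mu>\<in>?W. v \<mu>)"
    unfolding M(4) by (rule sum.mono_neutral_cong_left) (use M fin in \<open>auto simp: v_def\<close>)
  let ?u = "\<lambda>\<mu>. (\<mu> h - c) *\<^sub>C v \<mu>"
  have "(\<Sum>\<mu>\<in>?W. ?u \<mu>) = (\<Sum>\<mu>\<in>?W. bracket h (v \<mu>) - c *\<^sub>C v \<mu>)"
    using v assms(1) by (intro sum.cong) (auto simp: root_space_def scale_left_diff_distrib)
  also have "\<dots> = bracket h u - c *\<^sub>C u"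
    by (simp add: u sum_subtractf bracket_sum_right scale_sum_right del: sum.insert)
  finally have sum0: "(\<Sum>\<mu>\<in>?W. ?u \<mu>) = 0" using assms by simp
  have "?u \<mu> = 0" if "\<mu> \<in> ?W" for \<mu>
    by (rule weight_sum_zero[OF fin _ _ sum0 that])
      (use weight_dual v subspace_scale[OF subspace_root_space] in auto)
  then have sum_u: "u = (\<Sum>\<mu>\<in>{\<mu> \<in> ?W. \<mu> h = c}. v \<mu>)"
    unfolding u by (intro sum.mono_neutral_right) (use fin in auto)
  show ?thesis by (rule that[of v]) (rule v, rule sum_u)
qed

lemma weight_decomposition:
  obtains v where "\<And>\<mu>. \<mu> \<in> weights \<Longrightarrow> v \<mu> \<in> \<gg> \<mu>"
    "u = (\<Sum>\<mu>\<in>weights. v \<mu>)"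
proof -
  \<comment> \<open>For \<open>h = 0\<close> and \<open>c = 0\<close> the eigenvalue condition is
    void and selects all weights.\<close>
  have 0: "bracket 0 u = 0 *\<^sub>C u" by simp
  have eq: "{\<mu> \<in> weights. \<mu> 0 = 0} = weights"
    using weight_dual dual_zero by auto
  obtain v where v: "\<And>\<mu>. \<mu> \<in> weights \<Longrightarrow> v \<mu> \<in> \<gg> \<mu>"
    "u = (\<Sum>\<mu>\<in>{\<mu> \<in> weights. \<mu> 0 = 0}. v \<mu>)"
    using eigenvector_decomposition[OF subspace_0[OF subspace_H] 0] by blast
  show ?thesis by (rule that[OF v(1)]) (use v(2) eq in simp_all)
qed

subsection \<open>Coroots\<close>

lemma root_coeffs:
  assumes "\<beta> \<in> roots H"
  obtains c :: "nat \<Rightarrow> int" where "(\<forall>j\<in>{1..n}. 0 \<le> c j) \<or> (\<forall>j\<in>{1..n}. c j \<le> 0)"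
    "\<And>j. j \<in> {1..n} \<Longrightarrow> \<beta> (Z j) = of_int (c j)"
proof -
  obtain c :: "nat \<Rightarrow> int" where c: "(\<forall>j\<in>{1..n}. 0 \<le> c j) \<or> (\<forall>j\<in>{1..n}. c j \<le> 0)"
    "\<beta> = (\<lambda>h. \<Sum>j=1..n. of_int (c j) * \<alpha> j h)"
    using simple_system_\<alpha> assms unfolding simple_system_def by blast
  have "\<beta> (Z k) = of_int (c k)" if "k \<in> {1..n}" for k
  proof -
    have "\<beta> (Z k) = (\<Sum>j=1..n. if j = k then of_int (c j) else 0)"
      unfolding c(2) using that \<alpha>_Z by (intro sum.cong) auto
    then show ?thesis using that by simp
  qed
  then show ?thesis using that c by blast
qed

section \<open>The Killing form in a basis of weight vectors\<close>

definition weight_basis :: "'g set"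
  where "weight_basis = (SOME B. finite B \<and> independent B \<and> span B = UNIV \<and>
    B \<subseteq> (\<Union>\<mu>\<in>weights. \<gg> \<mu>))"

lemma weight_basis: "finite weight_basis" "independent weight_basis" "span weight_basis = UNIV"
  and weight_basis_subset: "weight_basis \<subseteq> (\<Union>\<mu>\<in>weights. \<gg> \<mu>)"
proof -
  let ?S = "\<Union>\<mu>\<in>weights. \<gg> \<mu>"
  obtain B where B: "B \<subseteq> ?S" "independent B" "?S \<subseteq> span B"
    using maximal_independent_subset by blast
  obtain F where F: "finite F" "span F = UNIV" using finite_dim by blast
  have "finite B" using independent_span_bound[OF F(1) B(2)] F(2) by simp
  moreover have "span B = UNIV"
    using span_minimal[OF B(3) subspace_span] span_weight_spaces by auto
  ultimately have "\<exists>B. finite B \<and> independent B \<and> span B = UNIV \<and> B \<subseteq> ?S" using B by blast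
  from someI_ex[OF this]
  show "finite weight_basis" "independent weight_basis" "span weight_basis = UNIV"
    "weight_basis \<subseteq> ?S"
    unfolding weight_basis_def by blast+
qed

abbreviation \<kappa> :: "'g \<Rightarrow> 'g \<Rightarrow> complex"
  where "\<kappa> \<equiv> killing weight_basis"

lemmas \<kappa>_commute = killing_commute[OF weight_basis]
lemmas \<kappa>_linear = killing_add_left[OF weight_basis] killing_scale_left[OF weight_basis]
  killing_add_right[OF weight_basis] killing_scale_right[OF weight_basis] killing_zero[OF weight_basis]
  killing_diff_left[OF weight_basis] killing_minus[OF weight_basis]
lemmas \<kappa>_sum_right = killing_sum_right[OF weight_basis]
lemmas \<kappa>_sum_left = killing_sum_left[OF weight_basis]
lemmas \<kappa>_invariant = killing_invariant[OF weight_basis]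
lemmas \<kappa>_weight_orthogonal = killing_weight_orthogonal[OF weight_basis]

definition weight_of :: "'g \<Rightarrow> 'g \<Rightarrow> complex"
  where "weight_of b = (SOME \<mu>. \<mu> \<in> weights \<and> b \<in> \<gg> \<mu>)"

lemma weight_of:
  assumes "b \<in> weight_basis"
  shows "weight_of b \<in> weights" "b \<in> \<gg> (weight_of b)"
proof -
  have "\<exists>\<mu>. \<mu> \<in> weights \<and> b \<in> \<gg> \<mu>" using assms weight_basis_subset by blast
  from someI_ex[OF this]
  show "weight_of b \<in> weights" "b \<in> \<gg> (weight_of b)"
    unfolding weight_of_def by blast+
qed

text \<open>Elements of \<open>H\<close> act diagonally in the weight basis, so the trace is a sum
  of products of eigenvalues.\<close>

lemma \<kappa>_H:
  assumes "h \<in> H" "k \<in> H"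
  shows "\<kappa> h k = (\<Sum>b\<in>weight_basis. weight_of b h * weight_of b k)"
  unfolding killing_def trace_on_def
proof (rule sum.cong)
  fix b assume b: "b \<in> weight_basis"
  then have "bracket h (bracket k b) = (weight_of b h * weight_of b k) *\<^sub>C b"
    using assms weight_of[OF b] by (simp add: root_space_def bracket_scale_right mult.commute)
  then show "representation weight_basis (bracket h (bracket k b)) b = weight_of b h * weight_of b k"
    using b weight_basis by (simp add: representation_scale representation_basis)
qed simp

lemma weight_real:
  assumes "\<mu> \<in> weights" "k \<in> {1..n}"
  shows "\<mu> (Z k) \<in> \<real>"
proof (cases "\<mu> = 0")
  case False
  then obtain c :: "nat \<Rightarrow> int" where "\<mu> (Z k) = of_int (c k)" using root_coeffs assms by blast
  then show ?thesis by simp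
qed simp

text \<open>The weights are real on the real span of the \<open>Z k\<close>, so there the Killing form is a sum of squares.\<close>

lemma \<kappa>_self_zero:
  assumes "h \<in> H" "\<And>\<mu>. \<mu> \<in> weights \<Longrightarrow> \<mu> h \<in> \<real>"
  shows "\<exists>r. \<kappa> h h = complex_of_real r \<and> 0 \<le> r \<and> (r = 0 \<longrightarrow> (\<forall>x. bracket h x = 0))"
proof (intro exI conjI impI)
  let ?r = "\<Sum>b\<in>weight_basis. (Re (weight_of b h))\<^sup>2"
  have re: "weight_of b h = complex_of_real (Re (weight_of b h))" if "b \<in> weight_basis" for b
    using assms(2) weight_of(1)[OF that] by (simp add: of_real_Re)
  show "\<kappa> h h = complex_of_real ?r"
    unfolding \<kappa>_H[OF assms(1,1)] of_real_sum
    by (intro sum.cong refl) (subst (1 2) re, auto simp: power2_eq_square)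
  show "0 \<le> ?r" by (simp add: sum_nonneg)
  show "\<forall>x. bracket h x = 0" if "?r = 0"
  proof -
    have "weight_of b h = 0" if b: "b \<in> weight_basis" for b
    proof -
      have "(Re (weight_of b h))\<^sup>2 = 0"
        using \<open>?r = 0\<close> b weight_basis(1) by (subst (asm) sum_nonneg_eq_0_iff) auto
      then show ?thesis using re[OF b] by simp
    qed
    then have "bracket h b \<in> {0}" if "b \<in> weight_basis" for b
      using that weight_of(2)[OF that] assms by (simp add: root_space_def)
    then show ?thesis
      using bracket_span_right[of _ weight_basis "{0}" h] weight_basis(3) by auto
  qed
qed

lemma center_trivial:
  assumes "h \<in> H" "\<And>x. bracket h x = 0"
  shows "h = 0"
proof -
  have "\<alpha> k h = 0" if k: "k \<in> {1..n}" for k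
  proof -
    obtain x where "x \<in> \<gg> (\<alpha> k)" "x \<noteq> 0" using rootsD(3)[OF simple_root[OF k]] by blast
    then show ?thesis using assms root_spaceD[of x H "\<alpha> k" h] by simp
  qed
  then show ?thesis using H_expand[OF assms(1)] by simp
qed

lemma \<kappa>_nondegenerate:
  assumes "\<And>y. \<kappa> x y = 0"
  shows "x = 0"
proof -
  let ?R = "{x. \<forall>y. \<kappa> x y = 0}"
  have "?R \<noteq> UNIV"
  proof
    assume "?R = UNIV"
    then have zero: "\<kappa> x y = 0" for x y by blast
    have "h = 0" if "h \<in> H" for h
    proof -
      have "Z k = 0" if k: "k \<in> {1..n}" for k
      proof (rule center_trivial[OF Z_in_H[OF k]])
        show "bracket (Z k) x = 0" for x
          using \<kappa>_self_zero[OF Z_in_H[OF k]] weight_real k zero by auto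
      qed
      then show ?thesis using H_expand[OF that] by simp
    qed
    \<comment> \<open>With \<open>H\<close> reduced to zero every vector has weight 0. Hence the
      whole algebra equals \<open>H\<close>, which is abelian.\<close>
    then have "\<gg> 0 = UNIV" by (force simp: root_space_def)
    then have "H = UNIV" using root_space_zero by simp
    then show False using simple_algebra bracket_H by (auto simp: simple_def)
  qed
  then have "?R = {0}"
    using lie_ideal_killing_radical[OF weight_basis] simple_algebra unfolding simple_def by blast
  then show ?thesis using assms by blast
qed

text \<open>Weight spaces are orthogonal unless their weights are opposite, so of any vector pairing
  nontrivially with \<open>x\<close> only the component of weight \<open>- \<mu>\<close>
  contributes.\<close>

lemma \<kappa>_weight_nondegenerate:
  assumes "\<mu> \<in> weights" "x \<in> \<gg> \<mu>" "x \<noteq> 0"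
  obtains y where "y \<in> \<gg> (- \<mu>)" "\<kappa> x y \<noteq> 0"
proof -
  obtain y where y: "\<kappa> x y \<noteq> 0" using \<kappa>_nondegenerate assms by blast
  obtain v where v: "\<And>\<nu>. \<nu> \<in> weights \<Longrightarrow> v \<nu> \<in> \<gg> \<nu>"
    "y = (\<Sum>\<nu>\<in>weights. v \<nu>)"
    using weight_decomposition by blast
  have "(\<Sum>\<nu>\<in>weights. \<kappa> x (v \<nu>)) \<noteq> 0" using y unfolding v(2) \<kappa>_sum_right .
  then obtain \<nu> where \<nu>: "\<nu> \<in> weights" "\<kappa> x (v \<nu>) \<noteq> 0"
    by (metis sum.not_neutral_contains_not_neutral)
  have "\<nu> = - \<mu>"
  proof (rule dual_eqI')
    fix h assume "h \<in> H"
    then have "\<mu> h + \<nu> h = 0" using \<kappa>_weight_orthogonal[OF assms(2) v(1)[OF \<nu>(1)]] \<nu>(2) by blast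
    then show "\<nu> h = (- \<mu>) h" by (simp add: eq_neg_iff_add_eq_0 add.commute)
  qed (use \<nu> assms weight_dual in \<open>blast intro: dual_space_uminus\<close>)+
  then show ?thesis using that \<nu> v by blast
qed

lemma root_uminus: "\<beta> \<in> roots H \<Longrightarrow> - \<beta> \<in> roots H"
proof -
  assume \<beta>: "\<beta> \<in> roots H"
  then obtain x where "x \<in> \<gg> \<beta>" "x \<noteq> 0" using rootsD(3) by blast
  then obtain y where "y \<in> \<gg> (- \<beta>)" "\<kappa> x y \<noteq> 0"
    using \<kappa>_weight_nondegenerate \<beta> by blast
  then show ?thesis
    using \<beta> rootsD[OF \<beta>] dual_space_uminus by (intro rootsI[of _ H y]) (auto simp: \<kappa>_linear)
qed

lemma \<kappa>_H_nondegenerate: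
  assumes "h \<in> H" "\<And>k. k \<in> H \<Longrightarrow> \<kappa> h k = 0"
  shows "h = 0"
proof (rule ccontr)
  assume "h \<noteq> 0"
  moreover have "h \<in> \<gg> 0" using assms root_space_zero by simp
  ultimately obtain y where "y \<in> \<gg> (- 0)" "\<kappa> h y \<noteq> 0"
    using \<kappa>_weight_nondegenerate by blast
  then show False using assms root_space_zero by simp
qed

text \<open>This is the usual element \<open>t\<close> representing \<open>\<beta>\<close> through
  the Killing form. The value \<open>\<phi> (root_dual \<beta>)\<close> plays the role of the inner
  product of \<open>\<phi>\<close> and \<open>\<beta>\<close>.\<close>

definition root_dual :: "('g \<Rightarrow> complex) \<Rightarrow> 'g"
  where "root_dual \<beta> = (THE t. t \<in> H \<and> (\<forall>h\<in>H. \<kappa> t h = \<beta> h))"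

lemma root_dual_unique:
  assumes "t \<in> H" "\<And>h. h \<in> H \<Longrightarrow> \<kappa> t h = \<beta> h"
  shows "root_dual \<beta> = t"
  unfolding root_dual_def
proof (rule the_equality)
  fix s assume s: "s \<in> H \<and> (\<forall>h\<in>H. \<kappa> s h = \<beta> h)"
  have "s - t = 0"
    by (rule \<kappa>_H_nondegenerate) (use s assms subspace_diff[OF subspace_H] in \<open>auto simp: \<kappa>_linear\<close>)
  then show "s = t" by simp
qed (use assms in blast)

lemma bracket_opposite_in_H:
  assumes "e \<in> \<gg> \<beta>" "f \<in> \<gg> (- \<beta>)"
  shows "bracket e f \<in> H"
  using bracket_root_space[OF assms] root_space_zero by simp

lemma \<kappa>_bracket_opposite:
  assumes "f \<in> \<gg> (- \<beta>)" "h \<in> H"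
  shows "\<kappa> (bracket e f) h = \<kappa> e f * \<beta> h"
proof -
  have "bracket f h = \<beta> h *\<^sub>C f"
    using assms by (simp add: root_space_def bracket_anticommute[of f h] scale_minus_left)
  then show ?thesis by (simp add: \<kappa>_invariant \<kappa>_linear mult.commute)
qed

text \<open>By invariance, \<open>bracket e f\<close> represents \<open>\<beta>\<close> up to the
  factor \<open>\<kappa> e f\<close>, which can be made nonzero by the choice of
  \<open>f\<close>.\<close>

lemma root_dual:
  assumes "\<beta> \<in> roots H"
  shows "root_dual \<beta> \<in> H" "\<And>h. h \<in> H \<Longrightarrow> \<kappa> (root_dual \<beta>) h = \<beta> h"
proof -
  obtain e where e: "e \<in> \<gg> \<beta>" "e \<noteq> 0" using rootsD(3)[OF assms] by blast
  then obtain f where f: "f \<in> \<gg> (- \<beta>)" "\<kappa> e f \<noteq> 0"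
    using \<kappa>_weight_nondegenerate assms by blast
  let ?t = "(1 / \<kappa> e f) *\<^sub>C bracket e f"
  have t: "?t \<in> H" "\<And>h. h \<in> H \<Longrightarrow> \<kappa> ?t h = \<beta> h"
    using bracket_opposite_in_H[OF e(1) f(1)] subspace_scale[OF subspace_H] f \<kappa>_bracket_opposite[OF f(1)]
    by (auto simp: \<kappa>_linear)
  have "root_dual \<beta> = ?t" by (rule root_dual_unique[OF t])
  then show "root_dual \<beta> \<in> H" "\<And>h. h \<in> H \<Longrightarrow> \<kappa> (root_dual \<beta>) h = \<beta> h" using t by simp_all
qed

lemma root_dual_commute:
  assumes "\<beta> \<in> roots H" "\<gamma> \<in> roots H"
  shows "\<beta> (root_dual \<gamma>) = \<gamma> (root_dual \<beta>)"
  using root_dual[OF assms(1)] root_dual[OF assms(2)] \<kappa>_commute by metis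

lemma bracket_opposite:
  assumes "\<beta> \<in> roots H" "e \<in> \<gg> \<beta>" "f \<in> \<gg> (- \<beta>)"
  shows "bracket e f = \<kappa> e f *\<^sub>C root_dual \<beta>"
proof -
  have "bracket e f - \<kappa> e f *\<^sub>C root_dual \<beta> = 0"
    by (rule \<kappa>_H_nondegenerate)
      (use assms root_dual bracket_opposite_in_H subspace_diff[OF subspace_H]
        subspace_scale[OF subspace_H] \<kappa>_bracket_opposite[OF assms(3)] in \<open>auto simp: \<kappa>_linear\<close>)
  then show ?thesis by simp
qed

text \<open>The coordinates of \<open>root_dual \<beta>\<close> solve a linear system with real
  matrix \<open>\<kappa> (Z j) (Z l)\<close> and real right-hand side \<open>\<beta> (Z l)\<close>.
  Their imaginary parts solve the homogeneous system, which has only the zero solution by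
  nondegeneracy on \<open>H\<close>.\<close>

lemma simple_root_root_dual_real:
  assumes "\<beta> \<in> roots H" "k \<in> {1..n}"
  shows "\<alpha> k (root_dual \<beta>) \<in> \<real>"
proof -
  let ?t = "root_dual \<beta>" and ?s = "\<Sum>j=1..n. complex_of_real (Im (\<alpha> j (root_dual \<beta>))) *\<^sub>C Z j"
  have sH: "?s \<in> H" using Z_in_H subspace_H by (intro subspace_sum subspace_scale) auto
  have \<kappa>_real: "\<kappa> (Z j) (Z l) \<in> \<real>" if "j \<in> {1..n}" "l \<in> {1..n}" for j l
    using that Z_in_H weight_real weight_of by (auto simp: \<kappa>_H intro!: sum_in_Reals Reals_mult)
  have "\<kappa> ?s (Z l) = 0" if l: "l \<in> {1..n}" for l
  proof -
    have "\<beta> (Z l) = \<kappa> (\<Sum>j=1..n. \<alpha> j ?t *\<^sub>C Z j) (Z l)"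
      using root_dual[OF assms(1)] Z_in_H[OF l] H_expand by metis
    also have "\<dots> = (\<Sum>j=1..n. \<alpha> j ?t * \<kappa> (Z j) (Z l))" by (simp add: \<kappa>_sum_left \<kappa>_linear)
    finally have "Im (\<Sum>j=1..n. \<alpha> j ?t * \<kappa> (Z j) (Z l)) = 0"
      using weight_real[of \<beta> l] assms l by (simp add: complex_is_Real_iff)
    moreover have "Im (\<Sum>j=1..n. \<alpha> j ?t * \<kappa> (Z j) (Z l)) =
        (\<Sum>j=1..n. Im (\<alpha> j ?t) * Re (\<kappa> (Z j) (Z l)))"
      unfolding Im_sum using \<kappa>_real l by (intro sum.cong) (auto simp: complex_is_Real_iff)
    ultimately have "(\<Sum>j=1..n. Im (\<alpha> j ?t) * Re (\<kappa> (Z j) (Z l))) = 0" by simp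
    then have "complex_of_real (\<Sum>j=1..n. Im (\<alpha> j ?t) * Re (\<kappa> (Z j) (Z l))) = 0" by simp
    moreover have "\<kappa> ?s (Z l) = complex_of_real (\<Sum>j=1..n. Im (\<alpha> j ?t) * Re (\<kappa> (Z j) (Z l)))"
      unfolding of_real_sum \<kappa>_sum_left
      by (intro sum.cong refl) (use \<kappa>_real l in \<open>auto simp: \<kappa>_linear of_real_Re\<close>)
    ultimately show ?thesis by simp
  qed
  then have "\<kappa> ?s h = 0" if "h \<in> H" for h
    by (subst H_expand[OF that]) (simp only: \<kappa>_sum_right \<kappa>_linear, simp)
  then have "?s = 0" by (rule \<kappa>_H_nondegenerate[OF sH])
  then have "\<alpha> k ?s = 0" using dual_zero[OF simple_root_dual] assms(2) by simp
  moreover have "\<alpha> k ?s = (\<Sum>j=1..n. if j = k then complex_of_real (Im (\<alpha> j ?t)) else 0)"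
    using assms(2) Z_in_H subspace_scale[OF subspace_H] simple_root_dual
    by (subst dual_sum) (auto simp: dual_scale \<alpha>_Z if_distrib[of "\<lambda>x. _ * x"] intro!: sum.cong cong: if_cong)
  ultimately show ?thesis using assms(2) by (simp add: complex_is_Real_iff)
qed

lemma weight_root_dual_real:
  assumes "\<beta> \<in> roots H" "\<mu> \<in> weights"
  shows "\<mu> (root_dual \<beta>) \<in> \<real>"
proof -
  have "\<mu> (root_dual \<beta>) = (\<Sum>k=1..n. \<mu> (Z k) * \<alpha> k (root_dual \<beta>))"
    by (rule dual_expand[OF weight_dual[OF assms(2)] root_dual(1)[OF assms(1)]])
  then show ?thesis using simple_root_root_dual_real weight_real assms
    by (auto intro!: sum_in_Reals Reals_mult)
qed

text \<open>All weights are real at \<open>root_dual \<beta>\<close>, so its Killing square is a sum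
  of real squares. If it were zero, \<open>root_dual \<beta>\<close> would be central, hence zero,
  and so would be \<open>\<beta>\<close>.\<close>

lemma root_norm_pos:
  assumes "\<beta> \<in> roots H"
  obtains r where "0 < r" "\<beta> (root_dual \<beta>) = complex_of_real r"
proof -
  let ?t = "root_dual \<beta>"
  have t: "?t \<in> H" "\<kappa> ?t ?t = \<beta> ?t" using root_dual[OF assms] by auto
  obtain r where r: "\<kappa> ?t ?t = complex_of_real r" "0 \<le> r" "r = 0 \<longrightarrow> (\<forall>x. bracket ?t x = 0)"
    using \<kappa>_self_zero[OF t(1)] weight_root_dual_real assms by blast
  have "r \<noteq> 0"
  proof
    assume "r = 0"
    then have "?t = 0" using r center_trivial t by blast
    then have "\<beta> h = 0" for h
      using root_dual(2)[OF assms, of h] rootsD(1)[OF assms] by (cases "h \<in> H") (auto simp: \<kappa>_linear dual_outside)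
    then have "\<beta> = 0" by auto
    then show False using rootsD[OF assms] by simp
  qed
  then show ?thesis using that r t by force
qed

text \<open>All brackets of opposite root vectors lie on the line through
  \<open>root_dual \<beta>\<close>, so the definite description only fixes a scalar.\<close>

lemma coroot_eq:
  assumes "\<beta> \<in> roots H"
  shows "coroot H \<beta> = (2 / \<beta> (root_dual \<beta>)) *\<^sub>C root_dual \<beta>"
proof -
  let ?t = "root_dual \<beta>"
  let ?S = "{bracket x y |x y. x \<in> \<gg> \<beta> \<and> y \<in> \<gg> (- \<beta>)}"
  obtain r where r: "0 < r" "\<beta> ?t = complex_of_real r" using root_norm_pos[OF assms] .
  obtain e where e: "e \<in> \<gg> \<beta>" "e \<noteq> 0" using rootsD(3)[OF assms] by blast
  then obtain f where f: "f \<in> \<gg> (- \<beta>)" "\<kappa> e f \<noteq> 0"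
    using \<kappa>_weight_nondegenerate assms by blast
  have neg: "(\<lambda>h. - \<beta> h) = - \<beta>" by auto
  have "?S \<subseteq> span {?t}" by (auto simp: bracket_opposite[OF assms] span_singleton)
  then have sub: "span ?S \<subseteq> span {?t}" by (rule span_minimal) (rule subspace_span)
  have "bracket e f \<in> span ?S" using e f by (intro span_base) blast
  then have "(2 / \<beta> ?t / \<kappa> e f) *\<^sub>C bracket e f \<in> span ?S" by (rule span_scale)
  then have mem: "(2 / \<beta> ?t) *\<^sub>C ?t \<in> span ?S"
    using f bracket_opposite[OF assms e(1) f(1)] by simp
  have scale: "\<beta> (c *\<^sub>C ?t) = c * \<beta> ?t" for c
    using dual_scale[OF rootsD(1)[OF assms] root_dual(1)[OF assms]] .
  show ?thesis
    unfolding coroot_def bracket_space_def neg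
  proof (rule the_equality)
    show "(2 / \<beta> ?t) *\<^sub>C ?t \<in> span ?S \<and> \<beta> ((2 / \<beta> ?t) *\<^sub>C ?t) = 2"
      using mem r by (simp add: scale)
  next
    fix s assume s: "s \<in> span ?S \<and> \<beta> s = 2"
    then obtain c where "s = c *\<^sub>C ?t" using sub by (auto simp: span_singleton)
    moreover from this have "c = 2 / \<beta> ?t" using s r scale by (simp add: nonzero_eq_divide_eq)
    ultimately show "s = (2 / \<beta> ?t) *\<^sub>C ?t" by simp
  qed
qed

lemma coroot:
  assumes "\<beta> \<in> roots H"
  shows "coroot H \<beta> \<in> H" "\<beta> (coroot H \<beta>) = 2"
    "\<And>\<phi>. \<phi> \<in> dual \<Longrightarrow> \<phi> (coroot H \<beta>) = 2 * \<phi> (root_dual \<beta>) / \<beta> (root_dual \<beta>)"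
proof -
  obtain r where r: "0 < r" "\<beta> (root_dual \<beta>) = complex_of_real r" using root_norm_pos[OF assms] .
  show "coroot H \<beta> \<in> H"
    unfolding coroot_eq[OF assms] using root_dual[OF assms] subspace_H by (simp add: subspace_scale)
  show *: "\<phi> (coroot H \<beta>) = 2 * \<phi> (root_dual \<beta>) / \<beta> (root_dual \<beta>)" if "\<phi> \<in> dual" for \<phi>
    unfolding coroot_eq[OF assms] using dual_scale[OF that] root_dual[OF assms] by simp
  show "\<beta> (coroot H \<beta>) = 2" using *[OF rootsD(1)[OF assms]] r by simp
qed

lemma root_dual_uminus:
  assumes "\<beta> \<in> roots H"
  shows "root_dual (- \<beta>) = - root_dual \<beta>"
  by (rule root_dual_unique)
    (use root_dual[OF assms] subspace_neg[OF subspace_H] in \<open>auto simp: \<kappa>_linear\<close>)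

lemma dual_uminus: "\<phi> \<in> dual \<Longrightarrow> h \<in> H \<Longrightarrow> \<phi> (- h) = - \<phi> h"
  using dual_scale[of \<phi> h "-1"] by simp

lemma coroot_uminus:
  assumes "\<beta> \<in> roots H"
  shows "coroot H (- \<beta>) = - coroot H \<beta>"
  using root_dual[OF assms] rootsD(1)[OF assms]
  by (simp add: coroot_eq assms root_uminus root_dual_uminus dual_uminus)

lemma sl2_triple:
  assumes "\<beta> \<in> roots H" "e \<in> \<gg> \<beta>" "e \<noteq> 0"
  obtains f where "f \<in> \<gg> (- \<beta>)" "bracket e f = coroot H \<beta>" "\<kappa> e f \<noteq> 0"
proof -
  obtain f where f: "f \<in> \<gg> (- \<beta>)" "\<kappa> e f \<noteq> 0"
    using \<kappa>_weight_nondegenerate assms by blast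
  obtain r where r: "0 < r" "\<beta> (root_dual \<beta>) = complex_of_real r" using root_norm_pos[OF assms(1)] .
  let ?f = "(2 / \<beta> (root_dual \<beta>) / \<kappa> e f) *\<^sub>C f"
  have "bracket e ?f = coroot H \<beta>"
    using f bracket_opposite[OF assms(1,2) f(1)] coroot_eq[OF assms(1)] by (simp add: bracket_scale_right)
  moreover have "?f \<in> \<gg> (- \<beta>)" using f subspace_scale[OF subspace_root_space] by blast
  moreover have "\<kappa> e ?f \<noteq> 0" using f r by (simp add: \<kappa>_linear)
  ultimately show ?thesis using that by blast
qed

subsection \<open>Root strings\<close>

lemma ladder_weight:
  assumes "f \<in> \<gg> \<beta>" "x \<in> \<gg> \<mu>"
  shows "(bracket f ^^ k) x \<in> \<gg> (\<lambda>h. \<mu> h + of_nat k * \<beta> h)"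
proof (induction k)
  case (Suc k)
  have "\<beta> + (\<lambda>h. \<mu> h + of_nat k * \<beta> h) = (\<lambda>h. \<mu> h + of_nat (Suc k) * \<beta> h)"
    by (auto simp: algebra_simps)
  then show ?case using bracket_root_space[OF assms(1) Suc] by simp
qed (use assms in simp)

lemma ladder_terminates:
  assumes "\<beta> \<in> roots H" "\<mu> \<in> dual" "f \<in> \<gg> \<beta>" "x \<in> \<gg> \<mu>"
  shows "\<exists>k. (bracket f ^^ k) x = 0"
proof (rule ccontr)
  assume "\<nexists>k. (bracket f ^^ k) x = 0"
  then have nz: "(bracket f ^^ k) x \<noteq> 0" for k by blast
  let ?w = "\<lambda>k::nat. \<lambda>h. \<mu> h + of_nat k * \<beta> h"
  have "?w k \<in> weights" for k
  proof (cases "?w k = 0")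
    case False
    have "?w k = \<mu> + (\<lambda>h. of_nat k * \<beta> h)" by auto
    then have "?w k \<in> dual"
      using dual_space_add[OF assms(2) dual_space_scale[OF rootsD(1)[OF assms(1)]]] by simp
    then show ?thesis using rootsI[OF _ False ladder_weight[OF assms(3,4)] nz] by blast
  qed blast
  then have "finite (range ?w)"
    using finite_roots finite_subset[of "range ?w" "weights"] by blast
  moreover have "inj ?w"
  proof (rule injI)
    fix k l :: nat assume eq: "?w k = ?w l"
    have "\<exists>h. \<beta> h \<noteq> 0"
    proof (rule ccontr)
      assume "\<nexists>h. \<beta> h \<noteq> 0"
      then have "\<beta> = 0" by auto
      then show False using rootsD(2)[OF assms(1)] by simp
    qed
    then obtain h where "\<beta> h \<noteq> 0" ..
    then show "k = l" using fun_cong[OF eq, of h] by simp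
  qed
  ultimately show False using finite_imageD[of ?w UNIV] by simp
qed

text \<open>The sl2 computation: \<open>e\<close> sends the vector at step \<open>k + 1\<close> of
  the ladder to \<open>(k + 1) * (\<mu> h - k)\<close> times the vector at step \<open>k\<close>. At
  the first zero of the ladder this factor must vanish, so \<open>\<mu> h\<close> is the last step
  \<open>m\<close> with a nonzero vector.\<close>

lemma highest_weight_vector:
  assumes e: "e \<in> \<gg> \<beta>" and f: "f \<in> \<gg> (- \<beta>)" and \<beta>: "\<beta> \<in> roots H"
    and h: "bracket e f = h" "\<beta> h = 2"
    and x: "x \<in> \<gg> \<mu>" "x \<noteq> 0" "\<mu> \<in> dual" "bracket e x = 0"
  obtains m :: nat where "\<mu> h = of_nat m" "\<And>k. k \<le> m \<Longrightarrow> (bracket f ^^ k) x \<noteq> 0"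
proof -
  have hH: "h \<in> H" using bracket_opposite_in_H[OF e f] h by simp
  have step: "bracket e ((bracket f ^^ Suc k) x) = (of_nat (Suc k) * (\<mu> h - of_nat k)) *\<^sub>C (bracket f ^^ k) x" for k
  proof (induction k)
    case 0
    show ?case using bracket_leibniz[of e f x] h x hH by (simp add: root_space_def)
  next
    case (Suc k)
    let ?y = "(bracket f ^^ Suc k) x"
    have "bracket h ?y = (\<mu> h - 2 * of_nat (Suc k)) *\<^sub>C ?y"
      using root_spaceD[OF ladder_weight[OF f x(1), of "Suc k"] hH] h(2) by (simp add: algebra_simps)
    moreover have "bracket f (bracket e ?y) = (of_nat (Suc k) * (\<mu> h - of_nat k)) *\<^sub>C ?y"
      unfolding Suc by (simp add: bracket_scale_right)
    ultimately have "bracket e (bracket f ?y) =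
        (\<mu> h - 2 * of_nat (Suc k)) *\<^sub>C ?y + (of_nat (Suc k) * (\<mu> h - of_nat k)) *\<^sub>C ?y"
      using bracket_leibniz[of e f ?y] h(1) by (simp only:)
    also have "\<dots> = (of_nat (Suc (Suc k)) * (\<mu> h - of_nat (Suc k))) *\<^sub>C ?y"
      unfolding scale_left_distrib[symmetric] by (intro arg_cong2[where f = scale]) (auto simp: algebra_simps)
    finally show ?case by simp
  qed
  obtain k where k: "(bracket f ^^ k) x = 0" "\<And>l. l < k \<Longrightarrow> (bracket f ^^ l) x \<noteq> 0"
    using ladder_terminates[OF root_uminus[OF \<beta>] x(3) f x(1)]
      exists_least_iff[of "\<lambda>k. (bracket f ^^ k) x = 0"] by blast
  have "k \<noteq> 0" using k x by (metis funpow_0)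
  then obtain m where m: "k = Suc m" using not0_implies_Suc by blast
  have "(of_nat (Suc m) * (\<mu> h - of_nat m)) *\<^sub>C (bracket f ^^ m) x = 0"
    using step[of m] k(1) m by simp
  moreover have "(of_nat (Suc m) :: complex) \<noteq> 0" by (rule of_nat_neq_0)
  ultimately have "\<mu> h = of_nat m" using k(2)[of m] m by simp
  then show ?thesis by (rule that) (use k(2) m in auto)
qed

lemma lowest_weight_vector:
  assumes "e \<in> \<gg> \<beta>" "f \<in> \<gg> (- \<beta>)" "\<beta> \<in> roots H"
    and "bracket e f = h" "\<beta> h = 2"
    and "x \<in> \<gg> \<mu>" "x \<noteq> 0" "\<mu> \<in> dual" "bracket f x = 0"
  obtains m :: nat where "\<mu> h = - of_nat m"
proof -
  have hH: "h \<in> H" using bracket_opposite_in_H[OF assms(1,2)] assms(4) by simp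
  have e: "e \<in> \<gg> (- (- \<beta>))" using assms by simp
  have fe: "bracket f e = - h" using assms(4) bracket_anticommute[of f e] by simp
  have "(- \<beta>) (- h) = 2" using assms dual_uminus[OF rootsD(1)[OF assms(3)] hH] by simp
  from highest_weight_vector[OF assms(2) e root_uminus[OF assms(3)] fe this assms(6-9)]
  obtain m :: nat where "\<mu> (- h) = of_nat m" by blast
  then have "\<mu> h = - of_nat m" using dual_uminus[OF assms(8) hH] by (metis minus_minus)
  then show ?thesis by (rule that)
qed

text \<open>Subtracting a multiple of \<open>e\<close> makes \<open>x\<close> orthogonal to
  \<open>f\<close>, hence killed by \<open>f\<close>. A nonzero remainder would be a lowest weight
  vector on which the coroot acts by 2, whereas such a value cannot be positive.\<close>

lemma root_space_one_dimensional:
  assumes "\<beta> \<in> roots H" "e \<in> \<gg> \<beta>" "e \<noteq> 0" "x \<in> \<gg> \<beta>"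
  obtains c where "x = c *\<^sub>C e"
proof -
  obtain f where f: "f \<in> \<gg> (- \<beta>)" "bracket e f = coroot H \<beta>" "\<kappa> e f \<noteq> 0"
    using sl2_triple[OF assms(1-3)] .
  let ?c = "\<kappa> x f / \<kappa> e f"
  let ?y = "x - ?c *\<^sub>C e"
  have y: "?y \<in> \<gg> \<beta>"
    using assms subspace_diff[OF subspace_root_space] subspace_scale[OF subspace_root_space] by blast
  have "\<kappa> ?y f = 0" using f by (simp add: \<kappa>_linear)
  then have "bracket ?y f = 0" using bracket_opposite[OF assms(1) y f(1)] by simp
  then have fy: "bracket f ?y = 0" using bracket_anticommute[of f ?y] by simp
  have "?y = 0"
  proof (rule ccontr)
    assume "?y \<noteq> 0"
    then obtain m :: nat where "\<beta> (coroot H \<beta>) = - of_nat m"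
      using lowest_weight_vector[OF assms(2) f(1) assms(1) f(2) coroot(2)[OF assms(1)] y _
          rootsD(1)[OF assms(1)] fy] by blast
    then have "complex_of_real 2 = complex_of_real (- real m)" using coroot(2)[OF assms(1)] by simp
    then have "2 = - real m" by (simp only: of_real_eq_iff)
    then show False by simp
  qed
  then show ?thesis using that[of ?c] by simp
qed

text \<open>If \<open>bracket x y = 0\<close>, then \<open>y\<close> is a highest weight vector for
  the sl2 of \<open>a\<close>, so \<open>b\<close> is nonnegative on the coroot of \<open>a\<close>.
  By invariance and one-dimensionality \<open>x\<close> also kills the root space of
  \<open>- (a + b)\<close>, so \<open>- (a + b)\<close> is nonnegative there as well, which makes
  \<open>b\<close> at most -2 on the coroot.\<close>

lemma bracket_root_vectors_nonzero:
  assumes a: "a \<in> roots H" and b: "b \<in> roots H" and ab: "a + b \<in> roots H"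
    and x: "x \<in> \<gg> a" "x \<noteq> 0" and y: "y \<in> \<gg> b" "y \<noteq> 0"
  shows "bracket x y \<noteq> 0"
proof
  assume xy: "bracket x y = 0"
  obtain f where f: "f \<in> \<gg> (- a)" "bracket x f = coroot H a"
    using sl2_triple[OF a x] by metis
  obtain m :: nat where m: "b (coroot H a) = of_nat m"
    using highest_weight_vector[OF x(1) f(1) a f(2) coroot(2)[OF a] y rootsD(1)[OF b] xy] by metis
  obtain z where z: "z \<in> \<gg> (- (a + b))" "z \<noteq> 0"
    using rootsD(3)[OF root_uminus[OF ab]] by blast
  have "bracket x z \<in> \<gg> (a + - (a + b))" by (rule bracket_root_space[OF x(1) z(1)])
  then have xz: "bracket x z \<in> \<gg> (- b)" by simp
  have "bracket x z = 0"
  proof (rule ccontr)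
    assume "bracket x z \<noteq> 0"
    then obtain y' where y': "y' \<in> \<gg> (- (- b))" "\<kappa> (bracket x z) y' \<noteq> 0"
      using \<kappa>_weight_nondegenerate[OF _ xz] root_uminus[OF b] by blast
    then obtain c where c: "y' = c *\<^sub>C y" using root_space_one_dimensional[OF b y] by auto
    have "\<kappa> (bracket x z) y' = - \<kappa> z (bracket x y')"
      by (simp add: bracket_anticommute[of x z] \<kappa>_linear \<kappa>_invariant)
    also have "\<dots> = 0" using c xy by (simp add: bracket_scale_right \<kappa>_linear)
    finally show False using y' by simp
  qed
  then obtain m' :: nat where m': "(- (a + b)) (coroot H a) = of_nat m'"
    using highest_weight_vector[OF x(1) f(1) a f(2) coroot(2)[OF a] z rootsD(1)[OF root_uminus[OF ab]]]
    by metis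
  have "complex_of_real (- 2 - real m) = complex_of_real (real m')"
    using m m' coroot(2)[OF a] by simp
  then have "- 2 - real m = real m'" by (simp only: of_real_eq_iff)
  then show False by simp
qed

text \<open>The triple bracket of root vectors is nonzero, while the Leibniz rule writes it through
  brackets in the root spaces of \<open>x + s\<close> and \<open>x + t\<close>. This is the Jacobi
  hypothesis of the descent on decompositions.\<close>

lemma root_sum_cases:
  assumes "x \<in> roots H" "s \<in> roots H" "t \<in> roots H" "s + t \<in> roots H" "x + (s + t) \<in> roots H"
    and "x + s \<noteq> 0" "x + t \<noteq> 0"
  shows "x + s \<in> roots H \<or> x + t \<in> roots H"
proof (rule ccontr)
  assume neg: "\<not> ?thesis"
  obtain u where u: "u \<in> \<gg> x" "u \<noteq> 0" using rootsD(3)[OF assms(1)] by blast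
  obtain v where v: "v \<in> \<gg> s" "v \<noteq> 0" using rootsD(3)[OF assms(2)] by blast
  obtain y where y: "y \<in> \<gg> t" "y \<noteq> 0" using rootsD(3)[OF assms(3)] by blast
  have "bracket v y \<noteq> 0" "bracket v y \<in> \<gg> (s + t)"
    using bracket_root_vectors_nonzero[OF assms(2-4) v y] bracket_root_space[OF v(1) y(1)] by auto
  then have "bracket u (bracket v y) \<noteq> 0"
    using bracket_root_vectors_nonzero[OF assms(1,4,5) u] by blast
  moreover have "bracket u v = 0"
    using neg assms(6) rootsI[OF dual_space_add[OF rootsD(1)[OF assms(1)] rootsD(1)[OF assms(2)]]
        _ bracket_root_space[OF u(1) v(1)]] by blast
  moreover have "bracket u y = 0"
    using neg assms(7) rootsI[OF dual_space_add[OF rootsD(1)[OF assms(1)] rootsD(1)[OF assms(3)]]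
        _ bracket_root_space[OF u(1) y(1)]] by blast
  ultimately show False using bracket_leibniz[of u v y] by simp
qed

lemma double_not_root:
  assumes "\<beta> \<in> roots H"
  shows "\<beta> + \<beta> \<notin> roots H"
proof
  assume "\<beta> + \<beta> \<in> roots H"
  moreover obtain x where "x \<in> \<gg> \<beta>" "x \<noteq> 0" using rootsD(3)[OF assms] by blast
  ultimately have "bracket x x \<noteq> 0" using bracket_root_vectors_nonzero assms by blast
  then show False using bracket_self by simp
qed

lemma reflection_apply: "\<phi> \<in> dual \<Longrightarrow> reflection H \<beta> \<phi> = (\<lambda>h. \<phi> h - \<phi> (coroot H \<beta>) * \<beta> h)"
  by (simp add: reflection_def)

text \<open>Climb \<open>r\<close> steps with \<open>e\<close> to a highest weight vector of weight
  \<open>m\<close>, so that the pairing is \<open>m - 2 * r\<close>, then descend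
  \<open>m - r\<close> steps with \<open>f\<close> to the reflected weight. The condition
  \<open>0 \<le> q\<close> ensures \<open>r \<le> m\<close>; the other sign is treated through
  \<open>- \<beta>\<close>.\<close>

lemma reflection_root_aux:
  assumes \<beta>: "\<beta> \<in> roots H" and \<phi>: "\<phi> \<in> roots H"
  shows "\<exists>q::int. \<phi> (coroot H \<beta>) = of_int q \<and> (0 \<le> q \<longrightarrow> reflection H \<beta> \<phi> \<in> roots H)"
proof -
  obtain x where x: "x \<in> \<gg> \<phi>" "x \<noteq> 0" using rootsD(3)[OF \<phi>] by blast
  obtain e where e: "e \<in> \<gg> \<beta>" "e \<noteq> 0" using rootsD(3)[OF \<beta>] by blast
  obtain f where f: "f \<in> \<gg> (- \<beta>)" "bracket e f = coroot H \<beta>"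
    using sl2_triple[OF \<beta> e] by metis
  obtain k where k: "(bracket e ^^ k) x = 0" "\<And>l. l < k \<Longrightarrow> (bracket e ^^ l) x \<noteq> 0"
    using ladder_terminates[OF \<beta> rootsD(1)[OF \<phi>] e(1) x(1)]
      exists_least_iff[of "\<lambda>k. (bracket e ^^ k) x = 0"] by blast
  have "k \<noteq> 0" using k x by (metis funpow_0)
  then obtain r where r: "k = Suc r" using not0_implies_Suc by blast
  let ?v = "(bracket e ^^ r) x" and ?\<mu> = "\<lambda>h. \<phi> h + of_nat r * \<beta> h"
  have v: "?v \<in> \<gg> ?\<mu>" "?v \<noteq> 0" "bracket e ?v = 0"
    using ladder_weight[OF e(1) x(1)] k r by auto
  have "?\<mu> = \<phi> + (\<lambda>h. of_nat r * \<beta> h)" by auto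
  then have \<mu>: "?\<mu> \<in> dual"
    using dual_space_add[OF rootsD(1)[OF \<phi>] dual_space_scale[OF rootsD(1)[OF \<beta>]]] by simp
  obtain m :: nat where m: "?\<mu> (coroot H \<beta>) = of_nat m" "\<And>k. k \<le> m \<Longrightarrow> (bracket f ^^ k) ?v \<noteq> 0"
    using highest_weight_vector[OF e(1) f(1) \<beta> f(2) coroot(2)[OF \<beta>] v(1,2) \<mu> v(3)] by blast
  have q: "\<phi> (coroot H \<beta>) = of_int (int m - 2 * int r)"
    using m(1) coroot(2)[OF \<beta>] by (simp add: algebra_simps)
  have "reflection H \<beta> \<phi> \<in> roots H" if "0 \<le> int m - 2 * int r"
  proof -
    have mr: "2 * r \<le> m" using that by simp
    then have rm: "r \<le> m" by simp
    have nz: "(bracket f ^^ (m - r)) ?v \<noteq> 0" by (rule m(2)) simp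
    have "(\<lambda>h. ?\<mu> h + of_nat (m - r) * (- \<beta>) h) = reflection H \<beta> \<phi>"
      unfolding reflection_apply[OF rootsD(1)[OF \<phi>]] q
      using rm by (auto simp: of_nat_diff algebra_simps)
    then have w: "(bracket f ^^ (m - r)) ?v \<in> \<gg> (reflection H \<beta> \<phi>)"
      using ladder_weight[OF f(1) v(1), of "m - r"] by simp
    have eq: "reflection H \<beta> \<phi> = \<phi> - (\<lambda>h. \<phi> (coroot H \<beta>) * \<beta> h)"
      unfolding reflection_apply[OF rootsD(1)[OF \<phi>]] by auto
    have dual: "reflection H \<beta> \<phi> \<in> dual"
      unfolding eq by (rule dual_space_diff[OF rootsD(1)[OF \<phi>] dual_space_scale[OF rootsD(1)[OF \<beta>]]])
    have "reflection H \<beta> \<phi> \<noteq> 0"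
    proof
      assume "reflection H \<beta> \<phi> = 0"
      then have z: "\<phi> h = \<phi> (coroot H \<beta>) * \<beta> h" for h
        unfolding reflection_apply[OF rootsD(1)[OF \<phi>]] by (metis diff_eq_diff_eq diff_self zero_fun_apply)
      from z[of "coroot H \<beta>"] have c0: "\<phi> (coroot H \<beta>) = 0" using coroot(2)[OF \<beta>] by simp
      have "\<phi> h = 0" for h by (rule trans[OF z]) (simp add: c0)
      then have "\<phi> = 0" by auto
      then show False using rootsD(2)[OF \<phi>] by simp
    qed
    then show ?thesis by (rule rootsI[OF dual _ w nz])
  qed
  then show ?thesis using q by blast
qed

lemma cartan_integer:
  assumes "\<beta> \<in> roots H" "\<phi> \<in> roots H"
  obtains q :: int where "\<phi> (coroot H \<beta>) = of_int q"
  using reflection_root_aux[OF assms] by blast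

lemma reflection_uminus:
  assumes "\<beta> \<in> roots H"
  shows "reflection H (- \<beta>) = reflection H \<beta>"
  unfolding reflection_def coroot_uminus[OF assms]
  by (auto simp: fun_eq_iff dual_uminus coroot(1)[OF assms])

lemma reflection_root:
  assumes "\<beta> \<in> roots H" "\<phi> \<in> roots H"
  shows "reflection H \<beta> \<phi> \<in> roots H"
proof -
  obtain q :: int where q: "\<phi> (coroot H \<beta>) = of_int q" "0 \<le> q \<longrightarrow> reflection H \<beta> \<phi> \<in> roots H"
    using reflection_root_aux[OF assms] by blast
  obtain p :: int where p: "\<phi> (coroot H (- \<beta>)) = of_int p" "0 \<le> p \<longrightarrow> reflection H (- \<beta>) \<phi> \<in> roots H"
    using reflection_root_aux[OF root_uminus[OF assms(1)] assms(2)] by blast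
  have "complex_of_int p = of_int (- q)"
    using p q dual_uminus[OF rootsD(1)[OF assms(2)] coroot(1)[OF assms(1)]]
    by (simp add: coroot_uminus[OF assms(1)])
  then have "p = - q" by (simp only: of_int_eq_iff)
  then show ?thesis using p(2) q(2) reflection_uminus[OF assms(1)] by (cases "0 \<le> q") auto
qed

text \<open>Were the difference not a root, \<open>f\<close> would kill the root vector of
  \<open>\<phi>\<close>, which would then be a lowest weight vector with nonpositive
  pairing.\<close>

lemma root_diff:
  assumes \<beta>: "\<beta> \<in> roots H" and \<phi>: "\<phi> \<in> roots H" and "\<phi> \<noteq> \<beta>"
    and q: "\<phi> (coroot H \<beta>) = of_int q" "0 < q"
  shows "\<phi> - \<beta> \<in> roots H"
proof (rule ccontr)
  assume neg: "\<phi> - \<beta> \<notin> roots H"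
  obtain x where x: "x \<in> \<gg> \<phi>" "x \<noteq> 0" using rootsD(3)[OF \<phi>] by blast
  obtain e where e: "e \<in> \<gg> \<beta>" "e \<noteq> 0" using rootsD(3)[OF \<beta>] by blast
  obtain f where f: "f \<in> \<gg> (- \<beta>)" "bracket e f = coroot H \<beta>"
    using sl2_triple[OF \<beta> e] by metis
  have "bracket f x \<in> \<gg> (- \<beta> + \<phi>)" by (rule bracket_root_space[OF f(1) x(1)])
  then have "bracket f x \<in> \<gg> (\<phi> - \<beta>)" by (simp add: algebra_simps)
  then have "bracket f x = 0"
    using neg assms(3) rootsI[OF dual_space_diff[OF rootsD(1)[OF \<phi>] rootsD(1)[OF \<beta>]]] by auto
  then obtain m :: nat where "\<phi> (coroot H \<beta>) = - of_nat m"
    using lowest_weight_vector[OF e(1) f(1) \<beta> f(2) coroot(2)[OF \<beta>] x rootsD(1)[OF \<phi>]] by blast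
  then have "complex_of_int q = of_int (- int m)" using q by simp
  then have "q = - int m" by (simp only: of_int_eq_iff)
  then show False using q by simp
qed

subsection \<open>Positive roots\<close>

text \<open>The floor only converts the value to \<open>int\<close>; it is exact on roots, whose
  values at \<open>Z k\<close> are integers.\<close>

definition coef :: "('g \<Rightarrow> complex) \<Rightarrow> nat \<Rightarrow> int"
  where "coef \<beta> k = \<lfloor>Re (\<beta> (Z k))\<rfloor>"

definition height :: "('g \<Rightarrow> complex) \<Rightarrow> int"
  where "height \<beta> = (\<Sum>k=1..n. coef \<beta> k)"

abbreviation pos :: "('g \<Rightarrow> complex) set"
  where "pos \<equiv> pos_roots H n \<alpha>"

lemma root_Z: "\<beta> \<in> roots H \<Longrightarrow> k \<in> {1..n} \<Longrightarrow> \<beta> (Z k) = of_int (coef \<beta> k)"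
  by (rule root_coeffs[of \<beta>]) (simp_all add: coef_def)

lemma coef_eqI: "\<beta> (Z k) = of_int c \<Longrightarrow> coef \<beta> k = c"
  by (simp add: coef_def)

lemma coef_add:
  "\<beta> \<in> roots H \<Longrightarrow> \<gamma> \<in> roots H \<Longrightarrow> k \<in> {1..n} \<Longrightarrow> coef (\<beta> + \<gamma>) k = coef \<beta> k + coef \<gamma> k"
  by (rule coef_eqI) (simp add: root_Z)

lemma coef_uminus: "\<beta> \<in> roots H \<Longrightarrow> k \<in> {1..n} \<Longrightarrow> coef (- \<beta>) k = - coef \<beta> k"
  by (rule coef_eqI) (simp add: root_Z)

lemma coef_simple: "j \<in> {1..n} \<Longrightarrow> k \<in> {1..n} \<Longrightarrow> coef (\<alpha> j) k = (if j = k then 1 else 0)"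
  by (rule coef_eqI) (simp add: \<alpha>_Z)

lemma coef_sign:
  assumes "\<beta> \<in> roots H"
  shows "(\<forall>k\<in>{1..n}. 0 \<le> coef \<beta> k) \<or> (\<forall>k\<in>{1..n}. coef \<beta> k \<le> 0)"
proof -
  obtain c where "(\<forall>j\<in>{1..n}. 0 \<le> c j) \<or> (\<forall>j\<in>{1..n}. c j \<le> 0)"
    "\<And>j. j \<in> {1..n} \<Longrightarrow> \<beta> (Z j) = of_int (c j)"
    using root_coeffs[OF assms] by blast
  moreover from this have "coef \<beta> j = c j" if "j \<in> {1..n}" for j using coef_eqI that by blast
  ultimately show ?thesis by auto
qed

lemma coef_nonzero:
  assumes "\<beta> \<in> roots H"
  shows "\<exists>k\<in>{1..n}. coef \<beta> k \<noteq> 0"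
proof (rule ccontr)
  assume "\<not> ?thesis"
  then have "\<beta> (Z k) = 0 (Z k)" if "k \<in> {1..n}" for k using root_Z[OF assms that] that by simp
  then have "\<beta> = 0" by (rule dual_eqI[OF rootsD(1)[OF assms] dual_space_zero])
  then show False using rootsD(2)[OF assms] by simp
qed

lemma pos_roots_iff: "\<beta> \<in> pos \<longleftrightarrow> \<beta> \<in> roots H \<and> (\<forall>k\<in>{1..n}. 0 \<le> coef \<beta> k)"
proof (intro iffI conjI ballI)
  assume "\<beta> \<in> pos"
  then obtain c :: "nat \<Rightarrow> nat" where c: "\<beta> \<in> roots H" "\<beta> = (\<lambda>h. \<Sum>j=1..n. of_nat (c j) * \<alpha> j h)"
    unfolding pos_roots_def by blast
  then show "\<beta> \<in> roots H" by blast
  fix k assume k: "k \<in> {1..n}"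
  have "\<beta> (Z k) = (\<Sum>j=1..n. if j = k then of_nat (c j) else 0)"
    unfolding c(2) using k \<alpha>_Z by (intro sum.cong) auto
  then have "\<beta> (Z k) = of_int (int (c k))" using k by simp
  from coef_eqI[of \<beta> k "int (c k)", OF this] show "0 \<le> coef \<beta> k" by simp
next
  assume \<beta>: "\<beta> \<in> roots H \<and> (\<forall>k\<in>{1..n}. 0 \<le> coef \<beta> k)"
  have "\<beta> = (\<lambda>h. \<Sum>j=1..n. of_nat (nat (coef \<beta> j)) * \<alpha> j h)"
  proof
    fix h
    show "\<beta> h = (\<Sum>j=1..n. of_nat (nat (coef \<beta> j)) * \<alpha> j h)"
    proof (cases "h \<in> H")
      case True
      then have "\<beta> h = (\<Sum>j=1..n. \<beta> (Z j) * \<alpha> j h)"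
        using dual_expand rootsD(1) \<beta> by blast
      also have "\<dots> = (\<Sum>j=1..n. of_nat (nat (coef \<beta> j)) * \<alpha> j h)"
        using \<beta> root_Z by (intro sum.cong) auto
      finally show ?thesis .
    next
      case False
      have "\<beta> h = 0" by (rule dual_outside[OF rootsD(1) False]) (use \<beta> in blast)
      moreover have "\<alpha> j h = 0" if "j \<in> {1..n}" for j
        by (rule dual_outside[OF simple_root_dual[OF that] False])
      ultimately show ?thesis by simp
    qed
  qed
  then have "\<exists>c::nat \<Rightarrow> nat. \<beta> = (\<lambda>h. \<Sum>j=1..n. of_nat (c j) * \<alpha> j h)"
    by (rule exI[of _ "\<lambda>j. nat (coef \<beta> j)"])
  then show "\<beta> \<in> pos" unfolding pos_roots_def mem_Collect_eq using \<beta> by (intro conjI) simp_all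
qed

lemma pos_root: "\<beta> \<in> pos \<Longrightarrow> \<beta> \<in> roots H"
  by (simp add: pos_roots_iff)

lemma neg_roots_iff: "\<beta> \<in> neg_roots H n \<alpha> \<longleftrightarrow> - \<beta> \<in> pos"
proof -
  have "\<beta> \<in> roots H \<longleftrightarrow> - \<beta> \<in> roots H" using root_uminus[of \<beta>] root_uminus[of "- \<beta>"] by auto
  moreover have "\<beta> = (\<lambda>h. - f h) \<longleftrightarrow> - \<beta> = f" for f :: "'g \<Rightarrow> complex"
  proof -
    have "(\<lambda>h. - f h) = - f" by auto
    then show ?thesis by (metis minus_minus)
  qed
  ultimately show ?thesis unfolding neg_roots_def pos_roots_def by simp
qed

lemma pos_or_neg: "\<beta> \<in> roots H \<Longrightarrow> \<beta> \<in> pos \<or> - \<beta> \<in> pos"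
  using coef_sign by (auto simp: pos_roots_iff coef_uminus root_uminus)

lemma not_pos_and_neg:
  assumes "\<beta> \<in> pos"
  shows "- \<beta> \<notin> pos"
proof
  assume "- \<beta> \<in> pos"
  then have "coef \<beta> k = 0" if "k \<in> {1..n}" for k
    using assms that coef_uminus[OF pos_root[OF assms] that] by (force simp: pos_roots_iff)
  then show False using coef_nonzero pos_root assms by blast
qed

lemma pos_rootI:
  assumes "\<beta> \<in> roots H" "k \<in> {1..n}" "0 < coef \<beta> k"
  shows "\<beta> \<in> pos"
  using coef_sign[OF assms(1)] assms by (meson not_le pos_roots_iff)

lemma pos_coef: "\<beta> \<in> pos \<Longrightarrow> k \<in> {1..n} \<Longrightarrow> 0 \<le> coef \<beta> k"
  by (simp add: pos_roots_iff)

lemma pos_add: "\<beta> \<in> pos \<Longrightarrow> \<gamma> \<in> pos \<Longrightarrow> \<beta> + \<gamma> \<in> roots H \<Longrightarrow> \<beta> + \<gamma> \<in> pos"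
  by (simp add: pos_roots_iff coef_add)

lemma pos_sum_nonzero: "\<beta> \<in> pos \<Longrightarrow> \<gamma> \<in> pos \<Longrightarrow> \<beta> + \<gamma> \<noteq> 0"
  using not_pos_and_neg[of \<beta>] by (auto simp: add_eq_0_iff)

lemma simple_pos: "k \<in> {1..n} \<Longrightarrow> \<alpha> k \<in> pos"
  using simple_root coef_simple by (auto simp: pos_roots_iff)

lemma height_add: "\<beta> \<in> roots H \<Longrightarrow> \<gamma> \<in> roots H \<Longrightarrow> height (\<beta> + \<gamma>) = height \<beta> + height \<gamma>"
  by (simp add: height_def coef_add sum.distrib)

lemma height_pos: "\<beta> \<in> pos \<Longrightarrow> 0 < height \<beta>"
proof -
  assume \<beta>: "\<beta> \<in> pos"
  then obtain k where "k \<in> {1..n}" "coef \<beta> k \<noteq> 0" using coef_nonzero pos_root by blast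
  moreover from this have "0 < coef \<beta> k" using \<beta> by (auto simp: pos_roots_iff order.order_iff_strict)
  ultimately show ?thesis
    unfolding height_def using \<beta> by (intro sum_pos2) (auto simp: pos_roots_iff)
qed

lemma height_simple: "k \<in> {1..n} \<Longrightarrow> height (\<alpha> k) = 1"
  by (simp add: height_def coef_simple)

text \<open>The positive norm of \<open>\<beta>\<close> is the sum of its inner products with the
  simple roots, weighted by nonnegative coefficients, so some term is positive.\<close>

lemma pos_root_positive_pairing:
  assumes "\<beta> \<in> pos"
  obtains k and q :: int where "k \<in> {1..n}" "\<beta> (coroot H (\<alpha> k)) = of_int q" "0 < q"
proof -
  have \<beta>: "\<beta> \<in> roots H" using assms by (rule pos_root)
  obtain r where r: "0 < r" "\<beta> (root_dual \<beta>) = complex_of_real r" using root_norm_pos[OF \<beta>] .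
  have "\<beta> (root_dual \<beta>) = (\<Sum>k=1..n. \<beta> (Z k) * \<alpha> k (root_dual \<beta>))"
    by (rule dual_expand[OF rootsD(1)[OF \<beta>] root_dual(1)[OF \<beta>]])
  also have "\<dots> = (\<Sum>k=1..n. of_int (coef \<beta> k) * \<beta> (root_dual (\<alpha> k)))"
    using root_dual_commute[OF \<beta>] simple_root root_Z[OF \<beta>] by (intro sum.cong) auto
  finally have eq: "\<beta> (root_dual \<beta>) = (\<Sum>k=1..n. of_int (coef \<beta> k) * \<beta> (root_dual (\<alpha> k)))" .
  have "Re (\<Sum>k=1..n. of_int (coef \<beta> k) * \<beta> (root_dual (\<alpha> k))) = r"
    unfolding eq[symmetric] r(2) by simp
  then have "0 < (\<Sum>k=1..n. of_int (coef \<beta> k) * Re (\<beta> (root_dual (\<alpha> k))))" using r by simp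
  then obtain k where k: "k \<in> {1..n}" "0 < of_int (coef \<beta> k) * Re (\<beta> (root_dual (\<alpha> k)))"
    by (meson not_le sum_nonpos)
  have "0 \<le> coef \<beta> k" using assms k by (simp add: pos_roots_iff)
  then have re: "0 < Re (\<beta> (root_dual (\<alpha> k)))" using k(2) by (simp add: zero_less_mult_iff)
  have \<alpha>: "\<alpha> k \<in> roots H" using simple_root k by blast
  obtain s where s: "0 < s" "\<alpha> k (root_dual (\<alpha> k)) = complex_of_real s" using root_norm_pos[OF \<alpha>] .
  obtain q :: int where q: "\<beta> (coroot H (\<alpha> k)) = of_int q" using cartan_integer[OF \<alpha> \<beta>] .
  have "\<beta> (coroot H (\<alpha> k)) = 2 * \<beta> (root_dual (\<alpha> k)) / complex_of_real s"
    using coroot(3)[OF \<alpha> rootsD(1)[OF \<beta>]] s by simp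
  then have "Re (of_int q) = 2 * Re (\<beta> (root_dual (\<alpha> k))) / s" using q by (simp add: Re_divide_of_real)
  then have "0 < real_of_int q" using re s by simp
  then have "0 < q" by simp
  then show ?thesis using that k q by blast
qed

text \<open>A simple root with positive pairing can be subtracted. If the result were negative, that
  simple root would be a sum of two positive roots and have height at least 2.\<close>

lemma pos_root_split:
  assumes "\<beta> \<in> pos" "\<beta> \<notin> \<alpha> ` {1..n}"
  obtains k where "k \<in> {1..n}" "\<beta> - \<alpha> k \<in> pos"
proof -
  obtain k and q :: int where k: "k \<in> {1..n}" "\<beta> (coroot H (\<alpha> k)) = of_int q" "0 < q"
    using pos_root_positive_pairing[OF assms(1)] .
  have \<beta>: "\<beta> \<in> roots H" and \<alpha>: "\<alpha> k \<in> roots H" using assms(1) pos_root simple_root k by auto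
  have "\<beta> \<noteq> \<alpha> k" using assms(2) k by auto
  then have d: "\<beta> - \<alpha> k \<in> roots H" using root_diff[OF \<alpha> \<beta> _ k(2,3)] by blast
  have "\<beta> - \<alpha> k \<in> pos"
  proof (rule ccontr)
    assume "\<beta> - \<alpha> k \<notin> pos"
    then have "- (\<beta> - \<alpha> k) \<in> pos" using pos_or_neg d by blast
    then have neg: "\<alpha> k - \<beta> \<in> pos" by simp
    have "height (\<alpha> k) = height (\<alpha> k - \<beta>) + height \<beta>"
      using height_add[OF pos_root[OF neg] \<beta>] by simp
    then show False using height_pos[OF neg] height_pos[OF assms(1)] height_simple[OF k(1)] by simp
  qed
  then show ?thesis using that k by blast
qed

text \<open>Removing simple roots one at a time reaches a simple root. Applied to a difference of
  two additive functions, this proves identities on positive roots by checking them on simple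
  roots.\<close>

lemma additive_on_pos_zero:
  assumes "\<And>\<beta> \<gamma>. \<beta> \<in> pos \<Longrightarrow> \<gamma> \<in> pos \<Longrightarrow> L (\<beta> + \<gamma>) = L \<beta> + (L \<gamma> :: int)"
    and "\<And>k. k \<in> {1..n} \<Longrightarrow> L (\<alpha> k) = 0" and "\<beta> \<in> pos"
  shows "L \<beta> = 0"
  using assms(3)
proof (induction "nat (height \<beta>)" arbitrary: \<beta> rule: less_induct)
  case less
  show ?case
  proof (cases "\<beta> \<in> \<alpha> ` {1..n}")
    case True
    then show ?thesis using assms(2) by blast
  next
    case False
    then obtain k where k: "k \<in> {1..n}" "\<beta> - \<alpha> k \<in> pos" using pos_root_split less.prems by blast
    have sum: "\<beta> = (\<beta> - \<alpha> k) + \<alpha> k" by simp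
    have "height \<beta> = height (\<beta> - \<alpha> k) + height (\<alpha> k)"
      using height_add[OF pos_root[OF k(2)] simple_root[OF k(1)]] by simp
    then have "L (\<beta> - \<alpha> k) = 0"
      using less.hyps[OF _ k(2)] height_pos[OF k(2)] height_simple[OF k(1)] by simp
    then show ?thesis using assms(1)[OF k(2) simple_pos[OF k(1)]] assms(2)[OF k(1)] by simp
  qed
qed

text \<open>In a counterexample only \<open>\<alpha> k\<close> can be subtracted, and by induction
  the result is \<open>\<alpha> k\<close> itself; but twice a root is not a root.\<close>

lemma multiple_simple_root:
  assumes "\<beta> \<in> pos" "k \<in> {1..n}" "\<And>j. j \<in> {1..n} \<Longrightarrow> j \<noteq> k \<Longrightarrow> coef \<beta> j = 0"
  shows "\<beta> = \<alpha> k"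
  using assms
proof (induction "nat (height \<beta>)" arbitrary: \<beta> rule: less_induct)
  case less
  show ?case
  proof (rule ccontr)
    assume neq: "\<beta> \<noteq> \<alpha> k"
    have \<beta>: "\<beta> \<in> roots H" using less.prems pos_root by blast
    have "\<beta> \<notin> \<alpha> ` {1..n}"
    proof
      assume "\<beta> \<in> \<alpha> ` {1..n}"
      then obtain j where j: "j \<in> {1..n}" "\<beta> = \<alpha> j" by blast
      then have "j \<noteq> k" using neq by blast
      then show False using less.prems(3)[OF j(1)] coef_simple j by simp
    qed
    then obtain j where j: "j \<in> {1..n}" "\<beta> - \<alpha> j \<in> pos" using pos_root_split less.prems by blast
    have c: "coef (\<beta> - \<alpha> j) l = coef \<beta> l - coef (\<alpha> j) l" if "l \<in> {1..n}" for l
      using coef_add[OF \<beta> root_uminus[OF simple_root[OF j(1)]] that] coef_uminus[OF simple_root[OF j(1)] that]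
      by simp
    have "0 \<le> coef (\<beta> - \<alpha> j) j" using j by (simp add: pos_roots_iff)
    then have "coef \<beta> j \<noteq> 0" using c[OF j(1)] coef_simple j by simp
    then have jk: "j = k" using less.prems(3) j by blast
    have "height \<beta> = height (\<beta> - \<alpha> j) + 1"
      using height_add[OF pos_root[OF j(2)] simple_root[OF j(1)]] height_simple[OF j(1)] by simp
    then have "nat (height (\<beta> - \<alpha> j)) < nat (height \<beta>)" using height_pos[OF j(2)] by simp
    moreover have "coef (\<beta> - \<alpha> j) l = 0" if "l \<in> {1..n}" "l \<noteq> k" for l
      using c[OF that(1)] less.prems(3)[OF that] coef_simple[OF j(1) that(1)] that(2) jk by simp
    ultimately have "\<beta> - \<alpha> j = \<alpha> k" using less.hyps[OF _ j(2) less.prems(2)] by blast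
    then have "\<beta> = \<alpha> k + \<alpha> k" using jk by (simp add: algebra_simps)
    then show False using double_not_root simple_root less.prems \<beta> by blast
  qed
qed

subsection \<open>The Weyl group\<close>

lemma reflection_dual:
  assumes "\<beta> \<in> roots H" "\<phi> \<in> dual"
  shows "reflection H \<beta> \<phi> \<in> dual"
proof -
  have "reflection H \<beta> \<phi> = \<phi> - (\<lambda>h. \<phi> (coroot H \<beta>) * \<beta> h)"
    unfolding reflection_apply[OF assms(2)] by auto
  then show ?thesis
    using dual_space_diff[OF assms(2) dual_space_scale[OF rootsD(1)[OF assms(1)]]] by simp
qed

lemma reflection_reflection:
  assumes "\<beta> \<in> roots H"
  shows "reflection H \<beta> (reflection H \<beta> \<phi>) = \<phi>"
proof (cases "\<phi> \<in> dual")
  case True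
  then show ?thesis
    using reflection_dual[OF assms True] coroot(2)[OF assms] by (auto simp: reflection_apply)
qed (simp add: reflection_def)

lemma reflection_self: "\<beta> \<in> roots H \<Longrightarrow> reflection H \<beta> \<beta> = - \<beta>"
  by (auto simp: reflection_apply rootsD(1) coroot(2))

lemma weyl_dual: "w \<in> W \<Longrightarrow> \<phi> \<in> dual \<Longrightarrow> w \<phi> \<in> dual"
  by (induction rule: weyl_group.induct) (auto simp: reflection_dual)

lemma weyl_root: "w \<in> W \<Longrightarrow> \<phi> \<in> roots H \<Longrightarrow> w \<phi> \<in> roots H"
  by (induction rule: weyl_group.induct) (auto simp: reflection_root)

lemma weyl_add:
  assumes "w \<in> W" "\<phi> \<in> dual" "\<psi> \<in> dual"
  shows "w (\<phi> + \<psi>) = w \<phi> + w \<psi>"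
  using assms
proof (induction rule: weyl_group.induct)
  case (weyl_reflection \<beta> w)
  note w = weyl_dual[OF weyl_reflection(2) assms(2)] weyl_dual[OF weyl_reflection(2) assms(3)]
  have "reflection H \<beta> (w \<phi> + w \<psi>) = reflection H \<beta> (w \<phi>) + reflection H \<beta> (w \<psi>)"
    unfolding reflection_apply[OF dual_space_add[OF w]] reflection_apply[OF w(1)] reflection_apply[OF w(2)]
    by (auto simp: algebra_simps)
  then show ?case using weyl_reflection.IH[OF assms(2,3)] by (simp only: comp_apply)
qed simp

lemma weyl_scale:
  assumes "w \<in> W" "\<phi> \<in> dual"
  shows "w (\<lambda>h. c * \<phi> h) = (\<lambda>h. c * w \<phi> h)"
  using assms
proof (induction rule: weyl_group.induct)
  case (weyl_reflection \<beta> w)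
  note w = weyl_dual[OF weyl_reflection(2) assms(2)]
  have "reflection H \<beta> (\<lambda>h. c * w \<phi> h) = (\<lambda>h. c * reflection H \<beta> (w \<phi>) h)"
    unfolding reflection_apply[OF dual_space_scale[OF w]] reflection_apply[OF w]
    by (auto simp: algebra_simps)
  then show ?case using weyl_reflection by simp
qed simp

lemma weyl_uminus:
  assumes "w \<in> W" "\<phi> \<in> dual"
  shows "w (- \<phi>) = - w \<phi>"
proof -
  have "- \<phi> = (\<lambda>h. -1 * \<phi> h)" "- w \<phi> = (\<lambda>h. -1 * w \<phi> h)" by auto
  then show ?thesis using weyl_scale[OF assms, of "-1"] by simp
qed

lemma weyl_comp: "w \<in> W \<Longrightarrow> v \<in> W \<Longrightarrow> w \<circ> v \<in> W"
  by (induction rule: weyl_group.induct) (auto simp: comp_assoc weyl_group.weyl_reflection)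

lemma reflection_weyl: "\<beta> \<in> roots H \<Longrightarrow> reflection H \<beta> \<in> W"
  using weyl_group.weyl_reflection[OF _ weyl_group.weyl_id] by simp

lemma weyl_inverse:
  assumes "w \<in> W"
  shows "\<exists>v\<in>W. v \<circ> w = id \<and> w \<circ> v = id"
  using assms
proof (induction rule: weyl_group.induct)
  case weyl_id
  show ?case by (rule bexI[of _ id]) (simp_all add: weyl_group.weyl_id)
next
  case (weyl_reflection \<beta> w)
  then obtain v where v: "v \<in> W" "v \<circ> w = id" "w \<circ> v = id" by blast
  have "v (reflection H \<beta> (reflection H \<beta> (w \<phi>))) = \<phi>" "reflection H \<beta> (w (v (reflection H \<beta> \<phi>))) = \<phi>" for \<phi>
    unfolding reflection_reflection[OF weyl_reflection(1)]
    using fun_cong[OF v(2), of \<phi>] fun_cong[OF v(3), of "reflection H \<beta> \<phi>"]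
      reflection_reflection[OF weyl_reflection(1), of \<phi>] by simp_all
  then have "(v \<circ> reflection H \<beta>) \<circ> (reflection H \<beta> \<circ> w) = id"
    "(reflection H \<beta> \<circ> w) \<circ> (v \<circ> reflection H \<beta>) = id"
    by (intro ext; simp only: comp_apply id_apply)+
  then show ?case using weyl_comp[OF v(1) reflection_weyl[OF weyl_reflection(1)]] by blast
qed

lemma weyl_inv:
  assumes "w \<in> W"
  shows "inv w \<in> W" "inv w (w \<phi>) = \<phi>" "w (inv w \<phi>) = \<phi>"
proof -
  obtain v where v: "v \<in> W" "v \<circ> w = id" "w \<circ> v = id" using weyl_inverse[OF assms] by blast
  then have eq: "inv w = v" by (intro inv_unique_comp) auto
  show "inv w \<in> W" unfolding eq by (rule v(1))
  show "inv w (w \<phi>) = \<phi>" "w (inv w \<phi>) = \<phi>"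
    unfolding eq using fun_cong[OF v(2), of \<phi>] fun_cong[OF v(3), of \<phi>] by simp_all
qed

lemma weyl_inv_uminus: "w \<in> W \<Longrightarrow> \<phi> \<in> dual \<Longrightarrow> inv w (- w \<phi>) = - \<phi>"
  by (simp only: weyl_uminus[OF weyl_inv(1) weyl_dual] weyl_inv(2))

lemma weyl_inv_root: "w \<in> W \<Longrightarrow> \<beta> \<in> roots H \<Longrightarrow> inv w \<beta> \<in> roots H"
  by (rule weyl_root[OF weyl_inv(1)])

section \<open>Weyl group elements as isometries\<close>

lemma root_dual_reflection:
  assumes "\<beta> \<in> roots H" "\<gamma> \<in> roots H"
  shows "root_dual (reflection H \<gamma> \<beta>) = root_dual \<beta> - \<beta> (coroot H \<gamma>) *\<^sub>C root_dual \<gamma>"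
  by (rule root_dual_unique)
    (use assms root_dual subspace_diff[OF subspace_H] subspace_scale[OF subspace_H] in
      \<open>auto simp: \<kappa>_linear reflection_apply[OF rootsD(1)]\<close>)

lemma reflection_isometry:
  assumes \<phi>: "\<phi> \<in> dual" and \<beta>: "\<beta> \<in> roots H" and \<gamma>: "\<gamma> \<in> roots H"
  shows "reflection H \<gamma> \<phi> (root_dual (reflection H \<gamma> \<beta>)) = \<phi> (root_dual \<beta>)"
proof -
  let ?c = "\<phi> (coroot H \<gamma>)" and ?d = "\<beta> (coroot H \<gamma>)" and ?t = "root_dual \<beta>" and ?s = "root_dual \<gamma>"
  obtain r where r: "0 < r" "\<gamma> ?s = complex_of_real r" using root_norm_pos[OF \<gamma>] .
  have H: "?t \<in> H" "?s \<in> H" "?d *\<^sub>C ?s \<in> H"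
    using root_dual \<beta> \<gamma> subspace_scale[OF subspace_H] by auto
  have lin: "\<psi> (?t - ?d *\<^sub>C ?s) = \<psi> ?t - ?d * \<psi> ?s" if "\<psi> \<in> dual" for \<psi>
    using dual_add[OF that H(1), of "- (?d *\<^sub>C ?s)"] dual_uminus[OF that H(3)] dual_scale[OF that H(2)]
      subspace_neg[OF subspace_H H(3)] by simp
  have "reflection H \<gamma> \<phi> (root_dual (reflection H \<gamma> \<beta>)) =
      \<phi> ?t - ?d * \<phi> ?s - ?c * (\<beta> ?s - ?d * \<gamma> ?s)"
    unfolding root_dual_reflection[OF \<beta> \<gamma>] reflection_apply[OF \<phi>]
    by (simp only: lin[OF \<phi>] lin[OF rootsD(1)[OF \<gamma>]] root_dual_commute[OF \<gamma> \<beta>])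
  also have "\<dots> = \<phi> ?t"
    using r unfolding coroot(3)[OF \<gamma> \<phi>] coroot(3)[OF \<gamma> rootsD(1)[OF \<beta>]] r(2)
    by (simp add: field_simps)
  finally show ?thesis .
qed

lemma weyl_coroot:
  assumes "w \<in> W" "\<phi> \<in> dual" "\<beta> \<in> roots H"
  shows "w \<phi> (coroot H (w \<beta>)) = \<phi> (coroot H \<beta>)"
  using assms
proof (induction rule: weyl_group.induct)
  case (weyl_reflection \<gamma> w)
  have w: "w \<phi> \<in> dual" "w \<beta> \<in> roots H" "reflection H \<gamma> (w \<beta>) \<in> roots H"
    using weyl_dual weyl_root reflection_root weyl_reflection by auto
  have "reflection H \<gamma> (w \<phi>) (coroot H (reflection H \<gamma> (w \<beta>))) = w \<phi> (coroot H (w \<beta>))"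
    unfolding coroot(3)[OF w(3) reflection_dual[OF weyl_reflection(1) w(1)]] coroot(3)[OF w(2,1)]
    using reflection_isometry[OF _ w(2) weyl_reflection(1)] w(1) rootsD(1)[OF w(2)] by simp
  then show ?case using weyl_reflection by simp
qed simp

lemma weyl_conjugate_reflection:
  assumes "w \<in> W" "\<beta> \<in> roots H"
  shows "w \<circ> reflection H \<beta> = reflection H (w \<beta>) \<circ> w"
proof
  fix \<phi>
  show "(w \<circ> reflection H \<beta>) \<phi> = (reflection H (w \<beta>) \<circ> w) \<phi>"
  proof (cases "\<phi> \<in> dual")
    case True
    let ?\<psi> = "\<lambda>h. - \<phi> (coroot H \<beta>) * \<beta> h"
    have "reflection H \<beta> \<phi> = \<phi> + ?\<psi>" unfolding reflection_apply[OF True] by auto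
    then have "w (reflection H \<beta> \<phi>) = w \<phi> + (\<lambda>h. - \<phi> (coroot H \<beta>) * w \<beta> h)"
      by (simp only: weyl_add[OF assms(1) True dual_space_scale[OF rootsD(1)[OF assms(2)]]]
          weyl_scale[OF assms(1) rootsD(1)[OF assms(2)]])
    also have "\<dots> = reflection H (w \<beta>) (w \<phi>)"
      unfolding reflection_apply[OF weyl_dual[OF assms(1) True]] weyl_coroot[OF assms(1) True assms(2)]
      by auto
    finally show ?thesis by simp
  next
    case False
    then have "w \<phi> \<notin> dual"
      using weyl_dual[OF weyl_inv(1)[OF assms(1)], of "w \<phi>"] weyl_inv(2)[OF assms(1)] by auto
    then show ?thesis using False by (simp add: reflection_def)
  qed
qed

text \<open>A positive root other than \<open>\<alpha> k\<close> has a positive coefficient at some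
  \<open>j \<noteq> k\<close>, and the reflection changes only the coefficient at
  \<open>k\<close>.\<close>

lemma simple_reflection_pos:
  assumes "k \<in> {1..n}" "\<beta> \<in> pos" "\<beta> \<noteq> \<alpha> k"
  shows "reflection H (\<alpha> k) \<beta> \<in> pos"
proof -
  have \<beta>: "\<beta> \<in> roots H" using assms pos_root by blast
  obtain j where j: "j \<in> {1..n}" "j \<noteq> k" "coef \<beta> j \<noteq> 0"
    using multiple_simple_root[OF assms(2,1)] assms(3) by blast
  have "reflection H (\<alpha> k) \<beta> (Z j) = of_int (coef \<beta> j)"
    using reflection_apply[OF rootsD(1)[OF \<beta>]] \<alpha>_Z[OF assms(1) j(1)] j(2) root_Z[OF \<beta> j(1)] by simp
  then have "coef (reflection H (\<alpha> k) \<beta>) j = coef \<beta> j" by (rule coef_eqI)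
  moreover have "0 \<le> coef \<beta> j" using assms j by (simp add: pos_roots_iff)
  ultimately have "0 < coef (reflection H (\<alpha> k) \<beta>) j" using j(3) by simp
  then show ?thesis using pos_rootI[OF reflection_root[OF simple_root[OF assms(1)] \<beta>] j(1)] by blast
qed

section \<open>Words in simple reflections and the exchange property\<close>

definition simple_word :: "nat list \<Rightarrow> ('g \<Rightarrow> complex) \<Rightarrow> 'g \<Rightarrow> complex"
  where "simple_word ks = foldr (\<lambda>k v. reflection H (\<alpha> k) \<circ> v) ks id"

lemma simple_word_simps [simp]:
  "simple_word [] = id" "simple_word (k # ks) = reflection H (\<alpha> k) \<circ> simple_word ks"
  by (simp_all add: simple_word_def)

lemma simple_word_append: "simple_word (ks @ ls) = simple_word ks \<circ> simple_word ls"
  by (induction ks) (simp_all add: comp_assoc)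

lemma simple_word_weyl: "set ks \<subseteq> {1..n} \<Longrightarrow> simple_word ks \<in> W"
  by (induction ks) (auto intro!: weyl_group.weyl_id weyl_group.weyl_reflection simple_root)

lemma simple_word_rev:
  assumes "set ks \<subseteq> {1..n}"
  shows "simple_word ks (simple_word (rev ks) \<phi>) = \<phi>"
  using assms
proof (induction ks arbitrary: \<phi>)
  case (Cons k ks)
  then have "simple_word (k # ks) (simple_word (rev (k # ks)) \<phi>) =
      reflection H (\<alpha> k) (reflection H (\<alpha> k) \<phi>)"
    by (simp add: simple_word_append)
  then show ?case using reflection_reflection simple_root Cons by simp
qed simp

text \<open>Reflecting in a simple root with positive pairing \<open>q\<close> keeps a nonsimple
  root positive and lowers its height by \<open>q\<close>.\<close>

lemma pos_root_conjugate_simple: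
  assumes "\<beta> \<in> pos"
  shows "\<exists>ks k. set ks \<subseteq> {1..n} \<and> k \<in> {1..n} \<and> \<beta> = simple_word ks (\<alpha> k)"
  using assms
proof (induction "nat (height \<beta>)" arbitrary: \<beta> rule: less_induct)
  case less
  have \<beta>: "\<beta> \<in> roots H" using less.prems pos_root by blast
  show ?case
  proof (cases "\<beta> \<in> \<alpha> ` {1..n}")
    case True
    then obtain k where k: "k \<in> {1..n}" "\<beta> = \<alpha> k" by blast
    show ?thesis by (rule exI[of _ "[]"], rule exI[of _ k]) (use k in simp)
  next
    case False
    obtain k and q :: int where k: "k \<in> {1..n}" "\<beta> (coroot H (\<alpha> k)) = of_int q" "0 < q"
      using pos_root_positive_pairing[OF less.prems] .
    let ?\<gamma> = "reflection H (\<alpha> k) \<beta>"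
    have \<gamma>: "?\<gamma> \<in> pos" using simple_reflection_pos k(1) less.prems False by blast
    have "?\<gamma> (Z j) = of_int (coef \<beta> j - (if j = k then q else 0))" if "j \<in> {1..n}" for j
      using reflection_apply[OF rootsD(1)[OF \<beta>]] \<alpha>_Z[OF k(1) that] k(2) root_Z[OF \<beta> that] by simp
    then have "coef ?\<gamma> j = coef \<beta> j - (if j = k then q else 0)" if "j \<in> {1..n}" for j
      using coef_eqI that by blast
    then have "height ?\<gamma> = (\<Sum>j=1..n. coef \<beta> j - (if j = k then q else 0))"
      unfolding height_def by (rule sum.cong[OF refl])
    then have "height ?\<gamma> = height \<beta> - q" using k(1) by (simp add: height_def sum_subtractf)
    then obtain ks j where IH: "set ks \<subseteq> {1..n}" "j \<in> {1..n}" "?\<gamma> = simple_word ks (\<alpha> j)"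
      using less.hyps[OF _ \<gamma>] height_pos[OF \<gamma>] height_pos[OF less.prems] k(3) by force
    have "\<beta> = simple_word (k # ks) (\<alpha> j)"
      using IH(3) reflection_reflection[OF simple_root[OF k(1)], of \<beta>] by simp
    then show ?thesis using IH k by (intro exI[of _ "k # ks"] exI[of _ j]) simp
  qed
qed

text \<open>The group is generated by the reflections in all roots. Writing \<open>\<gamma>\<close>
  as the image of a simple root under a word \<open>ls\<close> turns its reflection into the
  palindrome \<open>ls @ [k] @ rev ls\<close>.\<close>

lemma weyl_simple_word:
  assumes "w \<in> W"
  shows "\<exists>ks. set ks \<subseteq> {1..n} \<and> w = simple_word ks"
  using assms
proof (induction rule: weyl_group.induct)
  case weyl_id
  show ?case by (rule exI[of _ "[]"]) simp
next
  case (weyl_reflection \<beta> w)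
  then obtain ks where ks: "set ks \<subseteq> {1..n}" "w = simple_word ks" by blast
  have *: "\<exists>ls. set ls \<subseteq> {1..n} \<and> reflection H \<gamma> = simple_word ls" if \<gamma>: "\<gamma> \<in> pos" for \<gamma>
  proof -
    obtain ls k where l: "set ls \<subseteq> {1..n}" "k \<in> {1..n}" "\<gamma> = simple_word ls (\<alpha> k)"
      using pos_root_conjugate_simple[OF \<gamma>] by blast
    have "simple_word (ls @ [k] @ rev ls) \<phi> = reflection H \<gamma> \<phi>" for \<phi>
    proof -
      have "simple_word (ls @ [k] @ rev ls) \<phi> =
          (simple_word ls \<circ> reflection H (\<alpha> k)) (simple_word (rev ls) \<phi>)"
        by (simp add: simple_word_append)
      also have "\<dots> = reflection H \<gamma> \<phi>"
        unfolding weyl_conjugate_reflection[OF simple_word_weyl[OF l(1)] simple_root[OF l(2)]] l(3)[symmetric]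
        using simple_word_rev[OF l(1)] by simp
      finally show ?thesis .
    qed
    then have "reflection H \<gamma> = simple_word (ls @ [k] @ rev ls)" by auto
    then show ?thesis using l by (intro exI[of _ "ls @ [k] @ rev ls"]) simp
  qed
  have "\<exists>ls. set ls \<subseteq> {1..n} \<and> reflection H \<beta> = simple_word ls"
    using pos_or_neg[OF weyl_reflection(1)] *[of \<beta>] *[of "- \<beta>"] reflection_uminus[OF weyl_reflection(1)]
    by auto
  then obtain ls where "set ls \<subseteq> {1..n}" "reflection H \<beta> = simple_word ls" by blast
  then show ?case using ks by (intro exI[of _ "ls @ ks"]) (simp add: simple_word_append)
qed

text \<open>Apply the letters to \<open>\<alpha> k\<close> from right to left. A letter
  \<open>j\<close> can turn a positive root negative only if that root is \<open>\<alpha> j\<close>,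
  and then conjugation shows that multiplying by the reflection in \<open>\<alpha> k\<close> on the
  right deletes this letter.\<close>

lemma exchange:
  assumes "set ks \<subseteq> {1..n}" "k \<in> {1..n}" "- simple_word ks (\<alpha> k) \<in> pos"
  shows "\<exists>ls. set ls \<subseteq> {1..n} \<and> Suc (length ls) = length ks \<and>
    simple_word ks \<circ> reflection H (\<alpha> k) = simple_word ls"
  using assms
proof (induction ks)
  case Nil
  then show ?case using not_pos_and_neg[OF simple_pos[OF Nil(2)]] by (simp only: simple_word_simps id_apply)
next
  case (Cons j ks)
  let ?v = "simple_word ks" and ?s = "reflection H (\<alpha> j)"
  have v: "?v \<in> W" using simple_word_weyl Cons.prems by simp
  have j: "j \<in> {1..n}" and \<alpha>k: "\<alpha> k \<in> roots H" and \<alpha>j: "\<alpha> j \<in> roots H"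
    using Cons.prems simple_root by auto
  have root: "?v (\<alpha> k) \<in> roots H" using weyl_root[OF v \<alpha>k] .
  show ?case
  proof (cases "- ?v (\<alpha> k) \<in> pos")
    case True
    then obtain ls where ls: "set ls \<subseteq> {1..n}" "Suc (length ls) = length ks"
      "?v \<circ> reflection H (\<alpha> k) = simple_word ls"
      using Cons.IH[OF _ Cons.prems(2) True] Cons.prems(1) by (metis list.set_intros(2) subset_iff)
    have "simple_word (j # ks) \<circ> reflection H (\<alpha> k) = simple_word (j # ls)"
      unfolding simple_word_simps comp_assoc ls(3) ..
    moreover have "set (j # ls) \<subseteq> {1..n}" "Suc (length (j # ls)) = length (j # ks)" using j ls by simp_all
    ultimately show ?thesis by blast
  next
    case False
    then have pos: "?v (\<alpha> k) \<in> pos" using pos_or_neg[OF root] by blast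
    have "?v (\<alpha> k) = \<alpha> j"
    proof (rule ccontr)
      assume "?v (\<alpha> k) \<noteq> \<alpha> j"
      then have "?s (?v (\<alpha> k)) \<in> pos" using simple_reflection_pos[OF j pos] by blast
      then show False
        using not_pos_and_neg Cons.prems(3) by (simp only: simple_word_simps comp_apply)
    qed
    then have "?v \<circ> reflection H (\<alpha> k) = ?s \<circ> ?v"
      using weyl_conjugate_reflection[OF v \<alpha>k] by simp
    then have "simple_word (j # ks) \<circ> reflection H (\<alpha> k) = ?s \<circ> (?s \<circ> ?v)"
      by (simp add: comp_assoc)
    also have "\<dots> = ?v" using reflection_reflection[OF \<alpha>j] by auto
    finally have "simple_word (j # ks) \<circ> reflection H (\<alpha> k) = simple_word ks" .
    moreover have "set ks \<subseteq> {1..n}" "Suc (length ks) = length (j # ks)" using Cons.prems(1) by simp_all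
    ultimately show ?thesis by blast
  qed
qed

text \<open>Let \<open>k\<close> be the last letter of a shortest word. As
  \<open>w (\<alpha> k)\<close> is positive, the word without this letter makes
  \<open>\<alpha> k\<close> negative, and the exchange property yields a word for \<open>w\<close>
  that is shorter by two letters.\<close>

lemma weyl_preserving_pos:
  assumes "w \<in> W" "\<And>\<beta>. \<beta> \<in> pos \<Longrightarrow> w \<beta> \<in> pos"
  shows "w = id"
proof -
  obtain ks where ks: "set ks \<subseteq> {1..n}" "w = simple_word ks"
    and min: "\<And>ls. set ls \<subseteq> {1..n} \<and> w = simple_word ls \<Longrightarrow> length ks \<le> length ls"
    using ex_has_least_nat[of "\<lambda>ks. set ks \<subseteq> {1..n} \<and> w = simple_word ks" _ length]
      weyl_simple_word[OF assms(1)] by blast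
  show ?thesis
  proof (cases ks rule: rev_cases)
    case (snoc ks' k)
    have k: "k \<in> {1..n}" "set ks' \<subseteq> {1..n}" using ks snoc by auto
    have v: "simple_word ks' \<in> W" using simple_word_weyl k by blast
    have w: "w = simple_word ks' \<circ> reflection H (\<alpha> k)" using ks snoc by (simp add: simple_word_append)
    have "w (\<alpha> k) = - simple_word ks' (\<alpha> k)"
      unfolding w using simple_root[OF k(1)] weyl_uminus[OF v] rootsD(1) by (simp add: reflection_self)
    then obtain ls where "set ls \<subseteq> {1..n}" "Suc (length ls) = length ks'" "w = simple_word ls"
      using exchange[OF k(2,1)] assms(2)[OF simple_pos[OF k(1)]] w by auto
    then show ?thesis using min[of ls] snoc by simp
  qed (use ks in simp)
qed

end

sublocale hermitian_symmetric \<subseteq> simple_lie_algebra_with_base scale bracket H n \<alpha> Z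
  by unfold_locales (fact simple, fact cartan, fact simple_system, fact Z_span, fact Z_dual)

context hermitian_symmetric
begin

subsection \<open>The grading and the parabolic subgroup\<close>

lemma coef_i_range:
  assumes "\<beta> \<in> roots H"
  shows "coef \<beta> i \<in> {-1, 0, 1}"
proof -
  have "\<beta> (Z i) = of_int (-1) \<or> \<beta> (Z i) = of_int 0 \<or> \<beta> (Z i) = of_int 1"
    using cominuscule[OF assms] by auto
  then show ?thesis using coef_eqI by blast
qed

lemma degree_one_pos: "\<beta> \<in> roots H \<Longrightarrow> coef \<beta> i = 1 \<Longrightarrow> \<beta> \<in> pos"
  using pos_rootI[OF _ node] by simp

lemma bracket_grade: "u \<in> grade j \<Longrightarrow> v \<in> grade k \<Longrightarrow> bracket u v \<in> grade (j + k)"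
  by (simp add: grade_def bracket_leibniz[of "Z i" u v] bracket_scale_left bracket_scale_right
      scale_left_distrib)

lemma grade_two: "u \<in> grade 2 \<Longrightarrow> u = 0"
proof -
  assume "u \<in> grade 2"
  then have "bracket (Z i) u = 2 *\<^sub>C u" by (simp add: grade_def)
  then obtain v where v: "u = (\<Sum>\<mu>\<in>{\<mu> \<in> weights. \<mu> (Z i) = 2}. v \<mu>)"
    by (rule eigenvector_decomposition[OF Z_in_H[OF node]])
  have "{\<mu> \<in> weights. \<mu> (Z i) = 2} = {}" using cominuscule by fastforce
  then show "u = 0" using v by (simp only: sum.empty)
qed

text \<open>The parabolic is the kernel of a polynomial in \<open>bracket (Z i)\<close>, which makes
  its invariance under automorphisms fixing \<open>Z i\<close> immediate.\<close>

lemma parabolic_iff: "u \<in> parabolic \<longleftrightarrow> bracket (Z i) (bracket (Z i) u) = bracket (Z i) u"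
proof
  let ?V = "{u. bracket (Z i) (bracket (Z i) u) = bracket (Z i) u}"
  have "subspace ?V"
    by (rule subspaceI) (simp_all add: bracket_add_right bracket_scale_right)
  moreover have "grade 0 \<union> grade 1 \<subseteq> ?V" by (auto simp: grade_def)
  ultimately have "parabolic \<subseteq> ?V" unfolding parabolic_def by (rule span_minimal[rotated])
  then show "u \<in> parabolic \<Longrightarrow> bracket (Z i) (bracket (Z i) u) = bracket (Z i) u" by blast
next
  assume eq: "bracket (Z i) (bracket (Z i) u) = bracket (Z i) u"
  have "u - bracket (Z i) u \<in> grade 0" "bracket (Z i) u \<in> grade 1"
    using eq by (simp_all add: grade_def bracket_diff_right)
  then have "(u - bracket (Z i) u) + bracket (Z i) u \<in> parabolic"
    unfolding parabolic_def by (intro span_add span_base) auto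
  then show "u \<in> parabolic" by simp
qed

lemma subspace_parabolic: "subspace parabolic"
  unfolding parabolic_def by (rule subspace_span)

lemma root_space_grade:
  assumes "\<beta> \<in> roots H"
  shows "\<gg> \<beta> \<subseteq> grade (coef \<beta> i)"
  using root_Z[OF assms node] Z_in_H[OF node] by (auto simp: grade_def root_space_def)

lemma bracket_borel_parabolic:
  assumes "x \<in> borel" "v \<in> parabolic"
  shows "bracket x v \<in> parabolic"
proof -
  have step: "bracket s t \<in> parabolic" if s: "s \<in> grade 0 \<union> grade 1" and t: "t \<in> grade 0 \<union> grade 1" for s t
  proof -
    have "bracket s t \<in> grade 0 \<or> bracket s t \<in> grade 1 \<or> bracket s t \<in> grade 2"
      using s t bracket_grade[of s 0 t 0] bracket_grade[of s 0 t 1] bracket_grade[of s 1 t 0]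
        bracket_grade[of s 1 t 1] by auto
    then show ?thesis
      using grade_two[of "bracket s t"] subspace_0[OF subspace_parabolic]
      unfolding parabolic_def by (auto intro: span_base)
  qed
  have gen: "s \<in> grade 0 \<union> grade 1" if "s \<in> H \<union> (\<Union>\<beta>\<in>pos. \<gg> \<beta>)" for s
    using that
  proof
    assume "s \<in> H"
    then show ?thesis using bracket_H[OF Z_in_H[OF node]] by (simp add: grade_def)
  next
    assume "s \<in> (\<Union>\<beta>\<in>pos. \<gg> \<beta>)"
    then obtain \<beta> where \<beta>: "\<beta> \<in> pos" "s \<in> \<gg> \<beta>" by blast
    have "coef \<beta> i = 0 \<or> coef \<beta> i = 1"
      using coef_i_range[OF pos_root[OF \<beta>(1)]] pos_coef[OF \<beta>(1) node] by auto
    then show ?thesis using root_space_grade[OF pos_root[OF \<beta>(1)]] \<beta>(2) by auto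
  qed
  show ?thesis
  proof (rule bracket_span_left[OF assms(1)[unfolded borel_def] subspace_parabolic])
    fix s assume s: "s \<in> H \<union> (\<Union>\<beta>\<in>pos. \<gg> \<beta>)"
    show "bracket s v \<in> parabolic"
      by (rule bracket_span_right[OF assms(2)[unfolded parabolic_def] subspace_parabolic])
        (rule step[OF gen[OF s]])
  qed
qed

section \<open>The stabiliser of the parabolic subalgebra\<close>

lemma adjoint_group_inverse:
  assumes "g \<in> adjoint_group"
  obtains g' where "g' \<in> adjoint_group" "\<And>x. g' (g x) = x" "\<And>x. g (g' x) = x"
  using connected_subgroup_inverse[of g UNIV] assms unfolding adjoint_group_def by auto

lemma adjoint_group_inj: "g \<in> adjoint_group \<Longrightarrow> inj g"
  by (metis adjoint_group_inverse injI)

lemma P_groupI: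
  assumes "g \<in> adjoint_group" "g ` parabolic \<subseteq> parabolic"
  shows "g \<in> P_group"
  unfolding P_group_def
  using assms endomorphism_injective_subspace_image[OF _ adjoint_group_inj subspace_parabolic]
    connected_subgroup_endomorphism unfolding adjoint_group_def by blast

lemma P_group_comp: "g \<in> P_group \<Longrightarrow> g' \<in> P_group \<Longrightarrow> g \<circ> g' \<in> P_group"
  using connected_subgroup_comp[of g UNIV g'] unfolding P_group_def adjoint_group_def
  by (simp only: mem_Collect_eq image_comp[symmetric])

lemma id_adjoint_group: "id \<in> adjoint_group"
  unfolding adjoint_group_def by (rule connected_subgroup.id)

lemma coset_eq_P_group:
  assumes "g \<in> adjoint_group"
  shows "coset g = P_group \<longleftrightarrow> g \<in> P_group"
proof
  have "id \<in> P_group" using id_adjoint_group by (simp add: P_group_def)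
  then have "g \<circ> id \<in> coset g" unfolding coset_def by blast
  then show "coset g = P_group \<Longrightarrow> g \<in> P_group" by simp
next
  assume g: "g \<in> P_group"
  obtain g' where g': "g' \<in> adjoint_group" "\<And>x. g' (g x) = x" "\<And>x. g (g' x) = x"
    by (rule adjoint_group_inverse[OF assms]) blast
  have "g' ` parabolic = g' ` g ` parabolic" using g by (simp add: P_group_def)
  also have "\<dots> = parabolic" using g'(2) by (simp add: image_image)
  finally have g'P: "g' \<in> P_group" using g'(1) by (simp add: P_group_def)
  have "q \<in> coset g" if "q \<in> P_group" for q
  proof -
    have "q = g \<circ> (g' \<circ> q)" using g'(3) by auto
    then show ?thesis using P_group_comp[OF g'P that] unfolding coset_def by blast
  qed
  moreover have "coset g \<subseteq> P_group" using P_group_comp[OF g] by (auto simp: coset_def)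
  ultimately show "coset g = P_group" by blast
qed

lemma connected_borel_P_group:
  assumes "b \<in> connected_subgroup borel"
  shows "b \<in> P_group"
proof (rule P_groupI)
  show "b \<in> adjoint_group"
    unfolding adjoint_group_def by (rule connected_subgroup_mono[OF assms]) simp
  show "b ` parabolic \<subseteq> parabolic"
    using connected_subgroup_invariant[OF assms subspace_parabolic bracket_borel_parabolic] by blast
qed

text \<open>Such a \<open>g\<close> fixes every functional on \<open>H\<close>, hence
  \<open>Z i\<close> itself, and an automorphism fixing \<open>Z i\<close> commutes with
  \<open>bracket (Z i)\<close>.\<close>

lemma weyl_lifts_id_P_group:
  assumes "g \<in> weyl_lifts H id"
  shows "g \<in> P_group"
proof (rule P_groupI)
  have g: "g \<in> adjoint_group" "g ` H = H" "\<And>\<phi> h. \<phi> \<in> dual \<Longrightarrow> h \<in> H \<Longrightarrow> \<phi> (g h) = \<phi> h"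
    using assms by (auto simp: weyl_lifts_def)
  show "g \<in> adjoint_group" by (rule g(1))
  have gZ: "g (Z i) = Z i"
  proof -
    have "g (Z i) \<in> H" using g(2) Z_in_H[OF node] by blast
    then have "g (Z i) = (\<Sum>k=1..n. \<alpha> k (g (Z i)) *\<^sub>C Z k)" by (rule H_expand)
    also have "\<dots> = (\<Sum>k=1..n. \<alpha> k (Z i) *\<^sub>C Z k)"
      using g(3)[OF simple_root_dual Z_in_H[OF node]] by (intro sum.cong) auto
    also have "\<dots> = Z i" using H_expand[OF Z_in_H[OF node]] by simp
    finally show ?thesis .
  qed
  have br: "bracket (Z i) (g u) = g (bracket (Z i) u)" for u
    using connected_subgroup_bracket[of g UNIV "Z i" u] g(1) gZ by (simp add: adjoint_group_def)
  show "g ` parabolic \<subseteq> parabolic" by (auto simp: parabolic_iff br)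
qed

section \<open>The base point is closed in the homogeneous space\<close>

lemma topspace_adjoint_topology: "topspace adjoint_topology = adjoint_group"
proof -
  have "functional (\<lambda>_. 0)" by (simp add: functional_iff)
  moreover have "g \<in> {g. (\<lambda>_. 0 :: complex) (g (0::'g)) \<in> UNIV}" for g :: "'g \<Rightarrow> 'g" by simp
  ultimately have "g \<in> \<Union>{{g. \<phi> (g x) \<in> U} |\<phi> x U. functional \<phi> \<and> open U}" for g
    using open_UNIV by blast
  then show ?thesis unfolding adjoint_topology_def by auto
qed

lemma openin_adjoint_topology:
  assumes "functional \<phi>" "open U"
  shows "openin adjoint_topology {g \<in> adjoint_group. \<phi> (g x) \<in> U}"
proof -
  have "openin (topology_generated_by {{g. \<phi> (g x) \<in> U} |\<phi> x U. functional \<phi> \<and> open U}) {g. \<phi> (g x) \<in> U}"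
    by (rule topology_generated_by_Basis) (use assms in blast)
  then show ?thesis unfolding adjoint_topology_def openin_subtopology by blast
qed

text \<open>An element fails to preserve the parabolic exactly when some matrix coefficient
  \<open>\<phi> (g y)\<close> is nonzero, with \<open>y\<close> in the parabolic and
  \<open>\<phi>\<close> vanishing on it; each such condition is open.\<close>

lemma openin_complement_P_group: "openin adjoint_topology (adjoint_group - P_group)"
proof -
  let ?F = "{{g \<in> adjoint_group. \<phi> (g y) \<in> - {0}} |\<phi> y. functional \<phi> \<and> (\<forall>v\<in>parabolic. \<phi> v = 0) \<and> y \<in> parabolic}"
  have "adjoint_group - P_group = \<Union>?F"
  proof
    show "adjoint_group - P_group \<subseteq> \<Union>?F"
    proof
      fix g assume g: "g \<in> adjoint_group - P_group"
      then obtain y where y: "y \<in> parabolic" "g y \<notin> parabolic" using P_groupI by blast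
      obtain \<phi> where "functional \<phi>" "\<And>v. v \<in> parabolic \<Longrightarrow> \<phi> v = 0" "\<phi> (g y) = 1"
        by (rule functional_vanishing_on_subspace[OF subspace_parabolic y(2)]) blast
      then have "{g \<in> adjoint_group. \<phi> (g y) \<in> - {0}} \<in> ?F" "g \<in> {g \<in> adjoint_group. \<phi> (g y) \<in> - {0}}"
        using y g by auto
      then show "g \<in> \<Union>?F" by (rule UnionI)
    qed
    show "\<Union>?F \<subseteq> adjoint_group - P_group" by (auto simp: P_group_def)
  qed
  moreover have "openin adjoint_topology (\<Union>?F)"
    by (rule openin_Union) (use openin_adjoint_topology[OF _ open_Compl[OF closed_singleton]] in blast)
  ultimately show ?thesis by simp
qed

lemma closedin_P_group: "closedin G_mod_P_topology {P_group}"
proof -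
  have "{g \<in> adjoint_group. coset g \<in> G_mod_P} = adjoint_group" by (auto simp: G_mod_P_def)
  then have "openin G_mod_P_topology G_mod_P"
    unfolding openin_G_mod_P_topology using openin_topspace[of adjoint_topology]
    by (simp add: topspace_adjoint_topology)
  moreover have "topspace G_mod_P_topology \<subseteq> G_mod_P"
    using openin_G_mod_P_topology openin_topspace by blast
  ultimately have top: "topspace G_mod_P_topology = G_mod_P" using openin_subset by blast
  have "coset id = P_group" using coset_eq_P_group[OF id_adjoint_group] id_adjoint_group by (simp add: P_group_def)
  then have "P_group \<in> G_mod_P" unfolding G_mod_P_def using id_adjoint_group by force
  moreover have "{g \<in> adjoint_group. coset g \<in> G_mod_P - {P_group}} = adjoint_group - P_group"
    using coset_eq_P_group by (auto simp: G_mod_P_def)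
  ultimately show ?thesis
    unfolding closedin_def top openin_G_mod_P_topology using openin_complement_P_group by auto
qed

lemma schubert_variety_id: "schubert_variety id = {P_group}"
proof -
  let ?S = "{coset (b \<circ> g) |b g. b \<in> connected_subgroup borel \<and> g \<in> weyl_lifts H (inv id)}"
  have "inv id = (id :: ('g \<Rightarrow> complex) \<Rightarrow> 'g \<Rightarrow> complex)" by (rule inv_id)
  moreover have "coset (b \<circ> g) = P_group" if "b \<in> connected_subgroup borel" "g \<in> weyl_lifts H id" for b g
    using P_group_comp[OF connected_borel_P_group weyl_lifts_id_P_group, OF that] coset_eq_P_group
    by (simp add: P_group_def)
  moreover have "id \<in> weyl_lifts H id" using id_adjoint_group by (simp add: weyl_lifts_def)
  moreover have "id \<in> connected_subgroup borel" by (rule connected_subgroup.id)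
  ultimately have "?S = {P_group}" by (simp only:) blast
  then show ?thesis unfolding schubert_variety_def using closure_of_closedin[OF closedin_P_group] by simp
qed

subsection \<open>Schubert varieties\<close>

lemma inversions_iff:
  assumes "w \<in> W"
  shows "\<beta> \<in> inversions w \<longleftrightarrow> \<beta> \<in> pos \<and> - inv w \<beta> \<in> pos"
proof
  assume "\<beta> \<in> inversions w"
  then obtain \<gamma> where \<gamma>: "\<gamma> \<in> neg_roots H n \<alpha>" "\<beta> = w \<gamma>" "\<beta> \<in> pos" by (auto simp: inversions_def)
  then show "\<beta> \<in> pos \<and> - inv w \<beta> \<in> pos" using weyl_inv(2)[OF assms] neg_roots_iff by (simp only:)
next
  assume \<beta>: "\<beta> \<in> pos \<and> - inv w \<beta> \<in> pos"
  then have "inv w \<beta> \<in> neg_roots H n \<alpha>" using neg_roots_iff by blast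
  then have "w (inv w \<beta>) \<in> w ` neg_roots H n \<alpha>" by blast
  then show "\<beta> \<in> inversions w" using \<beta> weyl_inv(3)[OF assms] by (simp only: inversions_def Int_iff)
qed

lemma inversions_nonempty:
  assumes w: "w \<in> W" and "schubert_proper w"
  shows "inversions w \<noteq> {}"
proof
  assume empty: "inversions w = {}"
  have "w \<beta> \<in> pos" if \<beta>: "\<beta> \<in> pos" for \<beta>
  proof (rule ccontr)
    assume "w \<beta> \<notin> pos"
    then have neg: "- w \<beta> \<in> pos" using pos_or_neg[OF weyl_root[OF w pos_root[OF \<beta>]]] by blast
    then have "- w \<beta> \<in> inversions w"
      unfolding inversions_iff[OF w] weyl_inv_uminus[OF w rootsD(1)[OF pos_root[OF \<beta>]]] minus_minus
      using \<beta> by blast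
    then show False using empty by blast
  qed
  then have "w = id" by (rule weyl_preserving_pos[OF w])
  then show False using assms(2) schubert_variety_id unfolding schubert_proper_def by blast
qed

lemma inversions_coef_i:
  assumes "w \<in> W_p" "\<beta> \<in> inversions w"
  shows "coef \<beta> i = 1"
proof -
  have w: "w \<in> W" and sub: "\<gg> \<beta> \<subseteq> grade 1" using assms by (auto simp: W_p_def)
  have \<beta>: "\<beta> \<in> roots H" using assms(2) inversions_iff[OF w] pos_root by blast
  obtain x where x: "x \<in> \<gg> \<beta>" "x \<noteq> 0" using rootsD(3)[OF \<beta>] by blast
  have "\<beta> (Z i) *\<^sub>C x = 1 *\<^sub>C x" using x sub root_spaceD[OF x(1) Z_in_H[OF node]] by (auto simp: grade_def)
  then have "\<beta> (Z i) = of_int 1" using x(2) by (simp only: scale_cancel_right) simp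
  then show ?thesis by (rule coef_eqI)
qed

section \<open>Root vectors of \<open>n_w w\<close> and the index set \<open>J_w w\<close>\<close>

lemma subspace_n_w: "subspace (n_w w)"
  unfolding n_w_def by (rule subspace_span)

lemma n_w_eq: "n_w w = span (\<Union>\<mu>\<in>uminus ` inversions w. \<gg> \<mu>)"
proof -
  have "(\<lambda>h. - \<beta> h) = - \<beta>" for \<beta> :: "'g \<Rightarrow> complex" by auto
  then show ?thesis unfolding n_w_def by (simp only: image_image UN_simps(10))
qed

lemma root_space_n_w: "\<beta> \<in> inversions w \<Longrightarrow> \<gg> (- \<beta>) \<subseteq> n_w w"
  unfolding n_w_eq by (rule subset_trans[OF _ span_superset]) blast

text \<open>A root vector outside the listed root spaces is independent of them, so membership of
  one nonzero root vector in \<open>n_w w\<close> already detects an inversion.\<close>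

lemma n_w_root_vector:
  assumes "w \<in> W" "x \<in> n_w w" "x \<noteq> 0" "x \<in> \<gg> (- \<gamma>)" "\<gamma> \<in> roots H"
  shows "\<gamma> \<in> inversions w"
proof (rule ccontr)
  assume neg: "\<gamma> \<notin> inversions w"
  from span_UN_root_spaces[OF assms(2)[unfolded n_w_eq]] obtain M v where M: "finite M"
    "M \<subseteq> uminus ` inversions w" "\<forall>\<mu>\<in>M. v \<mu> \<in> \<gg> \<mu>" "x = (\<Sum>\<mu>\<in>M. v \<mu>)"
    by blast
  have "M \<subseteq> roots H"
    using M(2) inversions_iff[OF assms(1)] pos_root root_uminus by blast
  then have sub: "insert (- \<gamma>) M \<subseteq> dual"
    using rootsD(1) root_uminus[OF assms(5)] by blast
  have notin: "- \<gamma> \<notin> M"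
  proof
    assume "- \<gamma> \<in> M"
    then obtain \<beta> where "\<beta> \<in> inversions w" "- \<gamma> = - \<beta>" using M(2) by blast
    then show False using neg minus_minus by metis
  qed
  let ?v = "\<lambda>\<mu>. if \<mu> = - \<gamma> then - x else v \<mu>"
  have "(\<Sum>\<mu>\<in>M. ?v \<mu>) = (\<Sum>\<mu>\<in>M. v \<mu>)" using notin by (intro sum.cong) auto
  then have sum0: "(\<Sum>\<mu>\<in>insert (- \<gamma>) M. ?v \<mu>) = 0"
    unfolding sum.insert[OF M(1) notin] M(4)[symmetric] by simp
  have mem: "?v \<mu> \<in> \<gg> \<mu>" if "\<mu> \<in> insert (- \<gamma>) M" for \<mu>
    using that M(3) subspace_neg[OF subspace_root_space assms(4)] by auto
  have "?v (- \<gamma>) = 0"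
    by (rule weight_sum_zero[of "insert (- \<gamma>) M" ?v, OF _ sub mem sum0]) (use M(1) in auto)
  then show False using assms(3) by simp
qed

text \<open>The bracket of root vectors for \<open>- \<alpha> j\<close> and \<open>- \<beta>\<close>
  lies in the root space of \<open>- (\<beta> + \<alpha> j)\<close>, and it is nonzero whenever that
  sum is a root. This turns stability of \<open>n_w w\<close> into a condition on roots.\<close>

lemma J_w_iff:
  assumes w: "w \<in> W_p"
  shows "j \<in> J_w w \<longleftrightarrow> j \<in> {1..n} - {i} \<and>
    (\<exists>\<beta>\<in>inversions w. \<beta> + \<alpha> j \<in> roots H \<and> \<beta> + \<alpha> j \<notin> inversions w)"
    (is "_ \<longleftrightarrow> _ \<and> ?C")
proof (cases "j \<in> {1..n} - {i}")
  case True
  then have j: "j \<in> {1..n}" "j \<noteq> i" by auto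
  have W: "w \<in> W" using w by (simp add: W_p_def)
  have neg: "(\<lambda>h. - \<alpha> j h) = - \<alpha> j" by auto
  have sub: "bracket_space (\<gg> (- \<alpha> j)) (n_w w) \<subseteq> n_w w \<longleftrightarrow> \<not> ?C"
  proof
    assume L: "bracket_space (\<gg> (- \<alpha> j)) (n_w w) \<subseteq> n_w w"
    show "\<not> ?C"
    proof
      assume ?C
      then obtain \<beta> where \<beta>: "\<beta> \<in> inversions w" "\<beta> + \<alpha> j \<in> roots H" "\<beta> + \<alpha> j \<notin> inversions w" by blast
      have r: "- \<beta> \<in> roots H" "- \<alpha> j \<in> roots H"
        using \<beta>(1) inversions_iff[OF W] pos_root root_uminus simple_root[OF j(1)] by blast+
      have eq: "- \<alpha> j + - \<beta> = - (\<beta> + \<alpha> j)" by simp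
      obtain x where x: "x \<in> \<gg> (- \<alpha> j)" "x \<noteq> 0" using rootsD(3)[OF r(2)] by blast
      obtain y where y: "y \<in> \<gg> (- \<beta>)" "y \<noteq> 0" using rootsD(3)[OF r(1)] by blast
      have "bracket x y \<in> bracket_space (\<gg> (- \<alpha> j)) (n_w w)"
        unfolding bracket_space_def using x y root_space_n_w[OF \<beta>(1)] by (intro span_base) blast
      moreover have "bracket x y \<noteq> 0"
        using bracket_root_vectors_nonzero[OF r(2,1) _ x y] root_uminus[OF \<beta>(2)] unfolding eq by blast
      moreover have "bracket x y \<in> \<gg> (- (\<beta> + \<alpha> j))"
        using bracket_root_space[OF x(1) y(1)] unfolding eq .
      ultimately show False using n_w_root_vector[OF W _ _ _ \<beta>(2)] L \<beta>(3) by blast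
    qed
  next
    assume nC: "\<not> ?C"
    have "bracket x y \<in> n_w w" if x: "x \<in> \<gg> (- \<alpha> j)" and y: "y \<in> n_w w" for x y
    proof (rule bracket_span_right[OF y[unfolded n_w_eq] subspace_n_w])
      fix s assume "s \<in> (\<Union>\<mu>\<in>uminus ` inversions w. \<gg> \<mu>)"
      then obtain \<beta> where \<beta>: "\<beta> \<in> inversions w" "s \<in> \<gg> (- \<beta>)" by blast
      have \<beta>r: "\<beta> \<in> roots H" using \<beta>(1) inversions_iff[OF W] pos_root by blast
      have eq: "- \<alpha> j + - \<beta> = - (\<beta> + \<alpha> j)" by simp
      have mem: "bracket x s \<in> \<gg> (- (\<beta> + \<alpha> j))"
        using bracket_root_space[OF x \<beta>(2)] unfolding eq .
      show "bracket x s \<in> n_w w"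
      proof (cases "bracket x s = 0")
        case False
        have c: "coef (\<beta> + \<alpha> j) i = 1"
          using coef_add[OF \<beta>r simple_root[OF j(1)] node] inversions_coef_i[OF w \<beta>(1)]
            coef_simple[OF j(1) node] j(2) by simp
        \<comment> \<open>Degree 1 excludes the zero functional, so a nonzero bracket does exhibit a
          root.\<close>
        have nz: "\<beta> + \<alpha> j \<noteq> 0"
        proof
          assume "\<beta> + \<alpha> j = 0"
          then show False using c by (simp only: coef_def zero_fun_apply) simp
        qed
        have dual: "\<beta> + \<alpha> j \<in> dual"
          by (rule dual_space_add[OF rootsD(1)[OF \<beta>r] simple_root_dual[OF j(1)]])
        have "- (\<beta> + \<alpha> j) \<noteq> 0" using nz by (simp only: neg_equal_0_iff_equal not_False_eq_True)
        then have "- (\<beta> + \<alpha> j) \<in> roots H"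
          using rootsI[OF dual_space_uminus[OF dual] _ mem False] by blast
        then have "\<beta> + \<alpha> j \<in> roots H" using root_uminus by (metis minus_minus)
        then have "\<beta> + \<alpha> j \<in> inversions w" using nC \<beta>(1) by blast
        then show ?thesis using root_space_n_w mem by blast
      qed (simp add: subspace_0[OF subspace_n_w])
    qed
    then show "bracket_space (\<gg> (- \<alpha> j)) (n_w w) \<subseteq> n_w w"
      unfolding bracket_space_def by (intro span_minimal[OF _ subspace_n_w]) blast
  qed
  show ?thesis unfolding J_w_def neg mem_Collect_eq sub using True by blast
next
  case False
  then show ?thesis unfolding J_w_def mem_Collect_eq by blast
qed

section \<open>The grading of roots transported by \<open>w\<close>\<close>

context
  fixes w
  assumes w: "w \<in> W_p" and nonempty: "inversions w \<noteq> {}"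
begin

lemma w_weyl: "w \<in> W"
  using w by (simp add: W_p_def)

lemmas w_inversions_iff = inversions_iff[OF w_weyl]
lemmas w_root = weyl_root[OF w_weyl]
lemmas w_inv = weyl_inv[OF w_weyl]
lemmas w_inv_root = weyl_inv_root[OF w_weyl]

text \<open>Applying \<open>w\<inverse>\<close> turns \<open>\<Delta>(w)\<close> into the negatives of the positive roots of degree \<open>-1\<close>.\<close>

definition deg :: "('g \<Rightarrow> complex) \<Rightarrow> int"
  where "deg \<gamma> = coef (w \<gamma>) i"

definition E :: "('g \<Rightarrow> complex) \<Rightarrow> int"
  where "E \<gamma> = (\<Sum>k=1..n. if deg (\<alpha> k) = 1 then coef \<gamma> k else 0)"

text \<open>The counterpart of \<open>E\<close> for the opposite grading. On positive roots both are
  nonnegative and the degree is \<open>E - F\<close>, so a bound on one gives a bound on the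
  other.\<close>

definition F :: "('g \<Rightarrow> complex) \<Rightarrow> int"
  where "F \<gamma> = (\<Sum>k=1..n. if deg (\<alpha> k) = -1 then coef \<gamma> k else 0)"

lemma deg_add: "\<beta> \<in> roots H \<Longrightarrow> \<gamma> \<in> roots H \<Longrightarrow> deg (\<beta> + \<gamma>) = deg \<beta> + deg \<gamma>"
  unfolding deg_def
  by (simp only: weyl_add[OF w_weyl rootsD(1) rootsD(1)] coef_add[OF w_root w_root node])

lemma deg_uminus: "\<beta> \<in> roots H \<Longrightarrow> deg (- \<beta>) = - deg \<beta>"
  unfolding deg_def by (simp only: weyl_uminus[OF w_weyl rootsD(1)] coef_uminus[OF w_root node])

lemma deg_range: "\<beta> \<in> roots H \<Longrightarrow> deg \<beta> \<in> {-1, 0, 1}"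
  unfolding deg_def by (rule coef_i_range[OF w_root])

lemma deg_inv: "deg (inv w \<beta>) = coef \<beta> i"
  unfolding deg_def w_inv(3) ..

lemma E_add: "\<beta> \<in> roots H \<Longrightarrow> \<gamma> \<in> roots H \<Longrightarrow> E (\<beta> + \<gamma>) = E \<beta> + E \<gamma>"
  unfolding E_def sum.distrib[symmetric] by (intro sum.cong) (auto simp only: coef_add split: if_splits)

lemma F_add: "\<beta> \<in> roots H \<Longrightarrow> \<gamma> \<in> roots H \<Longrightarrow> F (\<beta> + \<gamma>) = F \<beta> + F \<gamma>"
  unfolding F_def sum.distrib[symmetric] by (intro sum.cong) (auto simp only: coef_add split: if_splits)

lemma E_uminus: "\<beta> \<in> roots H \<Longrightarrow> E (- \<beta>) = - E \<beta>"
  unfolding E_def sum_negf[symmetric] by (intro sum.cong) (auto simp only: coef_uminus split: if_splits)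

lemma E_simple: "k \<in> {1..n} \<Longrightarrow> E (\<alpha> k) = (if deg (\<alpha> k) = 1 then 1 else 0)"
  and F_simple: "k \<in> {1..n} \<Longrightarrow> F (\<alpha> k) = (if deg (\<alpha> k) = -1 then 1 else 0)"
proof -
  assume k: "k \<in> {1..n}"
  have "E (\<alpha> k) = (\<Sum>l=1..n. if l = k then (if deg (\<alpha> k) = 1 then 1 else 0) else 0)"
    unfolding E_def using coef_simple[OF k] by (intro sum.cong) auto
  then show "E (\<alpha> k) = (if deg (\<alpha> k) = 1 then 1 else 0)" using k by simp
  have "F (\<alpha> k) = (\<Sum>l=1..n. if l = k then (if deg (\<alpha> k) = -1 then 1 else 0) else 0)"
    unfolding F_def using coef_simple[OF k] by (intro sum.cong) auto
  then show "F (\<alpha> k) = (if deg (\<alpha> k) = -1 then 1 else 0)" using k by simp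
qed

lemma E_nonneg: "\<beta> \<in> pos \<Longrightarrow> 0 \<le> E \<beta>" and F_nonneg: "\<beta> \<in> pos \<Longrightarrow> 0 \<le> F \<beta>"
  unfolding E_def F_def using pos_coef by (auto intro!: sum_nonneg)

lemma deg_eq: "\<beta> \<in> pos \<Longrightarrow> deg \<beta> = E \<beta> - F \<beta>"
proof -
  assume \<beta>: "\<beta> \<in> pos"
  have "(\<lambda>\<beta>. deg \<beta> - E \<beta> + F \<beta>) \<beta> = 0"
  proof (rule additive_on_pos_zero[OF _ _ \<beta>])
    fix \<beta> \<gamma> assume "\<beta> \<in> pos" "\<gamma> \<in> pos"
    then show "deg (\<beta> + \<gamma>) - E (\<beta> + \<gamma>) + F (\<beta> + \<gamma>) =
        deg \<beta> - E \<beta> + F \<beta> + (deg \<gamma> - E \<gamma> + F \<gamma>)"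
      using deg_add E_add F_add pos_root by simp
  next
    fix k assume "k \<in> {1..n}"
    then show "deg (\<alpha> k) - E (\<alpha> k) + F (\<alpha> k) = 0"
      using E_simple F_simple deg_range[OF simple_root] by auto
  qed
  then show ?thesis by simp
qed

text \<open>Otherwise \<open>- w \<gamma>\<close> would be an inversion, and all inversions of an
  element of \<open>W_p\<close> have coefficient 1 at \<open>i\<close>, not 0.\<close>

lemma degree_zero_pos:
  assumes "\<gamma> \<in> pos" "deg \<gamma> = 0"
  shows "w \<gamma> \<in> pos"
proof (rule ccontr)
  assume "w \<gamma> \<notin> pos"
  have \<gamma>: "\<gamma> \<in> roots H" using assms pos_root by blast
  have neg: "- w \<gamma> \<in> pos" using pos_or_neg[OF w_root[OF \<gamma>]] \<open>w \<gamma> \<notin> pos\<close> by blast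
  then have "- w \<gamma> \<in> inversions w"
    unfolding w_inversions_iff weyl_inv_uminus[OF w_weyl rootsD(1)[OF \<gamma>]] minus_minus using assms(1) by blast
  then have "coef (- w \<gamma>) i = 1" by (rule inversions_coef_i[OF w])
  then show False using coef_uminus[OF w_root[OF \<gamma>] node] assms(2) by (simp add: deg_def)
qed

text \<open>Applying \<open>w\<close> would split the simple root \<open>\<alpha> j\<close> into two
  positive roots, contradicting its height 1.\<close>

lemma simple_root_indecomposable:
  assumes "j \<in> {1..n}" "s \<in> pos" "t \<in> pos" "deg s = 0" "deg t = 0"
  shows "s + t \<noteq> inv w (\<alpha> j)"
proof
  assume "s + t = inv w (\<alpha> j)"
  then have "w (s + t) = \<alpha> j" by (simp only: w_inv(3))
  then have eq: "w s + w t = \<alpha> j"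
    by (simp only: weyl_add[OF w_weyl rootsD(1)[OF pos_root[OF assms(2)]] rootsD(1)[OF pos_root[OF assms(3)]]])
  have "w s \<in> pos" "w t \<in> pos" using degree_zero_pos assms by auto
  then have "2 \<le> height (w s + w t)"
    using height_add[OF pos_root pos_root] height_pos[of "w s"] height_pos[of "w t"] by fastforce
  then show False unfolding eq using height_simple[OF assms(1)] by simp
qed

lemma Levi_simple_root:
  assumes "j \<in> {1..n} - {i}"
  shows "inv w (\<alpha> j) \<in> pos" "deg (inv w (\<alpha> j)) = 0"
proof -
  have j: "j \<in> {1..n}" "j \<noteq> i" using assms by auto
  show g0: "deg (inv w (\<alpha> j)) = 0" unfolding deg_inv using coef_simple[OF j(1) node] j by simp
  show "inv w (\<alpha> j) \<in> pos"
  proof (rule ccontr)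
    assume "inv w (\<alpha> j) \<notin> pos"
    then have "\<alpha> j \<in> inversions w"
      unfolding w_inversions_iff
      using pos_or_neg[OF w_inv_root[OF simple_root[OF j(1)]]] simple_pos[OF j(1)] by blast
    then show False using inversions_coef_i[OF w] coef_simple[OF j(1) node] j by simp
  qed
qed

text \<open>The descent on decompositions is used twice: with \<open>deg\<close> and
  \<open>E\<close> it gives \<open>E y = 0\<close>, and with the negated grading and
  \<open>F\<close>, where \<open>x\<close> and \<open>y\<close> change places, it gives
  \<open>F x = 0\<close>. Then \<open>E x\<close> equals the degree of \<open>x\<close>, which is
  1.\<close>

lemma E_crossing:
  assumes j: "j \<in> {1..n}" and xy: "x \<in> pos" "y \<in> pos" "x + y = inv w (\<alpha> j)" "deg x = 1" "deg y = -1"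
  shows "E (inv w (\<alpha> j)) = 1"
proof -
  have add: "a + b \<in> pos" if "a \<in> pos" "b \<in> pos" "a + b \<in> roots H" for a b
    using pos_add that by blast
  have split: "\<exists>s t. s \<in> pos \<and> t \<in> pos \<and> a = s + t" if a: "a \<in> pos" "a \<notin> \<alpha> ` {1..n}" for a
  proof -
    obtain k where k: "k \<in> {1..n}" "a - \<alpha> k \<in> pos" using pos_root_split[OF a] by blast
    have "a = (a - \<alpha> k) + \<alpha> k" by (rule diff_add_cancel[symmetric])
    then show ?thesis using k(2) simple_pos[OF k(1)] by blast
  qed
  have jac: "a + s \<in> roots H \<or> a + t \<in> roots H"
    if "a \<in> pos" "s \<in> pos" "t \<in> pos" "s + t \<in> roots H" "a + (s + t) \<in> roots H" for a s t
    using root_sum_cases[OF pos_root pos_root pos_root] that pos_sum_nonzero by blast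
  have sub: "pos \<subseteq> roots H" using pos_root by blast
  have hadd: "nat (height (a + b)) = nat (height a) + nat (height b)" if "a \<in> pos" "b \<in> pos" for a b
    using height_add[OF pos_root pos_root, OF that] height_pos[OF that(1)] height_pos[OF that(2)] by simp
  have hpos: "0 < nat (height a)" if "a \<in> pos" for a using height_pos[OF that] by simp
  have theta: "inv w (\<alpha> j) \<in> pos"
    using pos_add[OF xy(1,2)] w_inv_root[OF simple_root[OF j]] xy(3) by (simp only:)
  have indec: "s + t \<noteq> inv w (\<alpha> j)" if "s \<in> pos" "t \<in> pos" "deg s = 0" "deg t = 0" for s t
    by (rule simple_root_indecomposable[OF j that])
  have "E y = 0"
  proof (rule alternating_decomposition_vanishes[of pos "roots H" "\<alpha> ` {1..n}" "\<lambda>\<beta>. nat (height \<beta>)" deg E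
        "inv w (\<alpha> j)" x y, OF add split jac sub hadd hpos _ _ _ _ theta indec xy])
    show "deg (a + b) = deg a + deg b" "E (a + b) = E a + E b" if "a \<in> pos" "b \<in> pos" for a b
      using deg_add E_add pos_root that by blast+
    show "deg a \<in> {-1, 0, 1}" if "a \<in> pos" for a using deg_range pos_root that by blast
    show "E a = 0" if "a \<in> pos" "a \<in> \<alpha> ` {1..n}" "deg a \<noteq> 1" for a using E_simple that by auto
  qed
  moreover have "F x = 0"
  proof (rule alternating_decomposition_vanishes[of pos "roots H" "\<alpha> ` {1..n}" "\<lambda>\<beta>. nat (height \<beta>)"
        "\<lambda>\<beta>. - deg \<beta>" F "inv w (\<alpha> j)" y x, OF add split jac sub hadd hpos _ _ _ _ theta])
    show "- deg (a + b) = - deg a + - deg b" "F (a + b) = F a + F b" if "a \<in> pos" "b \<in> pos" for a b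
      using deg_add F_add pos_root that by simp_all
    show "- deg a \<in> {-1, 0, 1}" if "a \<in> pos" for a using deg_range[OF pos_root[OF that]] by auto
    show "F a = 0" if "a \<in> pos" "a \<in> \<alpha> ` {1..n}" "- deg a \<noteq> 1" for a using F_simple that by auto
    show "s + t \<noteq> inv w (\<alpha> j)" if "s \<in> pos" "t \<in> pos" "- deg s = 0" "- deg t = 0" for s t
      using indec that by simp
    show "y + x = inv w (\<alpha> j)" using xy(3) by (simp only: add.commute)
  qed (use xy in auto)
  ultimately show ?thesis
    using deg_eq[OF xy(1)] xy(4) E_add[OF pos_root[OF xy(1)] pos_root[OF xy(2)]] unfolding xy(3) by simp
qed

text \<open>For \<open>j \<in> J_w w\<close> the decomposition comes from an inversion
  \<open>\<beta>\<close> that leaves the set when \<open>\<alpha> j\<close> is added: take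
  \<open>x = inv w (\<beta> + \<alpha> j)\<close> and \<open>y = - inv w \<beta>\<close>.
  Conversely, if \<open>inv w (\<alpha> j)\<close> is not simple, splitting off a simple root must
  give degrees 1 and -1, and the resulting pair shows \<open>j \<in> J_w w\<close>.\<close>

lemma E_Levi_simple_root:
  assumes j: "j \<in> {1..n} - {i}"
  shows "E (inv w (\<alpha> j)) = (if j \<in> J_w w then 1 else 0)"
proof (cases "j \<in> J_w w")
  case True
  then obtain \<beta> where \<beta>: "\<beta> \<in> inversions w" "\<beta> + \<alpha> j \<in> roots H" "\<beta> + \<alpha> j \<notin> inversions w"
    using J_w_iff[OF w] by blast
  have j': "j \<in> {1..n}" "j \<noteq> i" using j by auto
  have \<beta>r: "\<beta> \<in> roots H" and y: "- inv w \<beta> \<in> pos" using \<beta>(1) w_inversions_iff pos_root by blast+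
  have c: "coef (\<beta> + \<alpha> j) i = 1"
    using coef_add[OF \<beta>r simple_root[OF j'(1)] node] inversions_coef_i[OF w \<beta>(1)]
      coef_simple[OF j'(1) node] j'(2) by simp
  have "\<beta> + \<alpha> j \<in> pos" by (rule degree_one_pos[OF \<beta>(2) c])
  then have x: "inv w (\<beta> + \<alpha> j) \<in> pos"
    using \<beta>(3) w_inversions_iff pos_or_neg[OF w_inv_root[OF \<beta>(2)]] by blast
  have "inv w (\<beta> + \<alpha> j) = inv w \<beta> + inv w (\<alpha> j)"
    by (rule weyl_add[OF w_inv(1) rootsD(1)[OF \<beta>r] simple_root_dual[OF j'(1)]])
  then have sum: "inv w (\<beta> + \<alpha> j) + - inv w \<beta> = inv w (\<alpha> j)" by (simp only: add.commute add_minus_cancel minus_add_cancel)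
  have "deg (inv w (\<beta> + \<alpha> j)) = 1" "deg (- inv w \<beta>) = -1"
    using c inversions_coef_i[OF w \<beta>(1)] deg_uminus[OF w_inv_root[OF \<beta>r]] by (simp_all only: deg_inv)
  then show ?thesis using E_crossing[OF j'(1) x y sum] True by simp
next
  case False
  note \<theta> = Levi_simple_root[OF j]
  have j': "j \<in> {1..n}" "j \<noteq> i" using j by auto
  have "inv w (\<alpha> j) \<in> \<alpha> ` {1..n}"
  proof (rule ccontr)
    assume "inv w (\<alpha> j) \<notin> \<alpha> ` {1..n}"
    then obtain k where k: "k \<in> {1..n}" "inv w (\<alpha> j) - \<alpha> k \<in> pos" using pos_root_split \<theta>(1) by blast
    let ?s = "inv w (\<alpha> j) - \<alpha> k"
    have sum: "?s + \<alpha> k = inv w (\<alpha> j)" by (rule diff_add_cancel)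
    have "deg ?s + deg (\<alpha> k) = 0"
      using deg_add[OF pos_root[OF k(2)] simple_root[OF k(1)]] \<theta>(2) unfolding sum by simp
    moreover have "\<not> (deg ?s = 0 \<and> deg (\<alpha> k) = 0)"
      using simple_root_indecomposable[OF j'(1) k(2) simple_pos[OF k(1)]] sum by blast
    ultimately have "deg ?s = 1 \<and> deg (\<alpha> k) = -1 \<or> deg (\<alpha> k) = 1 \<and> deg ?s = -1"
      using deg_range[OF simple_root[OF k(1)]] by auto
    then obtain x y where xy: "x \<in> pos" "y \<in> pos" "x + y = inv w (\<alpha> j)" "deg x = 1" "deg y = -1"
      using k(2) simple_pos[OF k(1)] sum by (metis add.commute)
    have xr: "x \<in> roots H" and yr: "y \<in> roots H" using xy pos_root by auto
    have c: "coef (- w y) i = 1" using coef_uminus[OF w_root[OF yr] node] xy(5) by (simp add: deg_def)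
    have wy: "- w y \<in> pos" by (rule degree_one_pos[OF root_uminus[OF w_root[OF yr]] c])
    then have inv: "- w y \<in> inversions w"
      unfolding w_inversions_iff weyl_inv_uminus[OF w_weyl rootsD(1)[OF yr]] minus_minus using xy(2) by blast
    have "w (x + y) = \<alpha> j" unfolding xy(3) by (rule w_inv(3))
    then have "w x + w y = \<alpha> j" by (simp only: weyl_add[OF w_weyl rootsD(1)[OF xr] rootsD(1)[OF yr]])
    \<comment> \<open>The inversion \<open>- w y\<close> becomes \<open>w x\<close> when
      \<open>\<alpha> j\<close> is added, and \<open>w x\<close> is not an inversion because
      \<open>x\<close> is positive.\<close>
    then have eq: "- w y + \<alpha> j = w x" by (metis add.commute minus_add_cancel)
    have "w x \<notin> inversions w"
      unfolding w_inversions_iff w_inv(2) using not_pos_and_neg[OF xy(1)] by blast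
    then have "j \<in> J_w w"
      using J_w_iff[OF w] j inv w_root[OF xr] unfolding eq[symmetric] by blast
    then show False using False by blast
  qed
  then obtain k where "k \<in> {1..n}" "inv w (\<alpha> j) = \<alpha> k" by blast
  then show ?thesis using E_simple \<theta>(2) False by simp
qed

section \<open>The values of roots at \<open>Z_w w\<close> and the number
  \<open>a_w w\<close>\<close>

lemma Z_w_in_H: "Z_w w \<in> H"
  unfolding Z_w_def using Z_in_H by (intro subspace_sum[OF subspace_H]) (auto simp: J_w_def)

lemma weight_Z_w:
  assumes "\<beta> \<in> roots H"
  shows "\<beta> (Z_w w) = of_int (\<Sum>j\<in>J_w w. coef \<beta> j)"
proof -
  have J: "j \<in> {1..n}" if "j \<in> J_w w" for j using that by (auto simp: J_w_def)
  have "\<beta> (Z_w w) = (\<Sum>j\<in>J_w w. \<beta> (Z j))"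
    unfolding Z_w_def by (rule dual_sum[OF rootsD(1)[OF assms]]) (rule Z_in_H[OF J])
  also have "\<dots> = (\<Sum>j\<in>J_w w. of_int (coef \<beta> j))"
    by (rule sum.cong[OF refl]) (rule root_Z[OF assms J])
  finally show ?thesis by simp
qed

text \<open>Expand \<open>inv w \<beta>\<close> over the images of the simple roots: the one at
  \<open>i\<close> occurs with coefficient 1, and the others contribute only for
  \<open>j \<in> J_w w\<close>.\<close>

lemma E_inv_eq:
  assumes "\<beta> \<in> roots H" "coef \<beta> i = 1"
  shows "(\<Sum>j\<in>J_w w. coef \<beta> j) = E (inv w \<beta>) - E (inv w (\<alpha> i))"
proof -
  have pos: "\<beta> \<in> pos" by (rule degree_one_pos[OF assms(1) assms(2)])
  have "(\<lambda>\<beta>. E (inv w \<beta>) - (\<Sum>k=1..n. coef \<beta> k * E (inv w (\<alpha> k)))) \<beta> = 0"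
  proof (rule additive_on_pos_zero[OF _ _ pos])
    fix \<beta> \<gamma> assume "\<beta> \<in> pos" "\<gamma> \<in> pos"
    then have r: "\<beta> \<in> roots H" "\<gamma> \<in> roots H" using pos_root by auto
    have "E (inv w (\<beta> + \<gamma>)) = E (inv w \<beta>) + E (inv w \<gamma>)"
      unfolding weyl_add[OF w_inv(1) rootsD(1)[OF r(1)] rootsD(1)[OF r(2)]]
      by (rule E_add[OF w_inv_root[OF r(1)] w_inv_root[OF r(2)]])
    moreover have "(\<Sum>k=1..n. coef (\<beta> + \<gamma>) k * E (inv w (\<alpha> k))) =
        (\<Sum>k=1..n. coef \<beta> k * E (inv w (\<alpha> k))) + (\<Sum>k=1..n. coef \<gamma> k * E (inv w (\<alpha> k)))"
      unfolding sum.distrib[symmetric]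
      by (intro sum.cong refl) (simp only: coef_add[OF r] distrib_right)
    ultimately show "E (inv w (\<beta> + \<gamma>)) - (\<Sum>k=1..n. coef (\<beta> + \<gamma>) k * E (inv w (\<alpha> k))) =
        E (inv w \<beta>) - (\<Sum>k=1..n. coef \<beta> k * E (inv w (\<alpha> k))) +
        (E (inv w \<gamma>) - (\<Sum>k=1..n. coef \<gamma> k * E (inv w (\<alpha> k))))" by simp
  next
    fix j assume j: "j \<in> {1..n}"
    have "(\<Sum>k=1..n. coef (\<alpha> j) k * E (inv w (\<alpha> k))) = (\<Sum>k=1..n. if k = j then E (inv w (\<alpha> k)) else 0)"
      using coef_simple[OF j] by (intro sum.cong) auto
    then show "E (inv w (\<alpha> j)) - (\<Sum>k=1..n. coef (\<alpha> j) k * E (inv w (\<alpha> k))) = 0" using j by simp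
  qed
  then have "E (inv w \<beta>) = (\<Sum>k=1..n. coef \<beta> k * E (inv w (\<alpha> k)))" by simp
  also have "\<dots> = E (inv w (\<alpha> i)) + (\<Sum>k\<in>{1..n} - {i}. coef \<beta> k * E (inv w (\<alpha> k)))"
    using assms(2) by (subst sum.remove[OF _ node]) auto
  also have "(\<Sum>k\<in>{1..n} - {i}. coef \<beta> k * E (inv w (\<alpha> k))) = (\<Sum>k\<in>{1..n} - {i}. if k \<in> J_w w then coef \<beta> k else 0)"
    by (intro sum.cong refl) (auto simp only: E_Levi_simple_root split: if_splits)
  also have "\<dots> = (\<Sum>k\<in>J_w w. coef \<beta> k)"
    by (rule sum.mono_neutral_cong_right) (auto simp: J_w_def)
  finally show ?thesis by simp
qed

text \<open>The root \<open>inv w \<beta>\<close> has degree 1. If it is positive, then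
  \<open>E\<close> is \<open>1 + F\<close>, hence at least 1; if it is negative, \<open>E\<close> is
  at most 0.\<close>

lemma inversions_iff_E:
  assumes "\<beta> \<in> roots H" "coef \<beta> i = 1"
  shows "\<beta> \<in> inversions w \<longleftrightarrow> E (inv w \<beta>) \<le> 0"
proof
  assume "\<beta> \<in> inversions w"
  then have "- inv w \<beta> \<in> pos" using w_inversions_iff by blast
  then have "0 \<le> E (- inv w \<beta>)" by (rule E_nonneg)
  then show "E (inv w \<beta>) \<le> 0" using E_uminus[OF w_inv_root[OF assms(1)]] by simp
next
  assume le: "E (inv w \<beta>) \<le> 0"
  show "\<beta> \<in> inversions w"
  proof (rule ccontr)
    assume "\<beta> \<notin> inversions w"
    moreover have "\<beta> \<in> pos" by (rule degree_one_pos[OF assms(1) assms(2)])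
    ultimately have pos: "inv w \<beta> \<in> pos"
      using w_inversions_iff pos_or_neg[OF w_inv_root[OF assms(1)]] by blast
    have "deg (inv w \<beta>) = 1" by (simp only: deg_inv assms(2))
    then show False using deg_eq[OF pos] F_nonneg[OF pos] le by simp
  qed
qed

text \<open>An inversion yields a positive root of degree -1, on which \<open>F\<close> is nonzero,
  so some simple root \<open>\<alpha> k\<close> has degree -1. Then \<open>- w (\<alpha> k)\<close>
  is an inversion, and its value is \<open>- E (\<alpha> k) = 0\<close>.\<close>

lemma inversion_E_zero: "\<exists>\<beta>\<in>inversions w. E (inv w \<beta>) = 0"
proof -
  obtain \<phi> where \<phi>: "\<phi> \<in> inversions w" using nonempty by blast
  have \<phi>r: "\<phi> \<in> roots H" and y: "- inv w \<phi> \<in> pos" using \<phi> w_inversions_iff pos_root by blast+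
  have "deg (- inv w \<phi>) = -1"
    using deg_uminus[OF w_inv_root[OF \<phi>r]] inversions_coef_i[OF w \<phi>] by (simp only: deg_inv)
  then have nz: "F (- inv w \<phi>) \<noteq> 0" using deg_eq[OF y] E_nonneg[OF y] by simp
  have "\<exists>k\<in>{1..n}. deg (\<alpha> k) = -1"
  proof (rule ccontr)
    assume "\<not> ?thesis"
    then have "F (- inv w \<phi>) = 0" unfolding F_def by (intro sum.neutral) auto
    then show False using nz by simp
  qed
  then obtain k where k: "k \<in> {1..n}" "deg (\<alpha> k) = -1" by blast
  have \<alpha>: "\<alpha> k \<in> roots H" using simple_root k by blast
  have c: "coef (- w (\<alpha> k)) i = 1"
    using coef_uminus[OF w_root[OF \<alpha>] node] k(2) by (simp add: deg_def)
  have pos: "- w (\<alpha> k) \<in> pos" by (rule degree_one_pos[OF root_uminus[OF w_root[OF \<alpha>]] c])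
  note inv = weyl_inv_uminus[OF w_weyl rootsD(1)[OF \<alpha>]]
  have "- w (\<alpha> k) \<in> inversions w"
    unfolding w_inversions_iff inv minus_minus using pos simple_pos[OF k(1)] by blast
  moreover have "E (inv w (- w (\<alpha> k))) = 0"
    unfolding inv E_uminus[OF \<alpha>] using E_simple[OF k(1)] k(2) by simp
  ultimately show ?thesis by blast
qed

lemma a_w_eq: "a_w w = - E (inv w (\<alpha> i))"
proof -
  let ?d = "\<lambda>\<beta>. \<Sum>j\<in>J_w w. coef \<beta> j"
  have r: "\<beta> \<in> roots H" "coef \<beta> i = 1" if "\<beta> \<in> inversions w" for \<beta>
    using that w_inversions_iff pos_root inversions_coef_i[OF w] by blast+
  have eq: "{k. \<exists>\<beta>\<in>inversions w. \<beta> (Z_w w) = of_int k} = ?d ` inversions w"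
  proof (rule set_eqI)
    fix k
    show "k \<in> {k. \<exists>\<beta>\<in>inversions w. \<beta> (Z_w w) = of_int k} \<longleftrightarrow> k \<in> ?d ` inversions w"
      unfolding mem_Collect_eq image_iff using weight_Z_w[OF r(1)] by (metis of_int_eq_iff)
  qed
  have fin: "finite (inversions w)"
    by (rule finite_subset[OF _ finite_roots]) (use r(1) in blast)
  have d: "?d \<beta> = E (inv w \<beta>) - E (inv w (\<alpha> i))" if "\<beta> \<in> inversions w" for \<beta>
    by (rule E_inv_eq[OF r[OF that]])
  show ?thesis
    unfolding a_w_def eq
  proof (rule Max_eqI)
    show "finite (?d ` inversions w)" using fin by (rule finite_imageI)
    show "y \<le> - E (inv w (\<alpha> i))" if "y \<in> ?d ` inversions w" for y
      using that d inversions_iff_E[OF r] by fastforce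
    show "- E (inv w (\<alpha> i)) \<in> ?d ` inversions w" using inversion_E_zero d by force
  qed
qed

lemma inversions_iff_Z_w:
  assumes "\<beta> \<in> roots H" "coef \<beta> i = 1"
  shows "\<beta> \<in> inversions w \<longleftrightarrow> (\<Sum>j\<in>J_w w. coef \<beta> j) \<le> a_w w"
  unfolding inversions_iff_E[OF assms] a_w_eq E_inv_eq[OF assms] by simp

section \<open>The bigraded pieces of \<open>n_w w\<close>\<close>

lemma subspace_bigrade: "subspace (bigrade w j k)"
  by (rule subspaceI)
    (simp_all add: bigrade_def bracket_add_right bracket_scale_right scale_right_distrib mult.commute)

lemma root_space_bigrade:
  assumes "\<beta> \<in> roots H" "coef \<beta> i = 1" "(\<Sum>j\<in>J_w w. coef \<beta> j) = k"
  shows "\<gg> (- \<beta>) \<subseteq> bigrade w (-1) (- k)"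
proof
  fix x assume x: "x \<in> \<gg> (- \<beta>)"
  have "bracket (Z i) x = of_int (-1) *\<^sub>C x"
    using root_spaceD[OF x Z_in_H[OF node]] root_Z[OF assms(1) node] assms(2) by simp
  moreover have "bracket (Z_w w) x = of_int (- k) *\<^sub>C x"
    using root_spaceD[OF x Z_w_in_H] weight_Z_w[OF assms(1)] assms(3) by simp
  ultimately show "x \<in> bigrade w (-1) (- k)" unfolding bigrade_def by blast
qed

text \<open>The weight components of \<open>u\<close> take the value -1 at \<open>Z i\<close>, and
  independence forces those that are nonzero to take the value \<open>- k\<close> at
  \<open>Z_w w\<close>. The negatives of their weights are therefore inversions.\<close>

lemma bigrade_n_w:
  assumes "k \<le> a_w w"
  shows "bigrade w (-1) (- k) \<subseteq> n_w w"
proof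
  fix u assume "u \<in> bigrade w (-1) (- k)"
  then have u: "bracket (Z i) u = of_int (-1) *\<^sub>C u" "bracket (Z_w w) u = of_int (- k) *\<^sub>C u"
    unfolding bigrade_def by blast+
  let ?M = "{\<mu> \<in> weights. \<mu> (Z i) = of_int (-1)}"
  obtain v where v: "\<And>\<mu>. \<mu> \<in> weights \<Longrightarrow> v \<mu> \<in> \<gg> \<mu>" "u = (\<Sum>\<mu>\<in>?M. v \<mu>)"
    by (rule eigenvector_decomposition[OF Z_in_H[OF node] u(1)]) blast
  let ?v = "\<lambda>\<mu>. (\<mu> (Z_w w) - of_int (- k)) *\<^sub>C v \<mu>"
  have "(\<Sum>\<mu>\<in>?M. ?v \<mu>) = (\<Sum>\<mu>\<in>?M. bracket (Z_w w) (v \<mu>) - of_int (- k) *\<^sub>C v \<mu>)"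
    by (intro sum.cong refl) (use root_spaceD[OF v(1) Z_w_in_H] in \<open>simp add: scale_left_diff_distrib scale_left_distrib\<close>)
  also have "\<dots> = bracket (Z_w w) u - of_int (- k) *\<^sub>C u"
    unfolding v(2) sum_subtractf bracket_sum_right scale_sum_right ..
  finally have sum0: "(\<Sum>\<mu>\<in>?M. ?v \<mu>) = 0" using u(2) by simp
  have fin: "finite ?M" using finite_roots by simp
  have dual: "?M \<subseteq> dual" using weight_dual by blast
  have "v \<mu> \<in> n_w w" if \<mu>: "\<mu> \<in> ?M" for \<mu>
  proof (cases "v \<mu> = 0")
    case False
    have "?v \<mu> = 0"
      by (rule weight_sum_zero[OF fin dual _ sum0 \<mu>])
        (use v(1) subspace_scale[OF subspace_root_space] in blast)
    then have Zw: "\<mu> (Z_w w) = of_int (- k)" using False by (simp only: scale_eq_0_iff right_minus_eq simp_thms)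
    have "\<mu> \<noteq> 0" using \<mu> by auto
    then have \<mu>r: "\<mu> \<in> roots H" using \<mu> by blast
    have "coef \<mu> i = -1" using \<mu> coef_eqI[of \<mu> i "-1"] by blast
    then have c: "coef (- \<mu>) i = 1" using coef_uminus[OF \<mu>r node] by simp
    have "(- \<mu>) (Z_w w) = of_int k" using Zw by simp
    then have "(\<Sum>j\<in>J_w w. coef (- \<mu>) j) = k"
      using weight_Z_w[OF root_uminus[OF \<mu>r]] by (metis of_int_eq_iff)
    then have "- \<mu> \<in> inversions w" using inversions_iff_Z_w[OF root_uminus[OF \<mu>r] c] assms by blast
    then have "\<gg> (- (- \<mu>)) \<subseteq> n_w w" by (rule root_space_n_w)
    then show ?thesis using v(1) \<mu>r unfolding minus_minus by blast
  qed (simp add: subspace_0[OF subspace_n_w])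
  then show "u \<in> n_w w" unfolding v(2) by (rule subspace_sum[OF subspace_n_w])
qed

lemma n_w_decomposition:
  assumes "x \<in> n_w w"
  shows "\<exists>v. (\<forall>k\<in>{0..a_w w}. v k \<in> bigrade w (-1) (- k)) \<and> x = (\<Sum>k\<in>{0..a_w w}. v k)"
proof -
  let ?d = "\<lambda>\<mu>. \<Sum>j\<in>J_w w. coef (- \<mu>) j"
  from span_UN_root_spaces[OF assms[unfolded n_w_eq]] obtain M v where M: "finite M"
    "M \<subseteq> uminus ` inversions w" "\<forall>\<mu>\<in>M. v \<mu> \<in> \<gg> \<mu>" "x = (\<Sum>\<mu>\<in>M. v \<mu>)"
    by blast
  have inv: "- \<mu> \<in> inversions w" if "\<mu> \<in> M" for \<mu>
  proof -
    obtain \<beta> where "\<beta> \<in> inversions w" "\<mu> = - \<beta>" using M(2) \<open>\<mu> \<in> M\<close> by blast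
    then show ?thesis by (simp only: minus_minus)
  qed
  have r: "- \<mu> \<in> pos" "- \<mu> \<in> roots H" "coef (- \<mu>) i = 1" if "\<mu> \<in> M" for \<mu>
    using inv[OF that] w_inversions_iff pos_root inversions_coef_i[OF w] by blast+
  have J: "j \<in> {1..n}" if "j \<in> J_w w" for j using that by (auto simp: J_w_def)
  \<comment> \<open>The lower end 0 comes from the nonnegative coefficients of the positive root
    \<open>- \<mu>\<close>, the upper end from the description of the inversions.\<close>
  have "?d \<mu> \<in> {0..a_w w}" if "\<mu> \<in> M" for \<mu>
    using inversions_iff_Z_w[OF r(2,3)[OF that]] inv[OF that] pos_coef[OF r(1)[OF that] J]
    by (auto intro: sum_nonneg)
  then have "(\<Sum>k\<in>{0..a_w w}. \<Sum>\<mu>\<in>{\<mu> \<in> M. ?d \<mu> = k}. v \<mu>) = x"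
    unfolding M(4) by (intro sum.group[OF M(1)]) auto
  moreover have "(\<Sum>\<mu>\<in>{\<mu> \<in> M. ?d \<mu> = k}. v \<mu>) \<in> bigrade w (-1) (- k)" for k
  proof (rule subspace_sum[OF subspace_bigrade])
    fix \<mu> assume \<mu>: "\<mu> \<in> {\<mu> \<in> M. ?d \<mu> = k}"
    then have "\<gg> (- (- \<mu>)) \<subseteq> bigrade w (-1) (- k)"
      using root_space_bigrade[OF r(2,3)] by blast
    then show "v \<mu> \<in> bigrade w (-1) (- k)" using M(3) \<mu> unfolding minus_minus by blast
  qed
  ultimately show ?thesis
    by (intro exI[of _ "\<lambda>k. \<Sum>\<mu>\<in>{\<mu> \<in> M. ?d \<mu> = k}. v \<mu>"]) simp
qed

lemma bigrade_independent:
  assumes "finite K" "\<forall>k\<in>K. v k \<in> bigrade w j (- k)" "(\<Sum>k\<in>K. v k) = 0" "k \<in> K"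
  shows "v k = 0"
proof -
  let ?c = "\<lambda>k::int. complex_of_int (- k)"
  have inj: "inj_on ?c K" by (auto simp: inj_on_def)
  \<comment> \<open>The family is reindexed by the eigenvalues \<open>- k\<close> of
    \<open>Z_w w\<close>, so that independence of eigenvectors applies.\<close>
  define v' where "v' c = v (the_inv_into K ?c c)" for c
  have v': "v' (?c k) = v k" if "k \<in> K" for k
    unfolding v'_def using the_inv_into_f_f[OF inj that] by simp
  have "v' (?c k) = 0"
  proof (rule eigenvectors_independent[of "?c ` K" "Z_w w"])
    show "bracket (Z_w w) (v' c) = c *\<^sub>C v' c" if "c \<in> ?c ` K" for c
    proof -
      obtain l where l: "l \<in> K" "c = ?c l" using \<open>c \<in> ?c ` K\<close> by blast
      then show ?thesis unfolding l(2) v'[OF l(1)] using assms(2) by (simp add: bigrade_def)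
    qed
    show "(\<Sum>c\<in>?c ` K. v' c) = 0"
      unfolding sum.reindex[OF inj] using assms(3) sum.cong[OF refl v', of K] by (simp add: comp_def)
  qed (use assms in auto)
  then show ?thesis using v'[OF assms(4)] by simp
qed

lemma n_w_direct_sum:
  "internal_direct_sum {0..a_w w} (\<lambda>k. bigrade w (-1) (- k)) (n_w w)"
  unfolding internal_direct_sum_def
proof (intro conjI allI impI ballI)
  let ?S = "{(\<Sum>k\<in>{0..a_w w}. v k) |v. \<forall>k\<in>{0..a_w w}. v k \<in> bigrade w (-1) (- k)}"
  show "n_w w = ?S"
  proof
    show "n_w w \<subseteq> ?S" using n_w_decomposition by blast
    show "?S \<subseteq> n_w w"
    proof
      fix x assume "x \<in> ?S"
      then obtain v where v: "\<forall>k\<in>{0..a_w w}. v k \<in> bigrade w (-1) (- k)" "x = (\<Sum>k\<in>{0..a_w w}. v k)"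
        by blast
      have "v k \<in> n_w w" if "k \<in> {0..a_w w}" for k
        using bigrade_n_w[of k] v(1) that by auto
      then show "x \<in> n_w w" unfolding v(2) by (rule subspace_sum[OF subspace_n_w])
    qed
  qed
qed (use bigrade_independent in blast)

end

end

theorem proposition3p9:
  fixes scale :: "complex \<Rightarrow> 'g::ab_group_add \<Rightarrow> 'g" and bracket :: "'g \<Rightarrow> 'g \<Rightarrow> 'g"
    and H :: "'g set" and n :: nat and \<alpha> :: "nat \<Rightarrow> 'g \<Rightarrow> complex"
    and Z :: "nat \<Rightarrow> 'g" and i :: nat
    and w :: "('g \<Rightarrow> complex) \<Rightarrow> ('g \<Rightarrow> complex)"
  assumes "hermitian_symmetric scale bracket H n \<alpha> Z i"
    and "w \<in> hermitian_symmetric.W_p scale bracket H n \<alpha> Z i"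
    and "hermitian_symmetric.schubert_proper scale bracket H n \<alpha> Z i w"
  shows "internal_direct_sum {0..hermitian_symmetric.a_w scale bracket H n \<alpha> Z i w}
    (\<lambda>k. hermitian_symmetric.bigrade scale bracket H n \<alpha> Z i w (-1) (- k))
    (hermitian_symmetric.n_w scale bracket H n \<alpha> w)"
proof -
  interpret hermitian_symmetric scale bracket H n \<alpha> Z i by fact
  have "inversions w \<noteq> {}" using inversions_nonempty assms(2,3) by (simp add: W_p_def)
  then show ?thesis by (rule n_w_direct_sum[OF assms(2)])
qed

end
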